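(* Let $S$ be a set of primes, $n\ge1$, $g,h\in S_0(\mathbb R^n)$, and $A_\infty\in GL_{2n}(\mathbb R)$. Let $A$ be the automorphism of $\mathbb A_{\mathbb Q,S}^{2n}$ given by $A(x_\infty,(x_p)_{p\in S})=(A_\infty x_\infty,(x_p)_{p\in S})$. Put $\tilde g=g\otimes\mathbb 1_{K}$ and $\tilde h=h\otimes\mathbb 1_K$ where $K=\prod_{p\in S}\mathbb Z_p^n\subseteq\mathbb Q_S^n$. Then $\tilde g,\tilde h\in S_0(\mathbb A_{\mathbb Q,S}^n)$, and the following are equivalent: (i) $\mathcal G(g,A_\infty\mathbb Z^{2n})$ and $\mathcal G(h,A_\infty\mathbb Z^{2n})$ are dual frames for $L^2(\mathbb R^n)$; (ii) $\mathcal G(\tilde g,A\,\mathbb Z[\frac1p:p\in S]^{2n})$ and $\mathcal G(\tilde h,A\,\mathbb Z[\frac1p:p\in S]^{2n})$ are dual frames for $L^2(\mathbb A_{\mathbb Q,S}^n)$.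
   Context: $\mathbb Q_S$ is the restricted product of $\mathbb Q_p$ ($p\in S$) with respect to $\mathbb Z_p$, $\mathbb A_{\mathbb Q,S}=\mathbb R\times\mathbb Q_S$, and $\mathbb Z[\frac1p:p\in S]$ is embedded diagonally. Haar measure on $\mathbb A_{\mathbb Q,S}^n$: Lebesgue measure on $\mathbb R^n$ times the Haar measure on $\mathbb Q_S^n$ giving $K$ measure $1$. Let $\chi(x_\infty,(x_p))=e^{2\pi i x_\infty}\prod_{p\in S}e^{-2\pi i\{x_p\}_p}$ ($\{\cdot\}_p$ the $p$-adic fractional part); the dual of $\mathbb A_{\mathbb Q,S}^n$ is identified with $\mathbb A_{\mathbb Q,S}^n$ via $y\mapsto\chi(\langle\cdot,y\rangle)$, so the time–frequency plane is $\mathbb A_{\mathbb Q,S}^{2n}$ and $\pi(x,y)f(t)=\chi(\langle y,t\rangle)f(t-x)$; on $\mathbb R^n$, $\pi(x,\omega)f(t)=e^{2\pi i\omega\cdot t}f(t-x)$, $(x,\omega)\in\mathbb R^{2n}$. $\mathcal G(g,\Delta)=\{\pi(z)g:z\in\Delta\}$. Two Gabor systems $\mathcal G(g,\Delta),\mathcal G(h,\Delta)$ are dual frames if both are frames and $\sum_{z\in\Delta}\langle f,\pi(z)g\rangle\pi(z)h=f$ for all $f$. $S_0(G)$ is the set of $f\in L^2(G)$ with $\int_{G\times\widehat G}|\langle f,\pi(z)f\rangle|dz<\infty$. *)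

theory Defs
  imports "HOL-Probability.Probability"
begin

definition L2 :: "'a measure \<Rightarrow> ('a \<Rightarrow> complex) set" where
  "L2 M = {f. f \<in> borel_measurable M \<and> integrable M (\<lambda>x. (norm (f x))\<^sup>2)}"

definition ip :: "'a measure \<Rightarrow> ('a \<Rightarrow> complex) \<Rightarrow> ('a \<Rightarrow> complex) \<Rightarrow> complex" where
  "ip M f g = (\<integral>x. f x * cnj (g x) \<partial>M)"

definition l2norm :: "'a measure \<Rightarrow> ('a \<Rightarrow> complex) \<Rightarrow> real" where
  "l2norm M f = sqrt (\<integral>x. (norm (f x))\<^sup>2 \<partial>M)"

definition S0 :: "'a measure \<Rightarrow> 'z measure \<Rightarrow> ('z \<Rightarrow> ('a \<Rightarrow> complex) \<Rightarrow> ('a \<Rightarrow> complex))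
                    \<Rightarrow> ('a \<Rightarrow> complex) set" where
  "S0 M TF tfs = {f \<in> L2 M. (\<integral>\<^sup>+ z. ennreal (norm (ip M f (tfs z f))) \<partial>TF) < \<infinity>}"

definition is_frame :: "'a measure \<Rightarrow> 'z set \<Rightarrow> ('z \<Rightarrow> ('a \<Rightarrow> complex)) \<Rightarrow> bool" where
  "is_frame M Lam phi \<longleftrightarrow> (\<forall>z\<in>Lam. phi z \<in> L2 M) \<and>
     (\<exists>a b. 0 < a \<and> 0 < b \<and> (\<forall>f\<in>L2 M.
        (\<lambda>z. (norm (ip M f (phi z)))\<^sup>2) summable_on Lam \<and>
        a * (l2norm M f)\<^sup>2 \<le> (\<Sum>\<^sub>\<infinity>z\<in>Lam. (norm (ip M f (phi z)))\<^sup>2) \<and>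
        (\<Sum>\<^sub>\<infinity>z\<in>Lam. (norm (ip M f (phi z)))\<^sup>2) \<le> b * (l2norm M f)\<^sup>2))"

definition dual_frames :: "'a measure \<Rightarrow> 'z set \<Rightarrow> ('z \<Rightarrow> ('a \<Rightarrow> complex))
                              \<Rightarrow> ('z \<Rightarrow> ('a \<Rightarrow> complex)) \<Rightarrow> bool" where
  "dual_frames M Lam phi psi \<longleftrightarrow> is_frame M Lam phi \<and> is_frame M Lam psi \<and>
     (\<forall>f\<in>L2 M. \<forall>e>0. \<exists>F0. finite F0 \<and> F0 \<subseteq> Lam \<and>
        (\<forall>F. finite F \<and> F0 \<subseteq> F \<and> F \<subseteq> Lam \<longrightarrow>
           l2norm M (\<lambda>t. f t - (\<Sum>z\<in>F. ip M f (phi z) * psi z t)) < e))"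

definition tfsR :: "((real^'n) \<times> (real^'n)) \<Rightarrow> (real^'n \<Rightarrow> complex) \<Rightarrow> (real^'n \<Rightarrow> complex)" where
  "tfsR z f = (\<lambda>t. cis (2 * pi * (snd z \<bullet> t)) * f (t - fst z))"

definition latR :: "((real^'n) \<times> (real^'n) \<Rightarrow> (real^'n) \<times> (real^'n)) \<Rightarrow> ((real^'n) \<times> (real^'n)) set" where
  "latR Ainf = {Ainf (k, l) | k l. (\<forall>i. k $ i \<in> \<int>) \<and> (\<forall>i. l $ i \<in> \<int>)}"

text \<open>An element x of Q_p is represented by the sequence c with c k the unique
  representative of x modulo p^k Z_p lying in Z[1/p] \<inter> [0, p^k).  In particular c 0 is the
  p-adic fractional part of x, and x \<in> Z_p iff c 0 = 0.\<close>

definition pmod :: "nat \<Rightarrow> nat \<Rightarrow> real \<Rightarrow> real" where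
  "pmod p k r = r - real p ^ k * of_int \<lfloor>r / real p ^ k\<rfloor>"

definition is_Qp :: "nat \<Rightarrow> (nat \<Rightarrow> real) \<Rightarrow> bool" where
  "is_Qp p c \<longleftrightarrow> (\<forall>k. 0 \<le> c k \<and> c k < real p ^ k) \<and>
     (\<exists>N::nat. \<forall>k. real p ^ N * c k \<in> \<int>) \<and>
     (\<forall>k. pmod p k (c (Suc k)) = c k)"

text \<open>Q_S^n: x p i is the i-th coordinate at the prime p; restricted product w.r.t. Z_p^n.\<close>
definition QSn :: "nat set \<Rightarrow> (nat \<Rightarrow> 'n \<Rightarrow> nat \<Rightarrow> real) set" where
  "QSn S = {x. (\<forall>p i. p \<notin> S \<longrightarrow> x p i = (\<lambda>k. 0)) \<and> (\<forall>p\<in>S. \<forall>i. is_Qp p (x p i)) \<and>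
               finite {p\<in>S. \<exists>i. x p i 0 \<noteq> 0}}"

definition KS :: "nat set \<Rightarrow> (nat \<Rightarrow> 'n \<Rightarrow> nat \<Rightarrow> real) set" where
  "KS S = {x \<in> QSn S. \<forall>p i. x p i 0 = 0}"

definition qp_sub :: "nat \<Rightarrow> (nat \<Rightarrow> real) \<Rightarrow> (nat \<Rightarrow> real) \<Rightarrow> (nat \<Rightarrow> real)" where
  "qp_sub p c d = (\<lambda>k. pmod p k (c k - d k))"

definition QS_sub :: "(nat \<Rightarrow> 'n \<Rightarrow> nat \<Rightarrow> real) \<Rightarrow> (nat \<Rightarrow> 'n \<Rightarrow> nat \<Rightarrow> real) \<Rightarrow> (nat \<Rightarrow> 'n \<Rightarrow> nat \<Rightarrow> real)" where
  "QS_sub x y = (\<lambda>p i. qp_sub p (x p i) (y p i))"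

text \<open>p-adic fractional part of a product c*d (= real fractional part of c_K d_K, K large).\<close>
definition fracmul :: "(nat \<Rightarrow> real) \<Rightarrow> (nat \<Rightarrow> real) \<Rightarrow> real" where
  "fracmul c d = (THE v. \<forall>\<^sub>F K in sequentially. frac (c K * d K) = v)"

definition frac_inner :: "('n::finite \<Rightarrow> nat \<Rightarrow> real) \<Rightarrow> ('n \<Rightarrow> nat \<Rightarrow> real) \<Rightarrow> real" where
  "frac_inner y t = frac (\<Sum>i\<in>UNIV. fracmul (y i) (t i))"

definition qp_of :: "nat \<Rightarrow> real \<Rightarrow> (nat \<Rightarrow> real)" where
  "qp_of p q = (\<lambda>k. THE c. 0 \<le> c \<and> c < real p ^ k \<and> (\<exists>N::nat. real p ^ N * c \<in> \<int>) \<and>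
                     (\<exists>a b::int. coprime b (int p) \<and> q - c = real p ^ k * (of_int a / of_int b)))"

definition embS :: "nat set \<Rightarrow> real^'n \<Rightarrow> (nat \<Rightarrow> 'n \<Rightarrow> nat \<Rightarrow> real)" where
  "embS S v = (\<lambda>p i. if p \<in> S then qp_of p (v $ i) else (\<lambda>k. 0))"

definition ZS :: "nat set \<Rightarrow> real set" where
  "ZS S = {of_int a / of_nat m | a m. m > 0 \<and> (\<forall>p. prime p \<and> p dvd m \<longrightarrow> p \<in> S)}"

text \<open>Q_S^n is the disjoint union of the translates F + K, F ranging over the countable set
  of "fractional parts"; K is parametrised by p-adic digits, with the product of uniform
  digit measures (so K has measure 1).\<close>
definition FrS :: "nat set \<Rightarrow> (nat \<Rightarrow> 'n \<Rightarrow> real) set" where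
  "FrS S = {F. (\<forall>p i. p \<notin> S \<longrightarrow> F p i = 0) \<and>
              (\<forall>p\<in>S. \<forall>i. 0 \<le> F p i \<and> F p i < 1 \<and> (\<exists>N::nat. real p ^ N * F p i \<in> \<int>)) \<and>
              finite {p. \<exists>i. F p i \<noteq> 0}}"

definition digit_index :: "nat set \<Rightarrow> (nat \<times> 'n \<times> nat) set" where
  "digit_index S = {(p, i, j). p \<in> S}"

definition digits_measure :: "nat set \<Rightarrow> (nat \<times> 'n \<times> nat \<Rightarrow> nat) measure" where
  "digits_measure S = (\<Pi>\<^sub>M pij\<in>digit_index S. uniform_count_measure {0..<fst pij})"

definition from_digits :: "nat set \<Rightarrow> (nat \<Rightarrow> 'n \<Rightarrow> real) \<times> (nat \<times> 'n \<times> nat \<Rightarrow> nat)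
                             \<Rightarrow> (nat \<Rightarrow> 'n \<Rightarrow> nat \<Rightarrow> real)" where
  "from_digits S Fd = (\<lambda>p i k. if p \<in> S then
       pmod p k (fst Fd p i + (\<Sum>j<k. real (snd Fd (p, i, j)) * real p ^ j)) else 0)"

definition QS_measure :: "nat set \<Rightarrow> (nat \<Rightarrow> 'n \<Rightarrow> nat \<Rightarrow> real) measure" where
  "QS_measure S = embed_measure (count_space (FrS S) \<Otimes>\<^sub>M digits_measure S) (from_digits S)"

definition AQ :: "nat set \<Rightarrow> ((real^'n) \<times> (nat \<Rightarrow> 'n \<Rightarrow> nat \<Rightarrow> real)) measure" where
  "AQ S = lborel \<Otimes>\<^sub>M QS_measure S"

type_synonym 'n adele = "(real^'n) \<times> (nat \<Rightarrow> 'n \<Rightarrow> nat \<Rightarrow> real)"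

text \<open>chi(<y,t>) = exp(2 pi i y_oo.t_oo) * prod_{p in S} exp(-2 pi i {<y_p,t_p>}_p);
  only finitely many factors differ from 1.\<close>
definition chi_inner :: "nat set \<Rightarrow> 'n::finite adele \<Rightarrow> 'n adele \<Rightarrow> complex" where
  "chi_inner S y t = cis (2 * pi * (fst y \<bullet> fst t)) *
     (\<Prod>p\<in>{p\<in>S. frac_inner (snd y p) (snd t p) \<noteq> 0}. cis (- 2 * pi * frac_inner (snd y p) (snd t p)))"

definition tfsA :: "nat set \<Rightarrow> ('n::finite adele \<times> 'n adele) \<Rightarrow> ('n adele \<Rightarrow> complex) \<Rightarrow> ('n adele \<Rightarrow> complex)" where
  "tfsA S z f = (\<lambda>t. chi_inner S (snd z) t * f (fst t - fst (fst z), QS_sub (snd t) (snd (fst z))))"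

definition latA :: "nat set \<Rightarrow> ((real^'n) \<times> (real^'n) \<Rightarrow> (real^'n) \<times> (real^'n)) \<Rightarrow> ('n adele \<times> 'n adele) set" where
  "latA S Ainf = {((fst (Ainf (k, l)), embS S k), (snd (Ainf (k, l)), embS S l)) | k l.
                   (\<forall>i. k $ i \<in> ZS S) \<and> (\<forall>i. l $ i \<in> ZS S)}"

definition tensor1K :: "nat set \<Rightarrow> (real^'n \<Rightarrow> complex) \<Rightarrow> ('n adele \<Rightarrow> complex)" where
  "tensor1K S g = (\<lambda>t. g (fst t) * indicator (KS S) (snd t))"

end

(* Put Gamma = Z[1/p : p in S]. Reducing both components of a point of Gamma^{2n} modulo Z^{2n}
   gives its pair c of fractional parts in (Q_S^n/K)^2, and the finite-adelic shifts of 1_K indexed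
   by such pairs are, up to unimodular constants, an orthonormal basis (w_c) of L^2(Q_S^n): the
   characters of the profinite group K, translated to the cosets of K. Hence, up to phases common
   to g and h, the adelic Gabor system is the union over c of the systems
   { U_c pi(z) g (x) w_c : z in A_oo Z^{2n} } with U_c a time-frequency shift of R^n. It is an
   orthogonal direct sum of unitary copies of the real Gabor system, so both are dual frames or
   neither is. The S_0 statement follows from the same orthogonality, which gives
   |<g~, pi(z) g~>| = |<g, pi(z_oo) g>| when the finite part of z lies in K x K, and 0 otherwise. *)

theory Submission
  imports Defs
begin

section \<open>Square-integrable functions\<close>

text \<open>The Haar measure on Q_S^n is given through its parametrisation by a fractional part and
  a family of digits, so the finite part is computed in these coordinates: on a coset of K a
  character is a constant times a finite product of single-digit exponentials, and orthonormality
  reduces to finite geometric sums. Completeness is the harder half: the characters span an algebra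
  containing the indicators of all one-digit cylinders (Fourier inversion on Z/p^N), and a pi-lambda
  argument makes it dense. The shift U_c is pi(A_oo k_c) for an arbitrarily chosen lift k_c of c to
  Gamma^{2n}; lifts exist by partial fractions, and two lifts of c differ by an element of Z^{2n}
  because an element of Gamma that is integral at every prime of S is an integer. When there are
  infinitely many c, convergence of the expansion in each summand does not by itself give
  convergence of the whole; the frame bounds control all but finitely many summands at once.\<close>

lemma L2_measurable: "f \<in> L2 M \<Longrightarrow> f \<in> borel_measurable M"
  and L2_integrable: "f \<in> L2 M \<Longrightarrow> integrable M (\<lambda>x. (norm (f x))\<^sup>2)"
  by (auto simp: L2_def)

text \<open>The congruence rules compare functions on the space of the measure only; the product
  formulas for the adelic vectors are established only there.\<close>

lemma L2_cong: "(\<And>x. x \<in> space M \<Longrightarrow> f x = g x) \<Longrightarrow> f \<in> L2 M \<longleftrightarrow> g \<in> L2 M"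
  unfolding L2_def mem_Collect_eq
  by (intro conj_cong measurable_cong Bochner_Integration.integrable_cong) auto

lemma ip_cong:
  "(\<And>x. x \<in> space M \<Longrightarrow> f x = f' x) \<Longrightarrow> (\<And>x. x \<in> space M \<Longrightarrow> g x = g' x) \<Longrightarrow> ip M f g = ip M f' g'"
  unfolding ip_def by (intro Bochner_Integration.integral_cong) auto

lemma l2norm_cong: "(\<And>x. x \<in> space M \<Longrightarrow> f x = g x) \<Longrightarrow> l2norm M f = l2norm M g"
  unfolding l2norm_def by (intro arg_cong[where f = sqrt] Bochner_Integration.integral_cong) auto

lemma l2norm_nonneg: "0 \<le> l2norm M f"
  by (simp add: l2norm_def)

lemma l2norm_sq: "(l2norm M f)\<^sup>2 = (\<integral>x. (norm (f x))\<^sup>2 \<partial>M)"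
  by (simp add: l2norm_def)

lemma ip_self: "ip M f f = of_real ((l2norm M f)\<^sup>2)"
  unfolding l2norm_sq ip_def complex_norm_square[symmetric] by (simp flip: of_real_power)

lemma ip_commute: "ip M g f = cnj (ip M f g)"
  unfolding ip_def by (simp flip: Bochner_Integration.integral_cnj add: mult.commute)

lemma norm_add_sq_le: "(norm (a + b :: complex))\<^sup>2 \<le> 2 * (norm a)\<^sup>2 + 2 * (norm b)\<^sup>2"
proof -
  have "(norm (a + b))\<^sup>2 \<le> (norm a + norm b)\<^sup>2"
    by (intro power_mono norm_triangle_ineq norm_ge_zero)
  moreover have "0 \<le> (norm a - norm b)\<^sup>2"
    by simp
  ultimately show ?thesis
    by (simp add: power2_sum power2_diff)
qed

lemma L2_add:
  assumes "f \<in> L2 M" "g \<in> L2 M"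
  shows "(\<lambda>x. f x + g x) \<in> L2 M"
proof -
  note [measurable] = assms[THEN L2_measurable]
  have "integrable M (\<lambda>x. (norm (f x + g x))\<^sup>2)"
  proof (rule Bochner_Integration.integrable_bound)
    show "integrable M (\<lambda>x. 2 * (norm (f x))\<^sup>2 + 2 * (norm (g x))\<^sup>2)"
      using assms[THEN L2_integrable] by simp
  qed (auto simp: norm_add_sq_le)
  then show ?thesis
    by (simp add: L2_def)
qed

lemma L2_cmult: "f \<in> L2 M \<Longrightarrow> (\<lambda>x. c * f x) \<in> L2 M"
  unfolding L2_def by (auto simp: norm_mult power_mult_distrib)

lemma L2_diff: "f \<in> L2 M \<Longrightarrow> g \<in> L2 M \<Longrightarrow> (\<lambda>x. f x - g x) \<in> L2 M"
  using L2_add[OF _ L2_cmult[of g M "-1"]] by simp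

lemma L2_zero: "(\<lambda>x. 0) \<in> L2 M"
  by (simp add: L2_def)

lemma L2_sum: "(\<And>i. i \<in> I \<Longrightarrow> f i \<in> L2 M) \<Longrightarrow> (\<lambda>x. \<Sum>i\<in>I. f i x) \<in> L2 M"
  by (induction I rule: infinite_finite_induct) (auto intro: L2_zero L2_add)

lemma borel_measurable_cnj [measurable]: "cnj \<in> borel_measurable borel"
  by (intro borel_measurable_continuous_onI continuous_on_cnj continuous_on_id)

lemma integrable_ip:
  assumes "f \<in> L2 M" "g \<in> L2 M"
  shows "integrable M (\<lambda>x. f x * cnj (g x))"
proof (rule Bochner_Integration.integrable_bound)
  show "integrable M (\<lambda>x. (norm (f x))\<^sup>2 + (norm (g x))\<^sup>2)"
    using assms by (auto dest: L2_integrable)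
  show "(\<lambda>x. f x * cnj (g x)) \<in> borel_measurable M"
    using assms[THEN L2_measurable] by measurable
  have "a * b \<le> a\<^sup>2 + b\<^sup>2" if "0 \<le> a" "0 \<le> b" for a b :: real
    using that sum_squares_bound[of a b] zero_le_mult_iff[of a b] by linarith
  then show "AE x in M. norm (f x * cnj (g x)) \<le> norm ((norm (f x))\<^sup>2 + (norm (g x))\<^sup>2)"
    by (auto simp: norm_mult)
qed

lemma ip_diff_left: "f \<in> L2 M \<Longrightarrow> f' \<in> L2 M \<Longrightarrow> g \<in> L2 M \<Longrightarrow> ip M (\<lambda>x. f x - f' x) g = ip M f g - ip M f' g"
  unfolding ip_def by (simp add: left_diff_distrib integrable_ip)

lemma ip_cmult_left: "ip M (\<lambda>x. c * f x) g = c * ip M f g"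
  unfolding ip_def by (simp add: mult.assoc)

lemma ip_cmult_right: "ip M f (\<lambda>x. c * g x) = cnj c * ip M f g"
  unfolding ip_def by (simp add: mult.left_commute)

lemma ip_sum_left:
  "(\<And>i. i \<in> I \<Longrightarrow> f i \<in> L2 M) \<Longrightarrow> g \<in> L2 M \<Longrightarrow> ip M (\<lambda>x. \<Sum>i\<in>I. f i x) g = (\<Sum>i\<in>I. ip M (f i) g)"
  unfolding ip_def by (simp add: sum_distrib_right integrable_ip)

lemma ip_diff_right: "f \<in> L2 M \<Longrightarrow> g \<in> L2 M \<Longrightarrow> g' \<in> L2 M \<Longrightarrow> ip M f (\<lambda>x. g x - g' x) = ip M f g - ip M f g'"
  by (subst (1 2 3) ip_commute) (simp add: ip_diff_left)

lemma l2norm_diff_sq_le: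
  assumes "f \<in> L2 M" "g \<in> L2 M"
  shows "(l2norm M (\<lambda>x. f x - g x))\<^sup>2 \<le> 2 * (l2norm M f)\<^sup>2 + 2 * (l2norm M g)\<^sup>2"
proof -
  have "(\<integral>x. (norm (f x - g x))\<^sup>2 \<partial>M) \<le> (\<integral>x. 2 * (norm (f x))\<^sup>2 + 2 * (norm (g x))\<^sup>2 \<partial>M)"
    using assms[THEN L2_integrable] L2_integrable[OF L2_diff[OF assms]] norm_add_sq_le[of "f _" "- g _"]
    by (intro integral_mono) auto
  then show ?thesis
    unfolding l2norm_sq using assms by (simp add: L2_integrable)
qed

text \<open>Testing against f and against g gives <f,f> = <g,f> and <f,g> = <g,g>. This serves for
  vectors that are known only through their inner products.\<close>

lemma l2norm_eq_of_ip_eq: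
  assumes f: "f \<in> L2 M" and g: "g \<in> L2 M"
    and eq: "\<And>h. h \<in> L2 M \<Longrightarrow> ip M f h = ip M g h"
  shows "l2norm M f = l2norm M g"
proof -
  have "ip M f f = ip M g f" "ip M f g = ip M g g"
    using eq f g by auto
  then have "ip M f f = cnj (ip M g g)"
    by (metis ip_commute)
  then have "(l2norm M f)\<^sup>2 = (l2norm M g)\<^sup>2"
    unfolding ip_self complex_cnj_complex_of_real of_real_eq_iff .
  then show ?thesis
    using l2norm_nonneg by (metis power2_eq_iff_nonneg)
qed

text \<open>The adjoint of an analysis operator obeys the same bound: the squared norm of the sum s
  pairs the \<open>a z\<close> with the coefficients of s, and the Bessel bound is applied to s
  itself.\<close>

lemma bessel_synthesis_bound:
  assumes fin: "finite F" and phi: "\<And>z. z \<in> F \<Longrightarrow> phi z \<in> L2 M" and b: "0 < b"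
    and bessel: "\<And>f. f \<in> L2 M \<Longrightarrow> (\<Sum>z\<in>F. (norm (ip M f (phi z)))\<^sup>2) \<le> b * (l2norm M f)\<^sup>2"
  shows "(l2norm M (\<lambda>t. \<Sum>z\<in>F. a z * phi z t))\<^sup>2 \<le> b * (\<Sum>z\<in>F. (norm (a z))\<^sup>2)"
proof -
  define s where "s = (\<lambda>t. \<Sum>z\<in>F. a z * phi z t)"
  have s: "s \<in> L2 M"
    unfolding s_def by (intro L2_sum L2_cmult phi)
  \<comment> \<open>The weight \<open>b\<close> is chosen so that the Bessel bound turns the second
    term into half of the squared norm of s, which the left-hand side absorbs.\<close>
  have amgm: "x * y \<le> b * x\<^sup>2 / 2 + y\<^sup>2 / (2 * b)" for x y :: real
  proof -
    have "0 \<le> (b * x - y)\<^sup>2 / (2 * b)"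
      using b by simp
    also have "\<dots> = b * x\<^sup>2 / 2 + y\<^sup>2 / (2 * b) - x * y"
      using b by (simp add: field_simps power2_eq_square)
    finally show ?thesis by simp
  qed
  have "ip M s s = (\<Sum>z\<in>F. a z * ip M (phi z) s)"
    unfolding s_def by (subst ip_sum_left) (auto intro!: L2_cmult phi L2_sum simp: ip_cmult_left)
  moreover have "(l2norm M s)\<^sup>2 = norm (ip M s s)"
    by (simp only: ip_self norm_of_real abs_power2)
  ultimately have "(l2norm M s)\<^sup>2 \<le> (\<Sum>z\<in>F. norm (a z) * norm (ip M s (phi z)))"
    by (smt (verit, best) complex_mod_cnj ip_commute norm_mult norm_sum sum.cong)
  also have "\<dots> \<le> (\<Sum>z\<in>F. b * (norm (a z))\<^sup>2 / 2 + (norm (ip M s (phi z)))\<^sup>2 / (2 * b))"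
    by (intro sum_mono amgm)
  also have "\<dots> = b * (\<Sum>z\<in>F. (norm (a z))\<^sup>2) / 2 + (\<Sum>z\<in>F. (norm (ip M s (phi z)))\<^sup>2) / (2 * b)"
    by (simp add: sum.distrib sum_divide_distrib sum_distrib_left)
  also have "\<dots> \<le> b * (\<Sum>z\<in>F. (norm (a z))\<^sup>2) / 2 + (b * (l2norm M s)\<^sup>2) / (2 * b)"
    using b by (intro add_left_mono divide_right_mono bessel s) auto
  finally show ?thesis
    using b unfolding s_def[symmetric] by simp
qed

section \<open>Transfer of dual frames along an orthogonal decomposition\<close>

text \<open>The coefficient carries \<open>cnj (u z)\<close> and the synthesis vector carries
  \<open>u z\<close>, so a unimodular phase shared by both systems cancels in the expansion, while
  the frame inequalities see only absolute values.\<close>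

lemma dual_frames_reindex:
  fixes \<theta> :: "'z \<Rightarrow> 'y"
  assumes bij: "bij_betw \<theta> Lam' Lam"
    and u: "\<And>z. z \<in> Lam' \<Longrightarrow> norm (u z) = 1"
    and phi: "\<And>z t. z \<in> Lam' \<Longrightarrow> t \<in> space N \<Longrightarrow> phi' z t = u z * phi (\<theta> z) t"
    and psi: "\<And>z t. z \<in> Lam' \<Longrightarrow> t \<in> space N \<Longrightarrow> psi' z t = u z * psi (\<theta> z) t"
  shows "dual_frames N Lam' phi' psi' \<longleftrightarrow> dual_frames N Lam phi psi"
proof -
  have u0: "u z \<noteq> 0" "cnj (u z) * u z = 1" if "z \<in> Lam'" for z
    using u[OF that] by (auto simp: complex_norm_square[symmetric] mult.commute)
  have L2_phase: "chi' z \<in> L2 N \<longleftrightarrow> chi (\<theta> z) \<in> L2 N"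
    if "z \<in> Lam'" "\<And>t. t \<in> space N \<Longrightarrow> chi' z t = u z * chi (\<theta> z) t" for z chi chi'
  proof -
    have "chi' z \<in> L2 N \<longleftrightarrow> (\<lambda>t. u z * chi (\<theta> z) t) \<in> L2 N"
      by (rule L2_cong) (use that in auto)
    also have "\<dots> \<longleftrightarrow> chi (\<theta> z) \<in> L2 N"
      using L2_cmult[of "chi (\<theta> z)" N "u z"] L2_cmult[of "\<lambda>t. u z * chi (\<theta> z) t" N "cnj (u z)"] u0[OF that(1)]
      by (auto simp flip: mult.assoc)
    finally show ?thesis .
  qed
  have ip_phase: "ip N f (chi' z) = cnj (u z) * ip N f (chi (\<theta> z))"
    if "z \<in> Lam'" "\<And>t. t \<in> space N \<Longrightarrow> chi' z t = u z * chi (\<theta> z) t" for f z chi chi'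
    unfolding ip_cmult_right[symmetric] by (rule ip_cong) (use that in auto)
  have frame: "is_frame N Lam' chi' \<longleftrightarrow> is_frame N Lam chi"
    if chi: "\<And>z t. z \<in> Lam' \<Longrightarrow> t \<in> space N \<Longrightarrow> chi' z t = u z * chi (\<theta> z) t" for chi chi'
  proof -
    have "(\<forall>z\<in>Lam'. chi' z \<in> L2 N) \<longleftrightarrow> (\<forall>z\<in>Lam. chi z \<in> L2 N)"
      using bij L2_phase[of _ chi' chi] chi by (auto simp: bij_betw_def)
    moreover have "(norm (ip N f (chi' z)))\<^sup>2 = (norm (ip N f (chi (\<theta> z))))\<^sup>2" if "z \<in> Lam'" for f z
      using ip_phase[of z chi' chi f, OF that chi[OF that]] u[OF that] by (simp add: norm_mult)
    then have "(\<lambda>z. (norm (ip N f (chi' z)))\<^sup>2) summable_on Lam' \<longleftrightarrow> (\<lambda>z. (norm (ip N f (chi z)))\<^sup>2) summable_on Lam"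
      "(\<Sum>\<^sub>\<infinity>z\<in>Lam'. (norm (ip N f (chi' z)))\<^sup>2) = (\<Sum>\<^sub>\<infinity>z\<in>Lam. (norm (ip N f (chi z)))\<^sup>2)" for f
      using summable_on_reindex_bij_betw[OF bij, of "\<lambda>z. (norm (ip N f (chi z)))\<^sup>2"]
        infsum_reindex_bij_betw[OF bij, of "\<lambda>z. (norm (ip N f (chi z)))\<^sup>2"]
      by (auto cong: summable_on_cong infsum_cong)
    ultimately show ?thesis
      unfolding is_frame_def by simp
  qed
  have term_eq: "l2norm N (\<lambda>t. f t - (\<Sum>z\<in>F. ip N f (phi' z) * psi' z t))
      = l2norm N (\<lambda>t. f t - (\<Sum>z\<in>\<theta> ` F. ip N f (phi z) * psi z t))" if F: "F \<subseteq> Lam'" for f F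
  proof (rule l2norm_cong)
    fix t assume t: "t \<in> space N"
    have "(\<Sum>z\<in>\<theta> ` F. ip N f (phi z) * psi z t) = (\<Sum>z\<in>F. ip N f (phi (\<theta> z)) * psi (\<theta> z) t)"
      using bij F by (subst sum.reindex) (auto simp: bij_betw_def intro: inj_on_subset)
    also have "\<dots> = (\<Sum>z\<in>F. ip N f (phi' z) * psi' z t)"
    proof (rule sum.cong)
      fix z assume "z \<in> F"
      then have z: "z \<in> Lam'" using F by auto
      have "ip N f (phi' z) * psi' z t = (cnj (u z) * u z) * (ip N f (phi (\<theta> z)) * psi (\<theta> z) t)"
        using ip_phase[of z phi' phi f] z phi psi[OF z t] by (simp add: mult_ac)
      then show "ip N f (phi (\<theta> z)) * psi (\<theta> z) t = ip N f (phi' z) * psi' z t"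
        using u0[OF z] by simp
    qed simp
    finally show "f t - (\<Sum>z\<in>F. ip N f (phi' z) * psi' z t) = f t - (\<Sum>z\<in>\<theta> ` F. ip N f (phi z) * psi z t)"
      by simp
  qed
  \<comment> \<open>Unconditional convergence is a statement about finite index sets directed by
    inclusion; a bijection carries this directed set to that of the other index set.\<close>
  have Fin_image: "(\<exists>F0. finite F0 \<and> F0 \<subseteq> Lam' \<and> (\<forall>F. finite F \<and> F0 \<subseteq> F \<and> F \<subseteq> Lam' \<longrightarrow> Q (\<theta> ` F)))
     \<longleftrightarrow> (\<exists>F0. finite F0 \<and> F0 \<subseteq> Lam \<and> (\<forall>F. finite F \<and> F0 \<subseteq> F \<and> F \<subseteq> Lam \<longrightarrow> Q F))" (is "?L \<longleftrightarrow> ?R") for Q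
  proof -
    define \<eta> where "\<eta> = the_inv_into Lam' \<theta>"
    have inj: "inj_on \<theta> Lam'" and img: "\<theta> ` Lam' = Lam"
      using bij by (auto simp: bij_betw_def)
    have \<eta>: "\<theta> ` (\<eta> ` F) = F" "\<eta> ` F \<subseteq> Lam'" if "F \<subseteq> Lam" for F
      using that inj img unfolding \<eta>_def
      by (auto simp: image_image f_the_inv_into_f subset_iff the_inv_into_into cong: image_cong)
    have \<eta>': "\<eta> ` (\<theta> ` F) = F" if "F \<subseteq> Lam'" for F
      using that inj unfolding \<eta>_def by (auto simp: image_image the_inv_into_f_f subset_iff cong: image_cong)
    show ?thesis
    proof
      assume ?L
      then obtain F0 where F0: "finite F0" "F0 \<subseteq> Lam'" and
        "\<forall>F. finite F \<and> F0 \<subseteq> F \<and> F \<subseteq> Lam' \<longrightarrow> Q (\<theta> ` F)" by (elim exE conjE)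
      then have Q: "\<And>F. finite F \<Longrightarrow> F0 \<subseteq> F \<Longrightarrow> F \<subseteq> Lam' \<Longrightarrow> Q (\<theta> ` F)" by simp
      have "Q F" if "finite F" "\<theta> ` F0 \<subseteq> F" "F \<subseteq> Lam" for F
      proof -
        have "F0 \<subseteq> \<eta> ` F"
          using image_mono[OF that(2), of \<eta>] \<eta>'[OF F0(2)] by simp
        then have "Q (\<theta> ` (\<eta> ` F))"
          using \<eta>(2)[OF that(3)] that(1) by (intro Q) simp_all
        then show ?thesis
          using \<eta>(1)[OF that(3)] by simp
      qed
      then show ?R
        using F0 image_mono[OF F0(2), of \<theta>] img by (intro exI[of _ "\<theta> ` F0"]) simp
    next
      assume ?R
      then obtain F0 where F0: "finite F0" "F0 \<subseteq> Lam" and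
        "\<forall>F. finite F \<and> F0 \<subseteq> F \<and> F \<subseteq> Lam \<longrightarrow> Q F" by (elim exE conjE)
      then have Q: "\<And>F. finite F \<Longrightarrow> F0 \<subseteq> F \<Longrightarrow> F \<subseteq> Lam \<Longrightarrow> Q F" by simp
      have "Q (\<theta> ` F)" if "finite F" "\<eta> ` F0 \<subseteq> F" "F \<subseteq> Lam'" for F
      proof (rule Q)
        show "F0 \<subseteq> \<theta> ` F"
          using image_mono[OF that(2), of \<theta>] \<eta>(1)[OF F0(2)] by simp
        show "\<theta> ` F \<subseteq> Lam"
          using image_mono[OF that(3), of \<theta>] img by simp
      qed (use that in simp)
      then show ?L
        using F0 \<eta>(2)[OF F0(2)] by (intro exI[of _ "\<eta> ` F0"]) simp
    qed
  qed
  have "(\<exists>F0. finite F0 \<and> F0 \<subseteq> Lam' \<and> (\<forall>F. finite F \<and> F0 \<subseteq> F \<and> F \<subseteq> Lam' \<longrightarrow>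
           l2norm N (\<lambda>t. f t - (\<Sum>z\<in>F. ip N f (phi' z) * psi' z t)) < e))
     \<longleftrightarrow> (\<exists>F0. finite F0 \<and> F0 \<subseteq> Lam \<and> (\<forall>F. finite F \<and> F0 \<subseteq> F \<and> F \<subseteq> Lam \<longrightarrow>
           l2norm N (\<lambda>t. f t - (\<Sum>z\<in>F. ip N f (phi z) * psi z t)) < e))" for f e
    using Fin_image[of "\<lambda>F. l2norm N (\<lambda>t. f t - (\<Sum>z\<in>F. ip N f (phi z) * psi z t)) < e"] term_eq[of _ f]
    by simp
  moreover have "is_frame N Lam' phi' \<longleftrightarrow> is_frame N Lam phi" "is_frame N Lam' psi' \<longleftrightarrow> is_frame N Lam psi"
    by (intro frame phi psi; assumption)+
  ultimately show ?thesis
    unfolding dual_frames_def by simp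
qed

text \<open>Each \<open>J c\<close> embeds L^2(M) isometrically, images for different c are
  orthogonal, \<open>P c\<close> is the adjoint of \<open>J c\<close>, and \<open>parseval\<close>
  says that the images together span L^2(N). Functions are not identified modulo null sets, so
  linearity of J is required pointwise, while P is governed by inner products and norms. The
  summation index in \<open>J_sum\<close> has a type \<open>'i\<close> that is a parameter of the
  locale, since locale assumptions are monomorphic.\<close>

locale orthogonal_decomposition =
  fixes M :: "'a measure" and N :: "'b measure" and C :: "'c set"
    and J :: "'c \<Rightarrow> ('a \<Rightarrow> complex) \<Rightarrow> ('b \<Rightarrow> complex)"
    and P :: "'c \<Rightarrow> ('b \<Rightarrow> complex) \<Rightarrow> ('a \<Rightarrow> complex)"
  assumes J_L2: "c \<in> C \<Longrightarrow> f \<in> L2 M \<Longrightarrow> J c f \<in> L2 N"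
    and P_L2: "c \<in> C \<Longrightarrow> F \<in> L2 N \<Longrightarrow> P c F \<in> L2 M"
    and J_diff: "J c (\<lambda>x. f x - f' x) t = J c f t - J c f' t"
    and J_sum: "J c (\<lambda>x. \<Sum>i\<in>I. a i * g i x) t = (\<Sum>i\<in>(I :: 'i set). a i * J c (g i) t)"
    and J_orth: "c \<in> C \<Longrightarrow> c' \<in> C \<Longrightarrow> f \<in> L2 M \<Longrightarrow> f' \<in> L2 M \<Longrightarrow>
        ip N (J c f) (J c' f') = (if c = c' then ip M f f' else 0)"
    and adj: "c \<in> C \<Longrightarrow> F \<in> L2 N \<Longrightarrow> f \<in> L2 M \<Longrightarrow> ip N F (J c f) = ip M (P c F) f"
    and parseval: "F \<in> L2 N \<Longrightarrow> ((\<lambda>c. (l2norm M (P c F))\<^sup>2) has_sum (l2norm N F)\<^sup>2) C"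
begin

lemma l2norm_J: "c \<in> C \<Longrightarrow> f \<in> L2 M \<Longrightarrow> l2norm N (J c f) = l2norm M f"
  using J_orth[of c c f f] l2norm_nonneg unfolding ip_self
  by (metis of_real_eq_iff power2_eq_iff_nonneg)

text \<open>The ranges of the other \<open>J c'\<close> are orthogonal to that of
  \<open>J c\<close>, so only the slice of G over c survives. \<open>P c\<close> is not assumed
  linear; both sides are compared weakly, through the adjoint relation and
  \<open>l2norm_eq_of_ip_eq\<close>.\<close>

lemma l2norm_P_residual:
  fixes Lam :: "'i set" and phi :: "'i \<Rightarrow> 'a \<Rightarrow> complex"
  assumes c: "c \<in> C" and F: "F \<in> L2 N" and G: "finite G" "G \<subseteq> C \<times> Lam"
    and psi: "\<And>l. l \<in> Lam \<Longrightarrow> psi l \<in> L2 M"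
  shows "l2norm M (P c (\<lambda>t. F t - (\<Sum>z\<in>G. a z * J (fst z) (psi (snd z)) t)))
    = l2norm M (\<lambda>x. P c F x - (\<Sum>l\<in>{l. (c, l) \<in> G}. a (c, l) * psi l x))"
proof (rule l2norm_eq_of_ip_eq)
  have GL: "(\<lambda>t. a z * J (fst z) (psi (snd z)) t) \<in> L2 N" if "z \<in> G" for z
    using that G psi by (intro L2_cmult J_L2) auto
  have R: "(\<lambda>t. F t - (\<Sum>z\<in>G. a z * J (fst z) (psi (snd z)) t)) \<in> L2 N"
    by (intro L2_diff F L2_sum GL)
  then show "P c (\<lambda>t. F t - (\<Sum>z\<in>G. a z * J (fst z) (psi (snd z)) t)) \<in> L2 M"
    by (intro P_L2 c)
  have GM: "(\<lambda>t. a (c, l) * psi l t) \<in> L2 M" if "l \<in> {l. (c, l) \<in> G}" for l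
    using that G psi by (intro L2_cmult) auto
  show "(\<lambda>x. P c F x - (\<Sum>l\<in>{l. (c, l) \<in> G}. a (c, l) * psi l x)) \<in> L2 M"
    by (intro L2_diff P_L2 c F L2_sum GM)
  fix f assume f: "f \<in> L2 M"
  have fin: "finite {l. (c, l) \<in> G}"
    using finite_vimageI[OF G(1), of "Pair c"] by (simp add: vimage_def inj_on_def)
  have "ip M (P c (\<lambda>t. F t - (\<Sum>z\<in>G. a z * J (fst z) (psi (snd z)) t))) f
    = ip N F (J c f) - (\<Sum>z\<in>G. a z * ip N (J (fst z) (psi (snd z))) (J c f))"
    unfolding adj[OF c R f, symmetric]
    by (subst ip_diff_left, (intro F J_L2 c f L2_sum GL; simp)+, subst ip_sum_left)
       (auto intro!: GL J_L2 c f simp: ip_cmult_left)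
  also have "(\<Sum>z\<in>G. a z * ip N (J (fst z) (psi (snd z))) (J c f))
    = (\<Sum>z\<in>Pair c ` {l. (c, l) \<in> G}. a z * ip M (psi (snd z)) f)"
  proof (rule sum.mono_neutral_cong_right)
    show "\<forall>z\<in>G - Pair c ` {l. (c, l) \<in> G}. a z * ip N (J (fst z) (psi (snd z))) (J c f) = 0"
      using G psi c f by (auto simp: J_orth subset_iff split: if_splits)
  next
    fix z assume "z \<in> Pair c ` {l. (c, l) \<in> G}"
    then show "a z * ip N (J (fst z) (psi (snd z))) (J c f) = a z * ip M (psi (snd z)) f"
      using G psi c f by (auto simp: J_orth subset_iff)
  qed (use G in auto)
  also have "\<dots> = (\<Sum>l\<in>{l. (c, l) \<in> G}. a (c, l) * ip M (psi l) f)"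
    by (subst sum.reindex) (auto simp: inj_on_def)
  finally show "ip M (P c (\<lambda>t. F t - (\<Sum>z\<in>G. a z * J (fst z) (psi (snd z)) t))) f
     = ip M (\<lambda>x. P c F x - (\<Sum>l\<in>{l. (c, l) \<in> G}. a (c, l) * psi l x)) f"
    unfolding adj[OF c F f]
    by (subst ip_diff_left, (intro P_L2 F c f L2_sum GM; simp)+, subst ip_sum_left)
       (auto intro!: GM[simplified] f simp: ip_cmult_left)
qed

text \<open>The coefficients of F at (c, l) are those of \<open>P c F\<close> at l. Summing over l
  first gives the frame inequalities for \<open>P c F\<close>; summing over c then yields the norm
  of F by Parseval, so the bounds a and b are unchanged.\<close>

lemma is_frame_lift:
  fixes Lam :: "'i set"
  assumes fr: "is_frame M Lam phi"
  shows "is_frame N (C \<times> Lam) (\<lambda>(c, l). J c (phi l))"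
proof -
  from fr obtain a b where phi: "\<And>l. l \<in> Lam \<Longrightarrow> phi l \<in> L2 M" and ab: "0 < a" "0 < b"
    and summ: "\<And>f. f \<in> L2 M \<Longrightarrow> (\<lambda>l. (norm (ip M f (phi l)))\<^sup>2) summable_on Lam"
    and lo: "\<And>f. f \<in> L2 M \<Longrightarrow> a * (l2norm M f)\<^sup>2 \<le> (\<Sum>\<^sub>\<infinity>l\<in>Lam. (norm (ip M f (phi l)))\<^sup>2)"
    and up: "\<And>f. f \<in> L2 M \<Longrightarrow> (\<Sum>\<^sub>\<infinity>l\<in>Lam. (norm (ip M f (phi l)))\<^sup>2) \<le> b * (l2norm M f)\<^sup>2"
    unfolding is_frame_def by auto
  have "(\<lambda>z. (norm (ip N F (case z of (c, l) \<Rightarrow> J c (phi l))))\<^sup>2) summable_on C \<times> Lam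
     \<and> a * (l2norm N F)\<^sup>2 \<le> (\<Sum>\<^sub>\<infinity>z\<in>C \<times> Lam. (norm (ip N F (case z of (c, l) \<Rightarrow> J c (phi l))))\<^sup>2)
     \<and> (\<Sum>\<^sub>\<infinity>z\<in>C \<times> Lam. (norm (ip N F (case z of (c, l) \<Rightarrow> J c (phi l))))\<^sup>2) \<le> b * (l2norm N F)\<^sup>2"
    if F: "F \<in> L2 N" for F
  proof (intro conjI)
    define s where "s c = (\<Sum>\<^sub>\<infinity>l\<in>Lam. (norm (ip M (P c F) (phi l)))\<^sup>2)" for c
    define T where "T z = (norm (ip N F (case z of (c, l) \<Rightarrow> J c (phi l))))\<^sup>2" for z
    have T: "T (c, l) = (norm (ip M (P c F) (phi l)))\<^sup>2" if "c \<in> C" "l \<in> Lam" for c l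
      unfolding T_def using that phi F by (simp add: adj)
    have inner: "((\<lambda>l. T (c, l)) has_sum s c) Lam" if c: "c \<in> C" for c
      using has_sum_infsum[OF summ[OF P_L2[OF c F]]] T[OF c]
      unfolding s_def by (simp cong: has_sum_cong)
    have s0: "0 \<le> s c" for c unfolding s_def by (rule infsum_nonneg) simp
    have sb: "s c \<le> b * (l2norm M (P c F))\<^sup>2" "a * (l2norm M (P c F))\<^sup>2 \<le> s c" if "c \<in> C" for c
      unfolding s_def using up lo P_L2[OF that F] by auto
    have pb: "((\<lambda>c. k * (l2norm M (P c F))\<^sup>2) has_sum k * (l2norm N F)\<^sup>2) C" for k
      by (rule has_sum_cmult_right[OF parseval[OF F]])
    have ss: "s summable_on C"
      by (rule summable_on_comparison_test[OF has_sum_imp_summable[OF pb[of b]]]) (use sb s0 in auto)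
    have hs: "(T has_sum infsum s C) (C \<times> Lam)"
    proof (rule has_sum_SigmaI[OF inner has_sum_infsum[OF ss]])
      show "T summable_on C \<times> Lam"
        by (rule summable_on_SigmaI[OF inner ss]) (auto simp: T_def)
    qed auto
    show "(\<lambda>z. (norm (ip N F (case z of (c, l) \<Rightarrow> J c (phi l))))\<^sup>2) summable_on C \<times> Lam"
      using has_sum_imp_summable[OF hs] unfolding T_def .
    show "a * (l2norm N F)\<^sup>2 \<le> (\<Sum>\<^sub>\<infinity>z\<in>C \<times> Lam. (norm (ip N F (case z of (c, l) \<Rightarrow> J c (phi l))))\<^sup>2)"
      using has_sum_mono[OF pb has_sum_infsum[OF ss] sb(2)] infsumI[OF hs] unfolding T_def by simp
    show "(\<Sum>\<^sub>\<infinity>z\<in>C \<times> Lam. (norm (ip N F (case z of (c, l) \<Rightarrow> J c (phi l))))\<^sup>2) \<le> b * (l2norm N F)\<^sup>2"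
      using has_sum_mono[OF has_sum_infsum[OF ss] pb sb(1)] infsumI[OF hs] unfolding T_def by simp
  qed
  moreover have "\<forall>z\<in>C \<times> Lam. (case z of (c, l) \<Rightarrow> J c (phi l)) \<in> L2 N"
    using phi by (auto intro: J_L2)
  ultimately show ?thesis
    unfolding is_frame_def using ab by blast
qed

text \<open>Testing on \<open>J c0 f\<close> kills every coefficient outside the row of c0 and
  reproduces those of f in it. Membership of \<open>phi l\<close> in L^2(M) is a separate
  hypothesis, because \<open>J_L2\<close> transfers it in one direction only.\<close>

lemma is_frame_restrict:
  fixes Lam :: "'i set"
  assumes c0: "c0 \<in> C" and phi: "\<And>l. l \<in> Lam \<Longrightarrow> phi l \<in> L2 M"
    and fr: "is_frame N (C \<times> Lam) (\<lambda>(c, l). J c (phi l))"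
  shows "is_frame M Lam phi"
proof -
  from fr obtain a b where ab: "0 < a" "0 < b"
    and fr': "\<And>F. F \<in> L2 N \<Longrightarrow> (\<lambda>z. (norm (ip N F (case z of (c, l) \<Rightarrow> J c (phi l))))\<^sup>2) summable_on C \<times> Lam
     \<and> a * (l2norm N F)\<^sup>2 \<le> (\<Sum>\<^sub>\<infinity>z\<in>C \<times> Lam. (norm (ip N F (case z of (c, l) \<Rightarrow> J c (phi l))))\<^sup>2)
     \<and> (\<Sum>\<^sub>\<infinity>z\<in>C \<times> Lam. (norm (ip N F (case z of (c, l) \<Rightarrow> J c (phi l))))\<^sup>2) \<le> b * (l2norm N F)\<^sup>2"
    unfolding is_frame_def by auto
  have "(\<lambda>l. (norm (ip M f (phi l)))\<^sup>2) summable_on Lam \<and>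
      a * (l2norm M f)\<^sup>2 \<le> (\<Sum>\<^sub>\<infinity>l\<in>Lam. (norm (ip M f (phi l)))\<^sup>2) \<and>
      (\<Sum>\<^sub>\<infinity>l\<in>Lam. (norm (ip M f (phi l)))\<^sup>2) \<le> b * (l2norm M f)\<^sup>2" if f: "f \<in> L2 M" for f
  proof -
    define T where "T z = (norm (ip N (J c0 f) (case z of (c, l) \<Rightarrow> J c (phi l))))\<^sup>2" for z
    have T: "T z = (if fst z = c0 then (norm (ip M f (phi (snd z))))\<^sup>2 else 0)" if "z \<in> C \<times> Lam" for z
      unfolding T_def using that phi f c0 by (auto simp: J_orth)
    have bij: "bij_betw (Pair c0) Lam ({c0} \<times> Lam)"
      by (auto simp: bij_betw_def inj_on_def)
    have "T z = 0" if "z \<in> C \<times> Lam - {c0} \<times> Lam" for z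
      using T[of z] that by auto
    moreover have "{c0} \<times> Lam \<subseteq> C \<times> Lam"
      using c0 by auto
    ultimately have eq: "T summable_on C \<times> Lam \<longleftrightarrow> T summable_on {c0} \<times> Lam" "infsum T (C \<times> Lam) = infsum T ({c0} \<times> Lam)"
      by (intro summable_on_cong_neutral infsum_cong_neutral; blast)+
    have eq': "T summable_on {c0} \<times> Lam \<longleftrightarrow> (\<lambda>l. (norm (ip M f (phi l)))\<^sup>2) summable_on Lam"
      "infsum T ({c0} \<times> Lam) = (\<Sum>\<^sub>\<infinity>l\<in>Lam. (norm (ip M f (phi l)))\<^sup>2)"
      using summable_on_reindex_bij_betw[OF bij, of T] infsum_reindex_bij_betw[OF bij, of T] T c0
      by (auto cong: summable_on_cong infsum_cong)
    show ?thesis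
      using fr'[OF J_L2[OF c0 f]] eq eq' unfolding T_def by (simp add: l2norm_J c0 f)
  qed
  with ab phi show ?thesis
    unfolding is_frame_def by blast
qed

text \<open>C is split into a finite set C0, where the given expansions are close to their limits,
  and the rest, where the residuals are merely bounded. The latter bound must be uniform in the
  finite index set over which one sums; it comes from the Bessel bounds of both systems.\<close>

lemma dual_frames_lift:
  fixes Lam :: "'i set"
  assumes du: "dual_frames M Lam phi psi"
  shows "dual_frames N (C \<times> Lam) (\<lambda>(c, l). J c (phi l)) (\<lambda>(c, l). J c (psi l))"
proof -
  have fr: "is_frame M Lam phi" "is_frame M Lam psi"
    and rec: "\<And>f e. f \<in> L2 M \<Longrightarrow> 0 < e \<Longrightarrow> \<exists>F0. finite F0 \<and> F0 \<subseteq> Lam \<and>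
        (\<forall>F. finite F \<and> F0 \<subseteq> F \<and> F \<subseteq> Lam \<longrightarrow>
           l2norm M (\<lambda>t. f t - (\<Sum>z\<in>F. ip M f (phi z) * psi z t)) < e)"
    using du unfolding dual_frames_def by auto
  from fr(1) obtain b where phi: "\<And>l. l \<in> Lam \<Longrightarrow> phi l \<in> L2 M" and b: "0 < b"
    and b': "\<And>f. f \<in> L2 M \<Longrightarrow> (\<lambda>l. (norm (ip M f (phi l)))\<^sup>2) summable_on Lam \<and>
       (\<Sum>\<^sub>\<infinity>l\<in>Lam. (norm (ip M f (phi l)))\<^sup>2) \<le> b * (l2norm M f)\<^sup>2"
    unfolding is_frame_def by auto
  from fr(2) obtain d where psi: "\<And>l. l \<in> Lam \<Longrightarrow> psi l \<in> L2 M" and d: "0 < d"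
    and d': "\<And>f. f \<in> L2 M \<Longrightarrow> (\<lambda>l. (norm (ip M f (psi l)))\<^sup>2) summable_on Lam \<and>
       (\<Sum>\<^sub>\<infinity>l\<in>Lam. (norm (ip M f (psi l)))\<^sup>2) \<le> d * (l2norm M f)\<^sup>2"
    unfolding is_frame_def by auto
  have bF: "(\<Sum>l\<in>F. (norm (ip M f (phi l)))\<^sup>2) \<le> b * (l2norm M f)\<^sup>2"
    if "finite F" "F \<subseteq> Lam" "f \<in> L2 M" for F f
    using finite_sum_le_infsum[of "\<lambda>l. (norm (ip M f (phi l)))\<^sup>2" Lam F] b'[OF that(3)] that by auto
  have dF: "(\<Sum>l\<in>F. (norm (ip M f (psi l)))\<^sup>2) \<le> d * (l2norm M f)\<^sup>2"
    if "finite F" "F \<subseteq> Lam" "f \<in> L2 M" for F f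
    using finite_sum_le_infsum[of "\<lambda>l. (norm (ip M f (psi l)))\<^sup>2" Lam F] d'[OF that(3)] that by auto
  \<comment> \<open>The 2's come from the squared triangle inequality; \<open>d * b\<close> is the
    synthesis bound of \<open>psi\<close> times the Bessel bound of \<open>phi\<close>.\<close>
  define B where "B = 2 + 2 * (d * b)"
  have B: "0 < B" using b d by (simp add: B_def add_pos_pos)
  have resid: "(l2norm M (\<lambda>t. f t - (\<Sum>l\<in>F. ip M f (phi l) * psi l t)))\<^sup>2 \<le> B * (l2norm M f)\<^sup>2"
    if F: "finite F" "F \<subseteq> Lam" and f: "f \<in> L2 M" for F f
  proof -
    have "(l2norm M (\<lambda>t. f t - (\<Sum>l\<in>F. ip M f (phi l) * psi l t)))\<^sup>2
       \<le> 2 * (l2norm M f)\<^sup>2 + 2 * (l2norm M (\<lambda>t. \<Sum>l\<in>F. ip M f (phi l) * psi l t))\<^sup>2"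
      using F psi by (intro l2norm_diff_sq_le f L2_sum L2_cmult) auto
    also have "(l2norm M (\<lambda>t. \<Sum>l\<in>F. ip M f (phi l) * psi l t))\<^sup>2 \<le> d * (\<Sum>l\<in>F. (norm (ip M f (phi l)))\<^sup>2)"
      using F psi d by (intro bessel_synthesis_bound dF) auto
    also have "\<dots> \<le> d * (b * (l2norm M f)\<^sup>2)"
      using F f d by (intro mult_left_mono bF) auto
    finally show ?thesis
      by (simp add: B_def algebra_simps)
  qed
  have main: "\<exists>G0. finite G0 \<and> G0 \<subseteq> C \<times> Lam \<and> (\<forall>G. finite G \<and> G0 \<subseteq> G \<and> G \<subseteq> C \<times> Lam \<longrightarrow>
      l2norm N (\<lambda>t. F t - (\<Sum>z\<in>G. ip N F (case z of (c, l) \<Rightarrow> J c (phi l)) * (case z of (c, l) \<Rightarrow> J c (psi l)) t)) < e)"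
    if F: "F \<in> L2 N" and e: "0 < e" for F and e :: real
  proof -
    define n where "n c = (l2norm M (P c F))\<^sup>2" for c
    have n: "(n has_sum (l2norm N F)\<^sup>2) C" unfolding n_def by (rule parseval[OF F])
    \<comment> \<open>Chosen so that the indices outside C0 contribute at most e^2/4 after
      multiplication by the residual bound \<open>B\<close>.\<close>
    define e1 where "e1 = e\<^sup>2 / (4 * B)"
    have e1: "0 < e1" using e B by (simp add: e1_def)
    obtain C0 where C0: "finite C0" "C0 \<subseteq> C" and dist: "dist (sum n C0) ((l2norm N F)\<^sup>2) \<le> e1"
      using has_sum_finite_approximation[OF n e1] by auto
    have tail: "sum n X \<le> e1" if "finite X" "X \<subseteq> C - C0" for X
    proof -
      have "sum n (X \<union> C0) \<le> (l2norm N F)\<^sup>2"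
        by (rule finite_sum_le_has_sum[OF n]) (use that C0 in \<open>auto simp: n_def\<close>)
      moreover have "sum n (X \<union> C0) = sum n X + sum n C0"
        using that C0 by (intro sum.union_disjoint) auto
      ultimately show ?thesis using dist by (auto simp: dist_real_def)
    qed
    \<comment> \<open>The square of \<open>e2\<close>, summed over C0, is at most e^2/4; the extra 4
      under the root keeps \<open>e2\<close> positive when C0 is empty.\<close>
    define e2 where "e2 = e / sqrt (4 * real (card C0) + 4)"
    have e2: "0 < e2" using e by (simp add: e2_def)
    have e2': "real (card C0) * e2\<^sup>2 \<le> e\<^sup>2 / 4"
    proof -
      have "real (card C0) * e2\<^sup>2 = e\<^sup>2 * (real (card C0) / (4 * real (card C0) + 4))"
        by (simp add: e2_def power_divide)
      also have "\<dots> \<le> e\<^sup>2 * (1 / 4)"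
        by (intro mult_left_mono) (auto simp: field_simps)
      finally show ?thesis by simp
    qed
    have "\<forall>c\<in>C0. \<exists>F0. finite F0 \<and> F0 \<subseteq> Lam \<and>
        (\<forall>G. finite G \<and> F0 \<subseteq> G \<and> G \<subseteq> Lam \<longrightarrow>
           l2norm M (\<lambda>t. P c F t - (\<Sum>l\<in>G. ip M (P c F) (phi l) * psi l t)) < e2)"
      using rec[OF P_L2[OF _ F] e2] C0 by blast
    from bchoice[OF this] obtain F0 where F0all: "\<forall>c\<in>C0. finite (F0 c) \<and> F0 c \<subseteq> Lam \<and>
        (\<forall>G. finite G \<and> F0 c \<subseteq> G \<and> G \<subseteq> Lam \<longrightarrow>
           l2norm M (\<lambda>t. P c F t - (\<Sum>l\<in>G. ip M (P c F) (phi l) * psi l t)) < e2)"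
      by (elim exE)
    then have F0: "\<And>c. c \<in> C0 \<Longrightarrow> finite (F0 c)" "\<And>c. c \<in> C0 \<Longrightarrow> F0 c \<subseteq> Lam"
      and F0': "\<And>c G. c \<in> C0 \<Longrightarrow> finite G \<Longrightarrow> F0 c \<subseteq> G \<Longrightarrow> G \<subseteq> Lam \<Longrightarrow>
         l2norm M (\<lambda>t. P c F t - (\<Sum>l\<in>G. ip M (P c F) (phi l) * psi l t)) < e2"
      by simp_all
    show ?thesis
    proof (intro exI[of _ "Sigma C0 F0"] conjI allI impI)
      show "finite (Sigma C0 F0)" using C0 F0 by auto
      show "Sigma C0 F0 \<subseteq> C \<times> Lam" using C0 F0 by auto
      fix G assume "finite G \<and> Sigma C0 F0 \<subseteq> G \<and> G \<subseteq> C \<times> Lam"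
      then have G: "finite G" "Sigma C0 F0 \<subseteq> G" "G \<subseteq> C \<times> Lam" by auto
      define R where "R = (\<lambda>t. F t - (\<Sum>z\<in>G. ip N F (J (fst z) (phi (snd z))) * J (fst z) (psi (snd z)) t))"
      have R: "R \<in> L2 N"
        unfolding R_def using G psi by (intro L2_diff F L2_sum L2_cmult J_L2) auto
      define r where "r c = (l2norm M (P c R))\<^sup>2" for c
      have r: "(r has_sum (l2norm N R)\<^sup>2) C"
        unfolding r_def by (rule parseval[OF R])
      have Gc: "finite {l. (c, l) \<in> G}" "{l. (c, l) \<in> G} \<subseteq> Lam" for c
        using finite_vimageI[OF G(1), of "Pair c"] G by (auto simp: vimage_def inj_on_def)
      have r_eq: "r c = (l2norm M (\<lambda>x. P c F x - (\<Sum>l\<in>{l. (c, l) \<in> G}. ip M (P c F) (phi l) * psi l x)))\<^sup>2"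
        if c: "c \<in> C" for c
      proof -
        have "r c = (l2norm M (\<lambda>x. P c F x - (\<Sum>l\<in>{l. (c, l) \<in> G}. ip N F (J c (phi l)) * psi l x)))\<^sup>2"
          unfolding r_def R_def using l2norm_P_residual[OF c F G(1,3), of psi "\<lambda>z. ip N F (J (fst z) (phi (snd z)))"] psi
          by simp
        also have "(\<lambda>x. P c F x - (\<Sum>l\<in>{l. (c, l) \<in> G}. ip N F (J c (phi l)) * psi l x))
          = (\<lambda>x. P c F x - (\<Sum>l\<in>{l. (c, l) \<in> G}. ip M (P c F) (phi l) * psi l x))"
          using Gc(2)[of c] phi c F
          by (intro ext arg_cong2[where f = "(-)"] refl sum.cong) (auto simp: adj subset_iff)
        finally show ?thesis .
      qed
      have r1: "r c \<le> e2\<^sup>2" if c: "c \<in> C0" for c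
      proof -
        have "F0 c \<subseteq> {l. (c, l) \<in> G}" using G(2) c by auto
        then show ?thesis
          using F0'[OF c Gc(1)[of c] _ Gc(2)[of c]] r_eq[of c] c C0(2)
          by (simp add: subset_iff power_mono l2norm_nonneg)
      qed
      have r2: "r c \<le> B * n c" if c: "c \<in> C" for c
        unfolding r_eq[OF c] n_def by (rule resid[OF Gc P_L2[OF c F]])
      \<comment> \<open>Bounding all finite partial sums yields only a weak inequality, so the
        target is e^2/2, made of e^2/4 from C0 and e^2/4 from the rest.\<close>
      have "(l2norm N R)\<^sup>2 \<le> e\<^sup>2 / 2"
      proof (rule has_sum_le_finite_sums[OF r])
        fix X assume X: "finite X" "X \<subseteq> C"
        have "sum r X = sum r (X \<inter> C0) + sum r (X - C0)"
          using X by (metis sum.Int_Diff)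
        also have "sum r (X \<inter> C0) \<le> (\<Sum>c\<in>X \<inter> C0. e2\<^sup>2)"
          by (intro sum_mono r1) auto
        also have "\<dots> \<le> real (card C0) * e2\<^sup>2"
          using C0 by (auto intro!: mult_right_mono card_mono)
        also have "\<dots> \<le> e\<^sup>2 / 4" by (rule e2')
        also have "sum r (X - C0) \<le> (\<Sum>c\<in>X - C0. B * n c)"
          using X by (intro sum_mono r2) auto
        also have "\<dots> = B * sum n (X - C0)"
          by (simp add: sum_distrib_left)
        also have "\<dots> \<le> B * e1"
          using X B by (intro mult_left_mono tail) auto
        also have "\<dots> = e\<^sup>2 / 4"
          using B by (simp add: e1_def)
        finally show "sum r X \<le> e\<^sup>2 / 2" by simp
      qed
      also have "\<dots> < e\<^sup>2" using e by simp
      finally have "l2norm N R < e"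
        using e by (simp add: power_less_imp_less_base)
      then show "l2norm N (\<lambda>t. F t - (\<Sum>z\<in>G. ip N F (case z of (c, l) \<Rightarrow> J c (phi l)) *
           (case z of (c, l) \<Rightarrow> J c (psi l)) t)) < e"
        unfolding R_def by (simp add: case_prod_beta)
    qed
  qed
  show ?thesis
    unfolding dual_frames_def by (intro conjI is_frame_lift fr ballI allI impI main; assumption)
qed

text \<open>The expansion of \<open>J c0 f\<close> involves only indices in the row of c0, so the
  slice over c0 of a good finite set for \<open>J c0 f\<close> is a good finite set for f.\<close>

lemma dual_frames_restrict:
  fixes Lam :: "'i set"
  assumes c0: "c0 \<in> C" and phi: "\<And>l. l \<in> Lam \<Longrightarrow> phi l \<in> L2 M" and psi: "\<And>l. l \<in> Lam \<Longrightarrow> psi l \<in> L2 M"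
    and du: "dual_frames N (C \<times> Lam) (\<lambda>(c, l). J c (phi l)) (\<lambda>(c, l). J c (psi l))"
  shows "dual_frames M Lam phi psi"
proof -
  have main: "\<exists>F0. finite F0 \<and> F0 \<subseteq> Lam \<and> (\<forall>F. finite F \<and> F0 \<subseteq> F \<and> F \<subseteq> Lam \<longrightarrow>
           l2norm M (\<lambda>t. f t - (\<Sum>z\<in>F. ip M f (phi z) * psi z t)) < e)"
    if f: "f \<in> L2 M" and e: "0 < e" for f and e :: real
  proof -
    from du have "\<forall>F\<in>L2 N. \<forall>e>0. \<exists>G0. finite G0 \<and> G0 \<subseteq> C \<times> Lam \<and> (\<forall>G. finite G \<and> G0 \<subseteq> G \<and> G \<subseteq> C \<times> Lam \<longrightarrow>
        l2norm N (\<lambda>t. F t - (\<Sum>z\<in>G. ip N F (case z of (c, l) \<Rightarrow> J c (phi l)) *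
           (case z of (c, l) \<Rightarrow> J c (psi l)) t)) < e)"
      unfolding dual_frames_def by (elim conjE)
    from this[rule_format, OF J_L2[OF c0 f] e]
    obtain G0 where G0: "finite G0" "G0 \<subseteq> C \<times> Lam"
      and "\<forall>G. finite G \<and> G0 \<subseteq> G \<and> G \<subseteq> C \<times> Lam \<longrightarrow>
        l2norm N (\<lambda>t. J c0 f t - (\<Sum>z\<in>G. ip N (J c0 f) (case z of (c, l) \<Rightarrow> J c (phi l)) *
           (case z of (c, l) \<Rightarrow> J c (psi l)) t)) < e"
      by (elim exE conjE)
    then have G0': "\<And>G. finite G \<Longrightarrow> G0 \<subseteq> G \<Longrightarrow> G \<subseteq> C \<times> Lam \<Longrightarrow>
        l2norm N (\<lambda>t. J c0 f t - (\<Sum>z\<in>G. ip N (J c0 f) (case z of (c, l) \<Rightarrow> J c (phi l)) *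
           (case z of (c, l) \<Rightarrow> J c (psi l)) t)) < e"
      by simp
    have fin: "finite {l. (c0, l) \<in> G0}"
      using finite_vimageI[OF G0(1), of "Pair c0"] by (simp add: vimage_def inj_on_def)
    show ?thesis
    proof (intro exI[of _ "{l. (c0, l) \<in> G0}"] conjI allI impI fin)
      show "{l. (c0, l) \<in> G0} \<subseteq> Lam" using G0 by auto
      fix F assume "finite F \<and> {l. (c0, l) \<in> G0} \<subseteq> F \<and> F \<subseteq> Lam"
      then have F: "finite F" "{l. (c0, l) \<in> G0} \<subseteq> F" "F \<subseteq> Lam" by auto
      \<comment> \<open>The estimate is available only for supersets of G0, so the rest of G0 is
        kept; its indices have first component different from c0 and hence coefficient 0.\<close>
      define G where "G = G0 \<union> Pair c0 ` F"
      have G: "finite G" "G0 \<subseteq> G" "G \<subseteq> C \<times> Lam"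
        using F G0 c0 by (auto simp: G_def)
      have "(\<Sum>z\<in>G. ip N (J c0 f) (case z of (c, l) \<Rightarrow> J c (phi l)) * (case z of (c, l) \<Rightarrow> J c (psi l)) t)
         = J c0 (\<lambda>x. \<Sum>l\<in>F. ip M f (phi l) * psi l x) t" for t
      proof -
        have "(\<Sum>z\<in>G. ip N (J c0 f) (case z of (c, l) \<Rightarrow> J c (phi l)) * (case z of (c, l) \<Rightarrow> J c (psi l)) t)
          = (\<Sum>z\<in>Pair c0 ` F. ip M f (phi (snd z)) * J c0 (psi (snd z)) t)"
        proof (rule sum.mono_neutral_cong_right)
          show "\<forall>z\<in>G - Pair c0 ` F. ip N (J c0 f) (case z of (c, l) \<Rightarrow> J c (phi l)) *
             (case z of (c, l) \<Rightarrow> J c (psi l)) t = 0"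
          proof
            fix z assume z: "z \<in> G - Pair c0 ` F"
            then have "fst z \<noteq> c0" "fst z \<in> C" "snd z \<in> Lam"
              using F G0 by (cases z, auto simp: G_def)+
            then show "ip N (J c0 f) (case z of (c, l) \<Rightarrow> J c (phi l)) *
               (case z of (c, l) \<Rightarrow> J c (psi l)) t = 0"
              using phi c0 f by (simp add: J_orth case_prod_beta)
          qed
        next
          fix z assume "z \<in> Pair c0 ` F"
          then show "ip N (J c0 f) (case z of (c, l) \<Rightarrow> J c (phi l)) * (case z of (c, l) \<Rightarrow> J c (psi l)) t
             = ip M f (phi (snd z)) * J c0 (psi (snd z)) t"
            using F phi c0 f by (auto simp: J_orth)
        qed (use G in \<open>auto simp: G_def\<close>)
        also have "\<dots> = (\<Sum>l\<in>F. ip M f (phi l) * J c0 (psi l) t)"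
          by (subst sum.reindex) (auto simp: inj_on_def)
        finally show ?thesis by (simp add: J_sum)
      qed
      moreover have "J c0 (\<lambda>x. f x - (\<Sum>l\<in>F. ip M f (phi l) * psi l x))
          = (\<lambda>t. J c0 f t - J c0 (\<lambda>x. \<Sum>l\<in>F. ip M f (phi l) * psi l x) t)"
        by (intro ext J_diff)
      ultimately have "l2norm N (J c0 (\<lambda>x. f x - (\<Sum>l\<in>F. ip M f (phi l) * psi l x))) < e"
        using G0'[OF G] by simp
      then show "l2norm M (\<lambda>x. f x - (\<Sum>l\<in>F. ip M f (phi l) * psi l x)) < e"
        using F psi by (subst (asm) l2norm_J) (auto intro!: c0 L2_diff f L2_sum L2_cmult)
    qed
  qed
  have "is_frame N (C \<times> Lam) (\<lambda>(c, l). J c (phi l))" "is_frame N (C \<times> Lam) (\<lambda>(c, l). J c (psi l))"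
    using du by (simp_all add: dual_frames_def)
  then have "is_frame M Lam phi" "is_frame M Lam psi"
    by (simp_all add: is_frame_restrict[OF c0] phi psi)
  then show ?thesis
    unfolding dual_frames_def using main by simp
qed

end

section \<open>Tensoring with an orthonormal basis\<close>

context pair_sigma_finite
begin

lemma L2_tensor:
  assumes f: "f \<in> L2 M1" and w: "w \<in> L2 M2"
  shows "(\<lambda>t. f (fst t) * w (snd t)) \<in> L2 (M1 \<Otimes>\<^sub>M M2)"
proof -
  note [measurable] = L2_measurable[OF f] L2_measurable[OF w]
  have "integrable (M1 \<Otimes>\<^sub>M M2) (\<lambda>t. (norm (f (fst t)))\<^sup>2 * (norm (w (snd t)))\<^sup>2)"
  proof (rule Fubini_integrable)
    show "integrable M1 (\<lambda>x. \<integral>y. norm ((norm (f (fst (x, y))))\<^sup>2 * (norm (w (snd (x, y))))\<^sup>2) \<partial>M2)"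
      using L2_integrable[OF f] by simp
    show "AE x in M1. integrable M2 (\<lambda>y. (norm (f (fst (x, y))))\<^sup>2 * (norm (w (snd (x, y))))\<^sup>2)"
      using L2_integrable[OF w] by simp
  qed simp
  then show ?thesis
    by (simp add: L2_def norm_mult power_mult_distrib)
qed

text \<open>Fubini gives square-integrable slices only for almost every x, which is why Parseval is
  later applied to slices under an almost-everywhere integral.\<close>

lemma AE_slice_L2:
  assumes F: "F \<in> L2 (M1 \<Otimes>\<^sub>M M2)"
  shows "AE x in M1. (\<lambda>t. F (x, t)) \<in> L2 M2"
proof -
  note [measurable] = L2_measurable[OF F]
  show ?thesis
    using AE_integrable_fst'[OF L2_integrable[OF F]] AE_space by eventually_elim (simp add: L2_def)
qed

lemma slice_ip_measurable:
  assumes F: "F \<in> L2 (M1 \<Otimes>\<^sub>M M2)" and w: "w \<in> L2 M2"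
  shows "(\<lambda>x. ip M2 (\<lambda>t. F (x, t)) w) \<in> borel_measurable M1"
proof -
  note [measurable] = L2_measurable[OF F] L2_measurable[OF w]
  show ?thesis
    unfolding ip_def by (rule M2.borel_measurable_lebesgue_integral) (simp add: case_prod_beta)
qed

text \<open>Integrating out the second variable first leaves the slice coefficients paired with f.
  Thus slicing against w is adjoint to tensoring with w.\<close>

lemma ip_tensor_right:
  assumes F: "F \<in> L2 (M1 \<Otimes>\<^sub>M M2)" and f: "f \<in> L2 M1" and w: "w \<in> L2 M2"
  shows "ip (M1 \<Otimes>\<^sub>M M2) F (\<lambda>t. f (fst t) * w (snd t)) = ip M1 (\<lambda>x. ip M2 (\<lambda>t. F (x, t)) w) f"
proof -
  have "ip (M1 \<Otimes>\<^sub>M M2) F (\<lambda>t. f (fst t) * w (snd t))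
     = (\<integral>x. \<integral>y. F (x, y) * cnj (f x * w y) \<partial>M2 \<partial>M1)"
    unfolding ip_def using integral_fst'[OF integrable_ip[OF F L2_tensor[OF f w]]] by simp
  also have "\<dots> = (\<integral>x. \<integral>y. cnj (f x) * (F (x, y) * cnj (w y)) \<partial>M2 \<partial>M1)"
    by (simp add: mult_ac)
  also have "\<dots> = ip M1 (\<lambda>x. ip M2 (\<lambda>t. F (x, t)) w) f"
    unfolding ip_def by (simp add: mult.commute)
  finally show ?thesis .
qed

lemma ip_tensor_tensor:
  assumes "f \<in> L2 M1" "w \<in> L2 M2" "f' \<in> L2 M1" "w' \<in> L2 M2"
  shows "ip (M1 \<Otimes>\<^sub>M M2) (\<lambda>t. f (fst t) * w (snd t)) (\<lambda>t. f' (fst t) * w' (snd t)) = ip M2 w w' * ip M1 f f'"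
proof -
  have "ip (M1 \<Otimes>\<^sub>M M2) (\<lambda>t. f (fst t) * w (snd t)) (\<lambda>t. f' (fst t) * w' (snd t))
    = ip M1 (\<lambda>x. ip M2 w w' * f x) f'"
    using assms by (subst ip_tensor_right) (auto intro!: L2_tensor simp: ip_cmult_left mult.commute)
  then show ?thesis
    by (simp add: ip_cmult_left)
qed

end

section \<open>Norms and unordered sums as nonnegative integrals\<close>

lemma ennreal_l2norm_sq: "f \<in> L2 M \<Longrightarrow> ennreal ((l2norm M f)\<^sup>2) = (\<integral>\<^sup>+x. ennreal ((norm (f x))\<^sup>2) \<partial>M)"
  unfolding l2norm_sq by (subst nn_integral_eq_integral) (auto dest: L2_integrable)

lemma L2I_nn_integral:
  assumes "f \<in> borel_measurable M" "(\<integral>\<^sup>+x. ennreal ((norm (f x))\<^sup>2) \<partial>M) < \<infinity>"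
  shows "f \<in> L2 M"
  using assms by (auto simp: L2_def intro!: integrableI_bounded)

text \<open>Parseval identities are handled as nonnegative integrals over counting measure, where
  Tonelli applies without summability conditions; here such an integral is turned back into an
  unordered sum.\<close>

lemma has_sum_of_nn_integral_count_space:
  assumes "(\<integral>\<^sup>+c. ennreal (r c) \<partial>count_space C) = ennreal s" "\<And>c. 0 \<le> r c" "0 \<le> s"
  shows "(r has_sum s) C"
proof -
  have abs: "Infinite_Set_Sum.abs_summable_on r C"
    unfolding abs_summable_on_def using assms by (intro integrableI_bounded) simp_all
  have "infsetsum r C = s"
    using assms by (subst infsetsum_conv_nn_integral) simp_all
  then have "infsum r C = s"
    using infsetsum_infsum[OF abs] by simp
  moreover have "r summable_on C"
    using abs abs_summable_equivalent[of r C] abs_summable_summable by blast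
  ultimately show ?thesis
    using has_sum_infsum by blast
qed

text \<open>Completeness is stated as Parseval's identity, written as an integral over counting
  measure; countability of C allows this integral to be exchanged with others.\<close>

locale orthonormal_basis =
  fixes Q :: "'b measure" and C :: "'c set" and w :: "'c \<Rightarrow> 'b \<Rightarrow> complex"
  assumes sf: "sigma_finite_measure Q" and countable_C: "countable C"
    and w_L2: "c \<in> C \<Longrightarrow> w c \<in> L2 Q"
    and w_orth: "c \<in> C \<Longrightarrow> c' \<in> C \<Longrightarrow> ip Q (w c) (w c') = (if c = c' then 1 else 0)"
    and w_parseval: "f \<in> L2 Q \<Longrightarrow>
        (\<integral>\<^sup>+c. ennreal ((norm (ip Q f (w c)))\<^sup>2) \<partial>count_space C) = ennreal ((l2norm Q f)\<^sup>2)"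
begin

text \<open>Tonelli moves the sum over c inside, Parseval applies to almost every slice, and Tonelli
  once more reassembles the norm of F.\<close>

lemma tensor_parseval:
  assumes M: "sigma_finite_measure M" and F: "F \<in> L2 (M \<Otimes>\<^sub>M Q)"
  shows "(\<integral>\<^sup>+c. \<integral>\<^sup>+x. ennreal ((norm (ip Q (\<lambda>t. F (x, t)) (w c)))\<^sup>2) \<partial>M \<partial>count_space C)
    = ennreal ((l2norm (M \<Otimes>\<^sub>M Q) F)\<^sup>2)"
proof -
  interpret pair_sigma_finite M Q
    using M sf by (simp add: pair_sigma_finite_def)
  note [measurable] = L2_measurable[OF F]
  have "(\<integral>\<^sup>+c. \<integral>\<^sup>+x. ennreal ((norm (ip Q (\<lambda>t. F (x, t)) (w c)))\<^sup>2) \<partial>M \<partial>count_space C)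
    = (\<integral>\<^sup>+x. \<integral>\<^sup>+c. ennreal ((norm (ip Q (\<lambda>t. F (x, t)) (w c)))\<^sup>2) \<partial>count_space C \<partial>M)"
  proof (rule nn_integral_count_space_nn_integral[symmetric])
    fix c assume "c \<in> C"
    note [measurable] = slice_ip_measurable[OF F w_L2[OF this]]
    show "(\<lambda>x. ennreal ((norm (ip Q (\<lambda>t. F (x, t)) (w c)))\<^sup>2)) \<in> borel_measurable M"
      by measurable
  qed (rule countable_C)
  also have "\<dots> = (\<integral>\<^sup>+x. \<integral>\<^sup>+t. ennreal ((norm (F (x, t)))\<^sup>2) \<partial>Q \<partial>M)"
    by (rule nn_integral_cong_AE, use AE_slice_L2[OF F] in eventually_elim)
       (simp add: w_parseval ennreal_l2norm_sq)
  also have "\<dots> = (\<integral>\<^sup>+z. ennreal ((norm (F z))\<^sup>2) \<partial>(M \<Otimes>\<^sub>M Q))"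
    by (rule M2.nn_integral_fst) simp
  finally show ?thesis
    using F by (simp add: ennreal_l2norm_sq)
qed

text \<open>The squared norm is a single term of the finite sum in
  \<open>tensor_parseval\<close>.\<close>

lemma slice_ip_L2:
  assumes M: "sigma_finite_measure M" and F: "F \<in> L2 (M \<Otimes>\<^sub>M Q)" and c: "c \<in> C"
  shows "(\<lambda>x. ip Q (\<lambda>t. F (x, t)) (w c)) \<in> L2 M"
proof (rule L2I_nn_integral)
  interpret pair_sigma_finite M Q
    using M sf by (simp add: pair_sigma_finite_def)
  show "(\<lambda>x. ip Q (\<lambda>t. F (x, t)) (w c)) \<in> borel_measurable M"
    by (rule slice_ip_measurable[OF F w_L2[OF c]])
  have "(\<integral>\<^sup>+x. ennreal ((norm (ip Q (\<lambda>t. F (x, t)) (w c)))\<^sup>2) \<partial>M)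
     = (\<integral>\<^sup>+c'\<in>{c}. \<integral>\<^sup>+x. ennreal ((norm (ip Q (\<lambda>t. F (x, t)) (w c')))\<^sup>2) \<partial>M \<partial>count_space C)"
    using c by (simp add: nn_integral_indicator_singleton)
  also have "\<dots> \<le> (\<integral>\<^sup>+c'. \<integral>\<^sup>+x. ennreal ((norm (ip Q (\<lambda>t. F (x, t)) (w c')))\<^sup>2) \<partial>M \<partial>count_space C)"
    by (intro nn_integral_mono) (auto split: split_indicator)
  also have "\<dots> < \<infinity>"
    unfolding tensor_parseval[OF M F] by simp
  finally show "(\<integral>\<^sup>+x. ennreal ((norm (ip Q (\<lambda>t. F (x, t)) (w c)))\<^sup>2) \<partial>M) < \<infinity>" .
qed

text \<open>The space L^2(M x Q) is the orthogonal sum of the copies of L^2(M) tensored with the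
  \<open>w c\<close>. Each copy may be twisted by its own isometry \<open>U c\<close>; since the
  adjoint \<open>V c\<close> preserves norms, Parseval survives the twist. The freedom is needed to
  absorb the real component of a coset representative in the lattice.\<close>

lemma orthogonal_decomposition_tensor:
  fixes U V :: "'c \<Rightarrow> ('a \<Rightarrow> complex) \<Rightarrow> 'a \<Rightarrow> complex"
  assumes M: "sigma_finite_measure M"
    and U_L2: "\<And>c f. f \<in> L2 M \<Longrightarrow> U c f \<in> L2 M" and V_L2: "\<And>c f. f \<in> L2 M \<Longrightarrow> V c f \<in> L2 M"
    and U_diff: "\<And>c f f' x. U c (\<lambda>x. f x - f' x) x = U c f x - U c f' x"
    and U_sum: "\<And>c (I :: 'i set) a g x. U c (\<lambda>x. \<Sum>i\<in>I. a i * g i x) x = (\<Sum>i\<in>I. a i * U c (g i) x)"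
    and U_iso: "\<And>c f f'. f \<in> L2 M \<Longrightarrow> f' \<in> L2 M \<Longrightarrow> ip M (U c f) (U c f') = ip M f f'"
    and UV: "\<And>c f f'. f \<in> L2 M \<Longrightarrow> f' \<in> L2 M \<Longrightarrow> ip M f (U c f') = ip M (V c f) f'"
    and V_norm: "\<And>c f. f \<in> L2 M \<Longrightarrow> l2norm M (V c f) = l2norm M f"
  shows "orthogonal_decomposition TYPE('i) M (M \<Otimes>\<^sub>M Q) C (\<lambda>c f t. U c f (fst t) * w c (snd t))
    (\<lambda>c F. V c (\<lambda>x. ip Q (\<lambda>t. F (x, t)) (w c)))"
proof -
  interpret pair_sigma_finite M Q
    using M sf by (simp add: pair_sigma_finite_def)
  show ?thesis
  proof
    fix c f assume "c \<in> C" "f \<in> L2 M"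
    then show "(\<lambda>t. U c f (fst t) * w c (snd t)) \<in> L2 (M \<Otimes>\<^sub>M Q)"
      by (intro L2_tensor U_L2 w_L2)
  next
    fix c F assume "c \<in> C" "F \<in> L2 (M \<Otimes>\<^sub>M Q)"
    then show "V c (\<lambda>x. ip Q (\<lambda>t. F (x, t)) (w c)) \<in> L2 M"
      by (intro V_L2 slice_ip_L2 M)
  next
    fix c f f' t
    show "U c (\<lambda>x. f x - f' x) (fst t) * w c (snd t) = U c f (fst t) * w c (snd t) - U c f' (fst t) * w c (snd t)"
      by (simp add: U_diff left_diff_distrib)
  next
    fix c a g t and I :: "'i set"
    show "U c (\<lambda>x. \<Sum>i\<in>I. a i * g i x) (fst t) * w c (snd t) = (\<Sum>i\<in>I. a i * (U c (g i) (fst t) * w c (snd t)))"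
      by (simp add: U_sum sum_distrib_right mult.assoc)
  next
    fix c c' f f' assume "c \<in> C" "c' \<in> C" "f \<in> L2 M" "f' \<in> L2 M"
    then show "ip (M \<Otimes>\<^sub>M Q) (\<lambda>t. U c f (fst t) * w c (snd t)) (\<lambda>t. U c' f' (fst t) * w c' (snd t))
      = (if c = c' then ip M f f' else 0)"
      by (subst ip_tensor_tensor) (auto simp: U_L2 w_L2 w_orth U_iso)
  next
    fix c F f assume "c \<in> C" "F \<in> L2 (M \<Otimes>\<^sub>M Q)" "f \<in> L2 M"
    then show "ip (M \<Otimes>\<^sub>M Q) F (\<lambda>t. U c f (fst t) * w c (snd t)) = ip M (V c (\<lambda>x. ip Q (\<lambda>t. F (x, t)) (w c))) f"
      by (subst ip_tensor_right) (auto simp: U_L2 w_L2 UV slice_ip_L2 M)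
  next
    fix F assume F: "F \<in> L2 (M \<Otimes>\<^sub>M Q)"
    have "(\<integral>\<^sup>+c. ennreal ((l2norm M (V c (\<lambda>x. ip Q (\<lambda>t. F (x, t)) (w c))))\<^sup>2) \<partial>count_space C)
      = ennreal ((l2norm (M \<Otimes>\<^sub>M Q) F)\<^sup>2)"
      unfolding tensor_parseval[OF M F, symmetric]
      by (intro nn_integral_cong) (simp add: V_norm slice_ip_L2 M F ennreal_l2norm_sq)
    then show "((\<lambda>c. (l2norm M (V c (\<lambda>x. ip Q (\<lambda>t. F (x, t)) (w c))))\<^sup>2) has_sum (l2norm (M \<Otimes>\<^sub>M Q) F)\<^sup>2) C"
      by (rule has_sum_of_nn_integral_count_space) simp_all
  qed
qed

end

section \<open>Digit coordinates on the finite adeles\<close>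

text \<open>The minus sign is that of the p-adic factors of the character chi.\<close>

definition ez :: "real \<Rightarrow> complex" where
  "ez r = cis (- 2 * pi * r)"

lemma ez_0 [simp]: "ez 0 = 1"
  and norm_ez [simp]: "norm (ez r) = 1"
  by (simp_all add: ez_def)

lemma ez_add: "ez (a + b) = ez a * ez b"
  by (simp add: ez_def cis_mult algebra_simps)

lemma cnj_ez: "cnj (ez a) = ez (- a)"
  by (simp add: ez_def cis_cnj)

lemma ez_Ints: "a \<in> \<int> \<Longrightarrow> ez a = 1"
proof -
  assume "a \<in> \<int>"
  then obtain m where "a = of_int m" by (auto elim: Ints_cases)
  then have "- 2 * pi * a = 2 * pi * of_int (- m)" by simp
  then show ?thesis unfolding ez_def using cis_multiple_2pi[of "of_int (- m)"] by simp
qed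

lemma ez_cong: "a - b \<in> \<int> \<Longrightarrow> ez a = ez b"
  using ez_add[of "a - b" b] by (simp add: ez_Ints)

lemma ez_eq_1_iff: "ez a = 1 \<longleftrightarrow> a \<in> \<int>"
proof
  assume "ez a = 1"
  then have "cos (2 * pi * a) = 1" by (simp add: ez_def complex_eq_iff)
  then obtain n :: int where "2 * pi * a = of_int n * 2 * pi"
    using cos_one_2pi_int by blast
  then have "a = of_int n" by simp
  then show "a \<in> \<int>" by simp
qed (rule ez_Ints)

lemma ez_frac: "ez (frac a) = ez a"
  by (rule ez_cong) (simp add: frac_def)

lemma ez_sum: "ez (\<Sum>i\<in>I. a i) = (\<Prod>i\<in>I. ez (a i))"
  by (induction I rule: infinite_finite_induct) (simp_all add: ez_add)

lemma ez_mult_nat: "ez (a * real n) = ez a ^ n"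
  unfolding ez_def Complex.DeMoivre by (simp add: mult_ac)

lemma frac_cong:
  fixes a b :: real
  assumes "a - b \<in> \<int>"
  shows "frac a = frac b"
proof -
  obtain m where "a - b = of_int m" using assms by (auto elim: Ints_cases)
  then have "a = b + of_int m" by simp
  then show ?thesis by (simp add: frac_def)
qed

subsection \<open>Reduction modulo a prime power\<close>

lemma pmod_0 [simp]: "pmod p 0 r = frac r"
  by (simp add: pmod_def frac_def)

lemma pmod_eqI:
  assumes "0 \<le> c" "c < real p ^ k" "r = c + real p ^ k * of_int m"
  shows "pmod p k r = c"
proof -
  have pos: "0 < real p ^ k" using assms by linarith
  have "r / real p ^ k = c / real p ^ k + of_int m"
    using pos assms by (simp add: field_simps)
  moreover have "\<lfloor>c / real p ^ k\<rfloor> = 0"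
    using pos assms by (simp add: floor_eq_iff field_simps)
  ultimately show ?thesis
    using assms by (simp add: pmod_def)
qed

lemma pmod_bounds:
  assumes "0 < p"
  shows "0 \<le> pmod p k r" "pmod p k r < real p ^ k"
proof -
  have pos: "0 < real p ^ k" using assms by simp
  have "pmod p k r = real p ^ k * frac (r / real p ^ k)"
    using pos by (simp add: pmod_def frac_def field_simps)
  then show "0 \<le> pmod p k r" "pmod p k r < real p ^ k"
    using pos frac_lt_1[of "r / real p ^ k"] by simp_all
qed

lemma pmod_decomp: "\<exists>m::int. r = pmod p k r + real p ^ k * of_int m"
  by (intro exI[of _ "\<lfloor>r / real p ^ k\<rfloor>"]) (simp add: pmod_def)

lemma pmod_pmod_Suc:
  assumes "0 < p"
  shows "pmod p k (pmod p (Suc k) r) = pmod p k r"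
proof -
  obtain m where m: "r = pmod p (Suc k) r + real p ^ Suc k * of_int m"
    using pmod_decomp by blast
  obtain m' where m': "r = pmod p k r + real p ^ k * of_int m'"
    using pmod_decomp by blast
  have "pmod p (Suc k) r = pmod p k r + real p ^ k * of_int (m' - int p * m)"
    using m m' by (simp add: algebra_simps)
  then show ?thesis
    by (rule pmod_eqI[OF pmod_bounds[OF assms]])
qed

lemma pmod_add_multiple:
  assumes "0 < p"
  shows "pmod p k (r + real p ^ k * of_int m) = pmod p k r"
proof -
  obtain m' where m': "r = pmod p k r + real p ^ k * of_int m'"
    using pmod_decomp by blast
  then have "r + real p ^ k * of_int m = pmod p k r + real p ^ k * of_int (m' + m)"
    by (simp add: algebra_simps)
  then show ?thesis
    by (rule pmod_eqI[OF pmod_bounds[OF assms]])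
qed

text \<open>The definition relates consecutive levels only. Iterating gives a congruence modulo p^k
  between any two levels; the multiple is an integer although the entries themselves lie in
  Z[1/p].\<close>

lemma is_Qp_step:
  assumes "is_Qp p c" "k \<le> K"
  shows "\<exists>m::int. c K = c k + real p ^ k * of_int m"
  using assms(2)
proof (induction K rule: dec_induct)
  case base
  show ?case by (intro exI[of _ 0]) simp
next
  case (step K)
  then obtain m where m: "c K = c k + real p ^ k * of_int m" by blast
  have "pmod p K (c (Suc K)) = c K" using assms(1) by (simp add: is_Qp_def)
  then obtain m' where m': "c (Suc K) = c K + real p ^ K * of_int m'"
    using pmod_decomp[of "c (Suc K)" p K] by auto
  have "real p ^ K = real p ^ k * real p ^ (K - k)"
    using step by (simp flip: power_add)
  then have "c (Suc K) = c k + real p ^ k * of_int (m + int p ^ (K - k) * m')"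
    using m m' by (simp add: algebra_simps)
  then show ?case by blast
qed

lemma is_Qp_qp_sub:
  assumes p: "0 < p" and c: "is_Qp p c" and d: "is_Qp p d"
  shows "is_Qp p (qp_sub p c d)"
  unfolding is_Qp_def
proof (intro conjI allI)
  show "0 \<le> qp_sub p c d k" "qp_sub p c d k < real p ^ k" for k
    using pmod_bounds[OF p] by (simp_all add: qp_sub_def)
  obtain N1 where N1: "\<And>k. real p ^ N1 * c k \<in> \<int>" using c by (auto simp: is_Qp_def)
  obtain N2 where N2: "\<And>k. real p ^ N2 * d k \<in> \<int>" using d by (auto simp: is_Qp_def)
  have "real p ^ (N1 + N2) * qp_sub p c d k \<in> \<int>" for k
  proof -
    obtain m where m: "c k - d k = qp_sub p c d k + real p ^ k * of_int m"
      using pmod_decomp[of "c k - d k" p k] unfolding qp_sub_def by blast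
    have "real p ^ (N1 + N2) * qp_sub p c d k = real p ^ N2 * (real p ^ N1 * c k)
       - real p ^ N1 * (real p ^ N2 * d k) - real p ^ (N1 + N2) * (real p ^ k * of_int m)"
      using m by (simp add: algebra_simps power_add)
    also have "\<dots> \<in> \<int>"
      by (intro Ints_diff Ints_mult N1 N2) simp_all
    finally show ?thesis .
  qed
  then show "\<exists>N. \<forall>k. real p ^ N * qp_sub p c d k \<in> \<int>" by blast
  show "pmod p k (qp_sub p c d (Suc k)) = qp_sub p c d k" for k
  proof -
    obtain m1 where m1: "c (Suc k) = c k + real p ^ k * of_int m1"
      using is_Qp_step[OF c, of k "Suc k"] by auto
    obtain m2 where m2: "d (Suc k) = d k + real p ^ k * of_int m2"
      using is_Qp_step[OF d, of k "Suc k"] by auto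
    have "pmod p k (qp_sub p c d (Suc k)) = pmod p k (c (Suc k) - d (Suc k))"
      unfolding qp_sub_def by (rule pmod_pmod_Suc[OF p])
    also have "c (Suc k) - d (Suc k) = (c k - d k) + real p ^ k * of_int (m1 - m2)"
      using m1 m2 by (simp add: algebra_simps)
    finally show ?thesis
      by (simp only: pmod_add_multiple[OF p] qp_sub_def)
  qed
qed

section \<open>Fractional parts as representatives of the cosets of K\<close>

definition frp :: "(nat \<Rightarrow> 'n \<Rightarrow> nat \<Rightarrow> real) \<Rightarrow> nat \<Rightarrow> 'n \<Rightarrow> real" where
  "frp x = (\<lambda>p i. x p i 0)"

lemma FrS_den: "F \<in> FrS S \<Longrightarrow> p \<in> S \<Longrightarrow> \<exists>N. real p ^ N * F p i \<in> \<int>"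
  unfolding FrS_def by blast

lemma FrS_bounds: "F \<in> FrS S \<Longrightarrow> 0 \<le> F p i \<and> F p i < 1"
  by (cases "p \<in> S") (auto simp: FrS_def)

lemma frp_in_FrS:
  assumes "x \<in> QSn S"
  shows "frp x \<in> FrS S"
proof -
  have "{p. \<exists>i. x p i 0 \<noteq> 0} \<subseteq> {p \<in> S. \<exists>i. x p i 0 \<noteq> 0}"
    using assms by (auto simp: QSn_def)
  moreover have "0 \<le> x p i 0 \<and> x p i 0 < 1 \<and> (\<exists>N. real p ^ N * x p i 0 \<in> \<int>)" if "p \<in> S" for p i
  proof -
    have q: "is_Qp p (x p i)" using assms that by (auto simp: QSn_def)
    then have "0 \<le> x p i 0 \<and> x p i 0 < real p ^ 0" "\<exists>N. real p ^ N * x p i 0 \<in> \<int>"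
      unfolding is_Qp_def by blast+
    then show ?thesis by simp
  qed
  ultimately show ?thesis
    using assms by (auto simp: FrS_def frp_def QSn_def intro: finite_subset)
qed

lemma QS_sub_in_QSn:
  assumes S: "\<forall>p\<in>S. prime p" and x: "x \<in> QSn S" and y: "y \<in> QSn S"
  shows "QS_sub x y \<in> QSn S"
proof -
  have "QS_sub x y p i = (\<lambda>k. 0)" if "p \<notin> S" for p i
    using that x y by (auto simp: QS_sub_def qp_sub_def QSn_def pmod_def)
  moreover have "is_Qp p (QS_sub x y p i)" if "p \<in> S" for p i
    using that x y S unfolding QS_sub_def by (intro is_Qp_qp_sub) (auto simp: QSn_def prime_gt_0_nat)
  moreover have "finite {p\<in>S. \<exists>i. QS_sub x y p i 0 \<noteq> 0}"
  proof (rule finite_subset)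
    show "{p\<in>S. \<exists>i. QS_sub x y p i 0 \<noteq> 0} \<subseteq> {p\<in>S. \<exists>i. x p i 0 \<noteq> 0} \<union> {p\<in>S. \<exists>i. y p i 0 \<noteq> 0}"
      by (auto simp: QS_sub_def qp_sub_def) (metis Ints_0)
    show "finite ({p\<in>S. \<exists>i. x p i 0 \<noteq> 0} \<union> {p\<in>S. \<exists>i. y p i 0 \<noteq> 0})"
      using x y by (simp add: QSn_def)
  qed
  ultimately show ?thesis by (simp add: QSn_def)
qed

text \<open>Fractional parts lie in [0, 1), so the difference of two of them is an integer only when
  they are equal.\<close>

lemma QS_sub_in_KS_iff:
  assumes S: "\<forall>p\<in>S. prime p" and x: "x \<in> QSn S" and y: "y \<in> QSn S"
  shows "QS_sub x y \<in> KS S \<longleftrightarrow> frp x = frp y"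
proof -
  have "frac (x p i 0 - y p i 0) = 0 \<longleftrightarrow> x p i 0 = y p i 0" for p i
  proof -
    have b: "0 \<le> frp x p i" "frp x p i < 1" "0 \<le> frp y p i" "frp y p i < 1"
      using FrS_bounds[OF frp_in_FrS[OF x]] FrS_bounds[OF frp_in_FrS[OF y]] by blast+
    show ?thesis
    proof
      assume "frac (x p i 0 - y p i 0) = 0"
      then have "x p i 0 - y p i 0 \<in> \<int>" by (simp add: frac_eq_0_iff)
      then obtain m :: int where m: "x p i 0 - y p i 0 = of_int m" by (auto elim: Ints_cases)
      then have "\<bar>real_of_int m\<bar> < 1" using b by (auto simp: frp_def)
      then have "m = 0" by linarith
      then show "x p i 0 = y p i 0" using m by simp
    qed simp
  qed
  then show ?thesis
    using QS_sub_in_QSn[OF assms] by (auto simp: KS_def frp_def QS_sub_def qp_sub_def fun_eq_iff)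
qed

subsection \<open>Digit expansions\<close>

definition digit_space :: "nat set \<Rightarrow> (nat \<times> 'n \<times> nat \<Rightarrow> nat) set" where
  "digit_space S = (\<Pi>\<^sub>E pij\<in>digit_index S. {0..<fst pij})"

lemma space_digits_measure: "space (digits_measure S) = digit_space S"
  by (simp add: digits_measure_def digit_space_def space_PiM space_uniform_count_measure)

lemma digit_less: "d \<in> digit_space S \<Longrightarrow> p \<in> S \<Longrightarrow> d (p, i, j) < p"
  by (auto simp: digit_space_def digit_index_def PiE_iff)

lemma digit_sum_less:
  fixes p :: nat
  assumes "\<And>j. j < k \<Longrightarrow> d j < p"
  shows "(\<Sum>j<k. d j * p ^ j) < p ^ k"
  using assms
proof (induction k)
  case (Suc k)
  have "(\<Sum>j<Suc k. d j * p ^ j) < p ^ k + d k * p ^ k"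
    using Suc by simp
  also have "\<dots> = Suc (d k) * p ^ k" by simp
  also have "\<dots> \<le> p * p ^ k"
    using Suc.prems[of k] by (intro mult_right_mono) auto
  finally show ?case by simp
qed simp

text \<open>The digits form an integer at most p^k - 1 and \<open>F p i\<close> is less than 1, so
  the sum is already below p^k and the reduction by \<open>pmod\<close> changes nothing.\<close>

lemma from_digits_eq:
  assumes F: "F \<in> FrS S" and d: "d \<in> digit_space S" and p: "p \<in> S"
  shows "from_digits S (F, d) p i k = F p i + (\<Sum>j<k. real (d (p, i, j)) * real p ^ j)"
proof -
  have "(\<Sum>j<k. d (p, i, j) * p ^ j) + 1 \<le> p ^ k"
    using digit_sum_less[of k "\<lambda>j. d (p, i, j)" p] digit_less[OF d p] by (simp add: Suc_le_eq)
  then have "real ((\<Sum>j<k. d (p, i, j) * p ^ j) + 1) \<le> real (p ^ k)"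
    by (simp only: of_nat_le_iff)
  then have "(\<Sum>j<k. real (d (p, i, j)) * real p ^ j) + 1 \<le> real p ^ k"
    by simp
  moreover have "0 \<le> F p i" "F p i < 1"
    using F p by (auto simp: FrS_def)
  ultimately show ?thesis
    using p by (auto simp: from_digits_def intro!: pmod_eqI[where m = 0] add_nonneg_nonneg sum_nonneg)
qed

lemma is_Qp_from_digits:
  assumes S: "\<forall>p\<in>S. prime p" and F: "F \<in> FrS S" and d: "d \<in> digit_space S" and p: "p \<in> S"
  shows "is_Qp p (from_digits S (F, d) p i)"
  unfolding is_Qp_def
proof (intro conjI allI)
  have p0: "0 < p" using S p by (simp add: prime_gt_0_nat)
  show b: "0 \<le> from_digits S (F, d) p i k" "from_digits S (F, d) p i k < real p ^ k" for k
    using pmod_bounds[OF p0] p by (simp_all add: from_digits_def)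
  obtain N where N: "real p ^ N * F p i \<in> \<int>" using FrS_den[OF F p] by blast
  have "real p ^ N * from_digits S (F, d) p i k \<in> \<int>" for k
    unfolding from_digits_eq[OF F d p] distrib_left
    by (intro Ints_add N Ints_mult Ints_sum) simp_all
  then show "\<exists>N. \<forall>k. real p ^ N * from_digits S (F, d) p i k \<in> \<int>" by blast
  show "pmod p k (from_digits S (F, d) p i (Suc k)) = from_digits S (F, d) p i k" for k
    by (rule pmod_eqI[OF b, where m = "int (d (p, i, k))"]) (simp add: from_digits_eq[OF F d p])
qed

lemma frp_from_digits:
  assumes "F \<in> FrS S" "d \<in> digit_space S"
  shows "frp (from_digits S (F, d)) = F"
proof (intro ext)
  fix p i
  show "frp (from_digits S (F, d)) p i = F p i"
    using from_digits_eq[OF assms, of p i 0] assms(1)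
    by (cases "p \<in> S") (auto simp: frp_def from_digits_def FrS_def)
qed

lemma from_digits_in_QSn:
  assumes S: "\<forall>p\<in>S. prime p" and F: "F \<in> FrS S" and d: "d \<in> digit_space S"
  shows "from_digits S (F, d) \<in> QSn S"
proof -
  have "from_digits S (F, d) p i 0 = F p i" for p i
    using frp_from_digits[OF F d] by (metis frp_def)
  moreover have "finite {p\<in>S. \<exists>i. F p i \<noteq> 0}"
    using F by (auto simp: FrS_def elim: rev_finite_subset)
  ultimately show ?thesis
    using is_Qp_from_digits[OF assms] by (auto simp: QSn_def from_digits_def)
qed

text \<open>F is recovered from level 0, and the digit at position j from the increment between
  levels j and j+1.\<close>

lemma inj_on_from_digits:
  assumes S: "\<forall>p\<in>S. prime p"
  shows "inj_on (from_digits S) (FrS S \<times> (digit_space S :: (nat \<times> 'n \<times> nat \<Rightarrow> nat) set))"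
proof (rule inj_onI)
  fix a b assume a: "a \<in> FrS S \<times> (digit_space S :: (nat \<times> 'n \<times> nat \<Rightarrow> nat) set)" and b: "b \<in> FrS S \<times> digit_space S"
    and eq: "from_digits S a = from_digits S b"
  obtain F d F' d' where ab: "a = (F, d)" "b = (F', d')" by (cases a, cases b)
  have "F = F'" using frp_from_digits eq a b ab by (metis mem_Sigma_iff)
  moreover have "d = d'"
  proof (rule PiE_ext)
    show "d \<in> (\<Pi>\<^sub>E pij\<in>digit_index S. {0..<fst pij})" "d' \<in> (\<Pi>\<^sub>E pij\<in>digit_index S. {0..<fst pij})"
      using a b ab by (auto simp: digit_space_def)
    fix z :: "nat \<times> 'n \<times> nat" assume "z \<in> digit_index S"
    then obtain p i j where z: "z = (p, i, j)" "p \<in> S" by (auto simp: digit_index_def)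
    have "from_digits S (F, d) p i k = from_digits S (F', d') p i k" for k
      using eq ab by simp
    then have "(\<Sum>j<k. real (d (p, i, j)) * real p ^ j) = (\<Sum>j<k. real (d' (p, i, j)) * real p ^ j)" for k
      using from_digits_eq[of F S d p i k] from_digits_eq[of F' S d' p i k] a b ab z \<open>F = F'\<close> by simp
    from this[of "Suc j"] this[of j] have "real (d (p, i, j)) * real p ^ j = real (d' (p, i, j)) * real p ^ j"
      by simp
    then show "d z = d' z"
      using S z by (auto dest: prime_gt_0_nat)
  qed
  ultimately show "a = b" using ab by simp
qed

subsection \<open>Characters in digit coordinates\<close>

lemma fracmul_eqI:
  assumes "\<And>K. K0 \<le> K \<Longrightarrow> frac (c K * d K) = v"
  shows "fracmul c d = v"
  unfolding fracmul_def
proof (rule the_equality)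
  show ev: "\<forall>\<^sub>F K in sequentially. frac (c K * d K) = v"
    using assms eventually_sequentially by blast
  fix v' assume "\<forall>\<^sub>F K in sequentially. frac (c K * d K) = v'"
  with ev have "\<forall>\<^sub>F K :: nat in sequentially. v' = v" by eventually_elim simp
  then show "v' = v" by simp
qed

text \<open>Modulo integers the products y_K t_K are eventually constant. The part with F depends on
  y modulo p^N only, because p^N F is an integer. The digit part is an integer, so it meets y
  through the fractional part \<open>y 0\<close> only, and positions from N' on contribute
  integers.\<close>

lemma fracmul_digits:
  assumes y: "is_Qp p y" and N: "real p ^ N * F \<in> \<int>" and N': "real p ^ N' * y 0 \<in> \<int>"
    and t: "\<And>k. t k = F + (\<Sum>j<k. real (d j) * real p ^ j)"
  shows "fracmul y t = frac (y N * F + (\<Sum>j<N'. y 0 * real p ^ j * real (d j)))"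
proof (rule fracmul_eqI[where ?K0.0 = "max N N'"], rule frac_cong)
  fix K assume "max N N' \<le> K"
  then have K: "N \<le> K" "N' \<le> K" by auto
  obtain m where m: "y K = y N + real p ^ N * of_int m" using is_Qp_step[OF y K(1)] by blast
  obtain m0 where m0: "y K = y 0 + of_int m0" using is_Qp_step[OF y, of 0 K] by auto
  have split: "(\<Sum>j<K. y 0 * real p ^ j * real (d j)) =
     (\<Sum>j<N'. y 0 * real p ^ j * real (d j)) + (\<Sum>j\<in>{N'..<K}. y 0 * real p ^ j * real (d j))"
    using K sum.atLeastLessThan_concat[of 0 N' K "\<lambda>j. y 0 * real p ^ j * real (d j)"] by (simp add: lessThan_atLeast0)
  have tail: "(\<Sum>j\<in>{N'..<K}. y 0 * real p ^ j * real (d j)) \<in> \<int>"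
  proof (rule Ints_sum)
    fix j assume j: "j \<in> {N'..<K}"
    have eq: "y 0 * real p ^ j * real (d j) = (real p ^ N' * y 0) * real p ^ (j - N') * real (d j)"
      using j by (simp flip: power_add)
    show "y 0 * real p ^ j * real (d j) \<in> \<int>"
      unfolding eq by (intro Ints_mult N') simp_all
  qed
  have "y K * t K = y K * F + (\<Sum>j<K. y K * (real p ^ j * real (d j)))"
    unfolding t distrib_left sum_distrib_left by (simp add: mult_ac)
  also have "y K * F = y N * F + of_int m * (real p ^ N * F)"
    unfolding m by (simp add: algebra_simps)
  also have "(\<Sum>j<K. y K * (real p ^ j * real (d j))) =
     (\<Sum>j<K. y 0 * real p ^ j * real (d j)) + (\<Sum>j<K. of_int m0 * (real p ^ j * real (d j)))"
    unfolding m0 by (simp add: sum.distrib algebra_simps)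
  finally have "y K * t K - (y N * F + (\<Sum>j<N'. y 0 * real p ^ j * real (d j)))
     = of_int m * (real p ^ N * F) + (\<Sum>j\<in>{N'..<K}. y 0 * real p ^ j * real (d j))
       + (\<Sum>j<K. of_int m0 * (real p ^ j * real (d j)))"
    unfolding split by simp
  also have "\<dots> \<in> \<int>"
    by (intro Ints_add tail Ints_sum Ints_mult N) simp_all
  finally show "y K * t K - (y N * F + (\<Sum>j<N'. y 0 * real p ^ j * real (d j))) \<in> \<int>" .
qed

lemma nonint_powers_subset:
  assumes "real p ^ N * r \<in> \<int>"
  shows "{j. real p ^ j * r \<notin> \<int>} \<subseteq> {..<N}"
proof (rule subsetI, rule ccontr)
  fix j assume j: "j \<in> {j. real p ^ j * r \<notin> \<int>}" "j \<notin> {..<N}"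
  then have eq: "real p ^ j * r = real p ^ (j - N) * (real p ^ N * r)"
    by (simp flip: power_add)
  have "real p ^ j * r \<in> \<int>"
    unfolding eq by (intro Ints_mult assms) simp
  then show False using j by simp
qed

text \<open>The digits on which the character with fractional part v really depends: position j
  becomes trivial once p^j v is an integer. Restricting to them makes the product in
  \<open>dchar\<close> finite.\<close>

definition char_index :: "(nat \<Rightarrow> 'n \<Rightarrow> real) \<Rightarrow> (nat \<times> 'n \<times> nat) set" where
  "char_index v = {(p, i, j). real p ^ j * v p i \<notin> \<int>}"

text \<open>The character of K attached to the class v, that is, x mapped to the product over p of
  exp(-2 pi i {<v_p, x_p>}), with x written in digits.\<close>

definition dchar :: "(nat \<Rightarrow> 'n \<Rightarrow> real) \<Rightarrow> (nat \<times> 'n \<times> nat \<Rightarrow> nat) \<Rightarrow> complex" where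
  "dchar v d = (\<Prod>(p, i, j)\<in>char_index v. ez (v p i * real p ^ j * real (d (p, i, j))))"

lemma char_index_subset: "v \<in> FrS S \<Longrightarrow> char_index v \<subseteq> digit_index S"
  by (force simp: char_index_def digit_index_def FrS_def)

lemma finite_char_index:
  fixes v :: "nat \<Rightarrow> 'n::finite \<Rightarrow> real"
  assumes v: "v \<in> FrS S"
  shows "finite (char_index v)"
proof (rule finite_subset)
  show "char_index v \<subseteq> Sigma {p. \<exists>i. v p i \<noteq> 0} (\<lambda>p. Sigma UNIV (\<lambda>i. {j. real p ^ j * v p i \<notin> \<int>}))"
    by (auto simp: char_index_def) (metis Ints_0 mult_zero_right)
  have "finite {j. real p ^ j * v p i \<notin> \<int>}" for p i
  proof (cases "p \<in> S")
    case True
    then obtain N where "real p ^ N * v p i \<in> \<int>" using FrS_den[OF v] by blast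
    then show ?thesis by (rule finite_subset[OF nonint_powers_subset]) simp
  next
    case False
    then show ?thesis using v by (simp add: FrS_def)
  qed
  then show "finite (Sigma {p. \<exists>i. v p i \<noteq> 0} (\<lambda>p. Sigma UNIV (\<lambda>i. {j. real p ^ j * v p i \<notin> \<int>})))"
    using v by (auto simp: FrS_def intro!: finite_SigmaI)
qed

text \<open>Factors outside \<open>char_index v\<close> equal 1. Enlarging the index set puts
  several characters over a common one.\<close>

lemma dchar_eq_prod:
  assumes "finite J" "char_index v \<subseteq> J"
  shows "dchar v d = (\<Prod>(p, i, j)\<in>J. ez (v p i * real p ^ j * real (d (p, i, j))))"
  unfolding dchar_def
proof (rule prod.mono_neutral_left[OF assms])
  have "ez (v p i * real p ^ j * real (d (p, i, j))) = 1" if "(p, i, j) \<notin> char_index v" for p i j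
    using that by (intro ez_Ints Ints_mult[OF _ Ints_of_nat]) (simp add: char_index_def mult.commute)
  then show "\<forall>z\<in>J - char_index v. (case z of (p, i, j) \<Rightarrow> ez (v p i * real p ^ j * real (d (p, i, j)))) = 1"
    by auto
qed

definition chif :: "nat set \<Rightarrow> (nat \<Rightarrow> 'n::finite \<Rightarrow> nat \<Rightarrow> real) \<Rightarrow> (nat \<Rightarrow> 'n \<Rightarrow> nat \<Rightarrow> real) \<Rightarrow> complex" where
  "chif S y t = (\<Prod>p\<in>{p\<in>S. frac_inner (y p) (t p) \<noteq> 0}. ez (frac_inner (y p) (t p)))"

lemma chi_inner_eq: "chi_inner S y t = cis (2 * pi * (fst y \<bullet> fst t)) * chif S (snd y) (snd t)"
  by (simp add: chi_inner_def chif_def ez_def)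

text \<open>The value of the character y at the representative F of a coset of K. The constant
  sequence is the p-adic number F itself, whose residues are all equal because 0 \<le> F <
  1.\<close>

definition chif_phase :: "nat set \<Rightarrow> (nat \<Rightarrow> 'n::finite \<Rightarrow> nat \<Rightarrow> real) \<Rightarrow> (nat \<Rightarrow> 'n \<Rightarrow> real) \<Rightarrow> complex" where
  "chif_phase S y F = (\<Prod>p\<in>{p\<in>S. \<exists>i. y p i 0 \<noteq> 0 \<or> F p i \<noteq> 0}. \<Prod>i\<in>UNIV. ez (fracmul (y p i) (\<lambda>_. F p i)))"

lemma norm_chif_phase: "norm (chif_phase S y F) = 1"
  by (simp add: chif_phase_def prod_norm[symmetric])

text \<open>Write t = F + x with x in K. The value at F is a phase common to the whole coset, and
  the value at x is a character of K that depends on the fractional part of y alone.\<close>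

lemma chif_from_digits:
  fixes y :: "nat \<Rightarrow> 'n::finite \<Rightarrow> nat \<Rightarrow> real"
  assumes S: "\<forall>p\<in>S. prime p" and y: "y \<in> QSn S" and F: "F \<in> FrS S" and d: "d \<in> digit_space S"
  shows "chif S y (from_digits S (F, d)) = chif_phase S y F * dchar (frp y) d"
proof -
  define t where "t = from_digits S (F, d)"
  define P where "P = {p\<in>S. \<exists>i. y p i 0 \<noteq> 0 \<or> F p i \<noteq> 0}"
  have finP: "finite P"
  proof (rule finite_subset)
    show "P \<subseteq> {p\<in>S. \<exists>i. y p i 0 \<noteq> 0} \<union> {p. \<exists>i. F p i \<noteq> 0}" by (auto simp: P_def)
    show "finite ({p\<in>S. \<exists>i. y p i 0 \<noteq> 0} \<union> {p. \<exists>i. F p i \<noteq> 0})"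
      using y F by (simp add: QSn_def FrS_def)
  qed
  have yp: "is_Qp p (y p i)" if "p \<in> S" for p i
    using y that by (simp add: QSn_def)
  have tp: "t p i k = F p i + (\<Sum>j<k. real (d (p, i, j)) * real p ^ j)" if "p \<in> S" for p i k
    unfolding t_def by (rule from_digits_eq[OF F d that])
  \<comment> \<open>Outside the finite set P both F and the fractional part of y vanish, so zero
    terms suffice in \<open>fracmul_digits\<close>.\<close>
  have zero: "frac_inner (y p) (t p) = 0" if "p \<in> S" "p \<notin> P" for p
  proof -
    have "fracmul (y p i) (t p i) = 0" for i
      using fracmul_digits[OF yp[OF that(1)], of 0 "F p i" 0 i "t p i" "\<lambda>j. d (p, i, j)"] tp that
      by (simp add: P_def)
    then show ?thesis by (simp add: frac_inner_def)
  qed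
  have fm: "ez (fracmul (y p i) (t p i)) = ez (fracmul (y p i) (\<lambda>_. F p i)) *
     (\<Prod>j\<in>{j. real p ^ j * y p i 0 \<notin> \<int>}. ez (y p i 0 * real p ^ j * real (d (p, i, j))))"
    if p: "p \<in> S" for p i
  proof -
    obtain N where N: "real p ^ N * F p i \<in> \<int>" using FrS_den[OF F p] by blast
    obtain N' where N': "real p ^ N' * y p i 0 \<in> \<int>" using yp[OF p, of i] by (auto simp: is_Qp_def)
    have "ez (fracmul (y p i) (t p i)) = ez (y p i N * F p i) * (\<Prod>j<N'. ez (y p i 0 * real p ^ j * real (d (p, i, j))))"
      using fracmul_digits[OF yp[OF p] N N', of "t p i" "\<lambda>j. d (p, i, j)"] tp[OF p]
      by (simp add: ez_frac ez_add ez_sum)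
    \<comment> \<open>The same formula with all digits equal to 0 identifies the factor that belongs
      to F.\<close>
    moreover have "ez (fracmul (y p i) (\<lambda>_. F p i)) = ez (y p i N * F p i)"
      using fracmul_digits[OF yp[OF p] N N', of "\<lambda>_. F p i" "\<lambda>_. 0"] by (simp add: ez_frac)
    moreover have "(\<Prod>j<N'. ez (y p i 0 * real p ^ j * real (d (p, i, j)))) =
       (\<Prod>j\<in>{j. real p ^ j * y p i 0 \<notin> \<int>}. ez (y p i 0 * real p ^ j * real (d (p, i, j))))"
    proof (rule prod.mono_neutral_right)
      show "\<forall>j\<in>{..<N'} - {j. real p ^ j * y p i 0 \<notin> \<int>}. ez (y p i 0 * real p ^ j * real (d (p, i, j))) = 1"
        by (auto intro!: ez_Ints Ints_mult[OF _ Ints_of_nat] simp: mult.commute)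
    qed (use nonint_powers_subset[OF N'] in auto)
    ultimately show ?thesis by simp
  qed
  have "chif S y t = (\<Prod>p\<in>P. ez (frac_inner (y p) (t p)))"
    unfolding chif_def using zero by (intro prod.mono_neutral_left finP) (auto simp: P_def)
  also have "\<dots> = (\<Prod>p\<in>P. \<Prod>i\<in>UNIV. ez (fracmul (y p i) (t p i)))"
    by (simp add: frac_inner_def ez_frac ez_sum)
  also have "\<dots> = (\<Prod>p\<in>P. \<Prod>i\<in>UNIV. ez (fracmul (y p i) (\<lambda>_. F p i)) *
     (\<Prod>j\<in>{j. real p ^ j * y p i 0 \<notin> \<int>}. ez (y p i 0 * real p ^ j * real (d (p, i, j)))))"
    by (intro prod.cong refl fm) (simp add: P_def)
  also have "\<dots> = chif_phase S y F *
     (\<Prod>p\<in>P. \<Prod>i\<in>UNIV. \<Prod>j\<in>{j. real p ^ j * y p i 0 \<notin> \<int>}. ez (y p i 0 * real p ^ j * real (d (p, i, j))))"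
    unfolding chif_phase_def P_def[symmetric] by (simp add: prod.distrib)
  also have "(\<Prod>p\<in>P. \<Prod>i\<in>UNIV. \<Prod>j\<in>{j. real p ^ j * y p i 0 \<notin> \<int>}. ez (y p i 0 * real p ^ j * real (d (p, i, j))))
     = dchar (frp y) d"
  proof -
    have fin: "finite {j. real p ^ j * y p i 0 \<notin> \<int>}" if p: "p \<in> P" for p i
    proof -
      obtain N' where N': "real p ^ N' * y p i 0 \<in> \<int>" using yp[of p i] p by (auto simp: P_def is_Qp_def)
      then show ?thesis by (rule finite_subset[OF nonint_powers_subset]) simp
    qed
    have inP: "p \<in> P" if "real p ^ j * y p i 0 \<notin> \<int>" for p i j
    proof -
      have "y p i 0 \<noteq> 0" using that by auto
      moreover from this have "p \<in> S" using y by (auto simp: QSn_def)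
      ultimately show ?thesis by (auto simp: P_def)
    qed
    have idx: "char_index (frp y) = Sigma P (\<lambda>p. Sigma UNIV (\<lambda>i. {j. real p ^ j * y p i 0 \<notin> \<int>}))"
      using inP by (auto simp: char_index_def frp_def)
    have "(\<Prod>p\<in>P. \<Prod>i\<in>UNIV. \<Prod>j\<in>{j. real p ^ j * y p i 0 \<notin> \<int>}. ez (y p i 0 * real p ^ j * real (d (p, i, j))))
      = (\<Prod>p\<in>P. \<Prod>(i, j)\<in>Sigma UNIV (\<lambda>i. {j. real p ^ j * y p i 0 \<notin> \<int>}). ez (y p i 0 * real p ^ j * real (d (p, i, j))))"
      using fin by (intro prod.cong refl prod.Sigma) auto
    also have "\<dots> = (\<Prod>(p, i, j)\<in>Sigma P (\<lambda>p. Sigma UNIV (\<lambda>i. {j. real p ^ j * y p i 0 \<notin> \<int>})).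
        ez (y p i 0 * real p ^ j * real (d (p, i, j))))"
      using fin finP by (intro prod.Sigma) auto
    finally show ?thesis
      unfolding dchar_def idx by (simp add: frp_def)
  qed
  finally show ?thesis unfolding t_def .
qed

section \<open>Orthonormal systems with dense span\<close>

lemma l2norm_minus: "l2norm M (\<lambda>x. f x - g x) = l2norm M (\<lambda>x. g x - f x)"
  by (simp add: l2norm_def norm_minus_commute)

lemma l2norm_cmult_sq: "(l2norm M (\<lambda>x. c * f x))\<^sup>2 = (norm c)\<^sup>2 * (l2norm M f)\<^sup>2"
  by (simp add: l2norm_sq norm_mult power_mult_distrib)

lemma l2norm_diff_sq_triangle:
  assumes "f \<in> L2 M" "g \<in> L2 M" "h \<in> L2 M"
  shows "(l2norm M (\<lambda>x. f x - h x))\<^sup>2 \<le> 2 * (l2norm M (\<lambda>x. f x - g x))\<^sup>2 + 2 * (l2norm M (\<lambda>x. g x - h x))\<^sup>2"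
  using l2norm_diff_sq_le[OF L2_diff[OF assms(1,2)] L2_diff[OF assms(3,2)]] l2norm_minus[of M h g] by simp

definition l2_closure :: "'a measure \<Rightarrow> ('a \<Rightarrow> complex) set \<Rightarrow> ('a \<Rightarrow> complex) set" where
  "l2_closure M T = {f \<in> L2 M. \<forall>e>0. \<exists>q\<in>T. (l2norm M (\<lambda>x. f x - q x))\<^sup>2 < e}"

text \<open>T will be the trigonometric polynomials in the digits. Closure under products makes the
  sets whose indicators lie in T stable under intersection.\<close>

locale l2_algebra = finite_measure M for M :: "'a measure" +
  fixes T :: "('a \<Rightarrow> complex) set"
  assumes T_L2: "q \<in> T \<Longrightarrow> q \<in> L2 M"
    and T_one: "(\<lambda>_. 1) \<in> T"
    and T_add: "q \<in> T \<Longrightarrow> r \<in> T \<Longrightarrow> (\<lambda>x. q x + r x) \<in> T"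
    and T_cmult: "q \<in> T \<Longrightarrow> (\<lambda>x. c * q x) \<in> T"
    and T_mult: "q \<in> T \<Longrightarrow> r \<in> T \<Longrightarrow> (\<lambda>x. q x * r x) \<in> T"
begin

lemma closure_L2: "f \<in> l2_closure M T \<Longrightarrow> f \<in> L2 M"
  by (simp add: l2_closure_def)

lemma closure_incl: "q \<in> T \<Longrightarrow> q \<in> l2_closure M T"
  unfolding l2_closure_def by (auto intro!: T_L2 bexI[of _ q] simp: l2norm_def)

lemma closure_limit:
  assumes f: "f \<in> L2 M" and approx: "\<And>e. 0 < e \<Longrightarrow> \<exists>g\<in>l2_closure M T. (l2norm M (\<lambda>x. f x - g x))\<^sup>2 < e"
  shows "f \<in> l2_closure M T"
  unfolding l2_closure_def
proof (intro CollectI conjI allI impI f)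
  fix e :: real assume e: "0 < e"
  \<comment> \<open>Both errors are doubled by the squared triangle inequality, hence a quarter of e
    for each.\<close>
  then obtain g where g: "g \<in> l2_closure M T" "(l2norm M (\<lambda>x. f x - g x))\<^sup>2 < e / 4"
    using approx[of "e / 4"] by auto
  obtain q where q: "q \<in> T" "(l2norm M (\<lambda>x. g x - q x))\<^sup>2 < e / 4"
    using g(1) e unfolding l2_closure_def by (force dest: spec[of _ "e / 4"])
  show "\<exists>q\<in>T. (l2norm M (\<lambda>x. f x - q x))\<^sup>2 < e"
    using l2norm_diff_sq_triangle[OF f closure_L2[OF g(1)] T_L2[OF q(1)]] g(2) q by (intro bexI[of _ q]) auto
qed

lemma closure_cong:
  assumes f: "f \<in> l2_closure M T" and eq: "\<And>x. x \<in> space M \<Longrightarrow> f x = g x"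
  shows "g \<in> l2_closure M T"
proof (rule closure_limit)
  show "g \<in> L2 M" using closure_L2[OF f] L2_cong[of M f g] eq by simp
  have "l2norm M (\<lambda>x. g x - f x) = l2norm M (\<lambda>x. 0)" by (rule l2norm_cong) (simp add: eq)
  then have "l2norm M (\<lambda>x. g x - f x) = 0" by (simp add: l2norm_def)
  then show "\<exists>h\<in>l2_closure M T. (l2norm M (\<lambda>x. g x - h x))\<^sup>2 < e" if "0 < e" for e
    using f that by (intro bexI[of _ f]) auto
qed

lemma closure_add:
  assumes f: "f \<in> l2_closure M T" and g: "g \<in> l2_closure M T"
  shows "(\<lambda>x. f x + g x) \<in> l2_closure M T"
  unfolding l2_closure_def
proof (intro CollectI conjI allI impI L2_add closure_L2 f g)
  fix e :: real assume e: "0 < e"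
  then have e4: "0 < e / 4" by simp
  obtain q where q: "q \<in> T" "(l2norm M (\<lambda>x. f x - q x))\<^sup>2 < e / 4"
    using f e4 unfolding l2_closure_def by blast
  obtain r where r: "r \<in> T" "(l2norm M (\<lambda>x. g x - r x))\<^sup>2 < e / 4"
    using g e4 unfolding l2_closure_def by blast
  have "(l2norm M (\<lambda>x. (f x - q x) - (r x - g x)))\<^sup>2
    \<le> 2 * (l2norm M (\<lambda>x. f x - q x))\<^sup>2 + 2 * (l2norm M (\<lambda>x. r x - g x))\<^sup>2"
    by (intro l2norm_diff_sq_le L2_diff closure_L2 f g T_L2 q r)
  also have "\<dots> < e" using q r l2norm_minus[of M r g] by simp
  finally show "\<exists>q\<in>T. (l2norm M (\<lambda>x. f x + g x - q x))\<^sup>2 < e"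
    using T_add[OF q(1) r(1)] by (intro bexI[of _ "\<lambda>x. q x + r x"]) (simp_all add: algebra_simps)
qed

lemma closure_cmult:
  assumes f: "f \<in> l2_closure M T"
  shows "(\<lambda>x. c * f x) \<in> l2_closure M T"
  unfolding l2_closure_def
proof (intro CollectI conjI allI impI L2_cmult closure_L2 f)
  fix e :: real assume e: "0 < e"
  \<comment> \<open>Adding 1 avoids a zero divisor when c = 0.\<close>
  have pos: "0 < (norm c)\<^sup>2 + 1" by (simp add: add_nonneg_pos)
  then have "0 < e / ((norm c)\<^sup>2 + 1)" using e by simp
  then obtain q where q: "q \<in> T" "(l2norm M (\<lambda>x. f x - q x))\<^sup>2 < e / ((norm c)\<^sup>2 + 1)"
    using f unfolding l2_closure_def by blast
  have "(l2norm M (\<lambda>x. c * f x - c * q x))\<^sup>2 = (norm c)\<^sup>2 * (l2norm M (\<lambda>x. f x - q x))\<^sup>2"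
    using l2norm_cmult_sq[of M c "\<lambda>x. f x - q x"] by (simp add: right_diff_distrib)
  also have "\<dots> \<le> ((norm c)\<^sup>2 + 1) * (l2norm M (\<lambda>x. f x - q x))\<^sup>2"
    by (intro mult_right_mono) auto
  also have "\<dots> < e" using q(2) pos by (simp add: field_simps)
  finally show "\<exists>q\<in>T. (l2norm M (\<lambda>x. c * f x - q x))\<^sup>2 < e"
    using T_cmult[OF q(1), of c] by (intro bexI[of _ "\<lambda>x. c * q x"]) simp_all
qed

lemma T_zero: "(\<lambda>x. 0) \<in> T"
  using T_cmult[OF T_one, of 0] by simp

lemma closure_sum:
  "(\<And>i. i \<in> I \<Longrightarrow> f i \<in> l2_closure M T) \<Longrightarrow> (\<lambda>x. \<Sum>i\<in>I. f i x) \<in> l2_closure M T"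
  by (induction I rule: infinite_finite_induct) (auto intro: closure_incl T_zero closure_add)

text \<open>Dominated convergence applied to the squared errors. It covers both countable unions of
  sets and approximation by simple functions.\<close>

lemma closure_dominated:
  assumes s: "\<And>n. s n \<in> l2_closure M T" and f: "f \<in> L2 M"
    and w: "integrable M (\<lambda>x. (w x)\<^sup>2)"
    and lim: "\<And>x. x \<in> space M \<Longrightarrow> (\<lambda>n. s n x) \<longlonglongrightarrow> f x"
    and bound: "\<And>n x. x \<in> space M \<Longrightarrow> norm (f x - s n x) \<le> w x"
  shows "f \<in> l2_closure M T"
proof (rule closure_limit[OF f])
  fix e :: real assume e: "0 < e"
  note [measurable] = L2_measurable[OF f] L2_measurable[OF closure_L2[OF s]]
  have "(\<lambda>n. \<integral>x. (norm (f x - s n x))\<^sup>2 \<partial>M) \<longlonglongrightarrow> (\<integral>x. 0 \<partial>M)"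
  proof (rule integral_dominated_convergence[OF _ _ w])
    show "AE x in M. (\<lambda>n. (norm (f x - s n x))\<^sup>2) \<longlonglongrightarrow> 0"
    proof (rule AE_I2)
      fix x assume "x \<in> space M"
      then have "(\<lambda>n. (norm (f x - s n x))\<^sup>2) \<longlonglongrightarrow> (norm (f x - f x))\<^sup>2"
        by (intro tendsto_intros lim)
      then show "(\<lambda>n. (norm (f x - s n x))\<^sup>2) \<longlonglongrightarrow> 0" by simp
    qed
    show "AE x in M. norm ((norm (f x - s n x))\<^sup>2) \<le> (w x)\<^sup>2" for n
      using bound by (intro AE_I2) (simp add: power_mono)
  qed measurable
  then have "(\<lambda>n. (l2norm M (\<lambda>x. f x - s n x))\<^sup>2) \<longlonglongrightarrow> 0" by (simp add: l2norm_sq)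
  from eventually_happens'[OF sequentially_bot order_tendstoD(2)[OF this e]]
  obtain n where "(l2norm M (\<lambda>x. f x - s n x))\<^sup>2 < e"
    by (elim exE)
  then show "\<exists>g\<in>l2_closure M T. (l2norm M (\<lambda>x. f x - g x))\<^sup>2 < e"
    using s by blast
qed

lemma L2_indicator: "A \<in> sets M \<Longrightarrow> (indicator A :: 'a \<Rightarrow> complex) \<in> L2 M"
proof -
  assume A: "A \<in> sets M"
  have "(\<lambda>x. (norm (indicator A x :: complex))\<^sup>2) = (\<lambda>x. indicator A x :: real)"
    by (auto simp: indicator_def)
  then show ?thesis
    using A integrable_real_indicator[OF A] emeasure_finite[of A]
    by (simp add: L2_def less_top[symmetric])
qed

text \<open>The sets whose indicators agree with an element of T form an intersection-stable
  generator. Dynkin induction puts the indicators of all measurable sets into the closure; linear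
  combinations and dominated limits of simple functions then reach every f.\<close>

theorem L2_eq_closure:
  assumes gen: "sets M = sigma_sets (space M) G" and G: "G \<subseteq> Pow (space M)"
    and ind: "\<And>A. A \<in> G \<Longrightarrow> \<exists>q\<in>T. \<forall>x\<in>space M. q x = indicator A x"
    and f: "f \<in> L2 M"
  shows "f \<in> l2_closure M T"
proof -
  define AA where "AA = {A \<in> sets M. \<exists>q\<in>T. \<forall>x\<in>space M. q x = indicator A x}"
  have GAA: "G \<subseteq> AA"
    using ind gen by (auto simp: AA_def intro: sigma_sets.Basic)
  have AA_sets: "sets M = sigma_sets (space M) AA"
  proof
    show "sets M \<subseteq> sigma_sets (space M) AA"
      unfolding gen by (rule sigma_sets_mono') (rule GAA)
    show "sigma_sets (space M) AA \<subseteq> sets M"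
      by (rule sets.sigma_sets_subset) (auto simp: AA_def)
  qed
  have AA_Pow: "AA \<subseteq> Pow (space M)"
    using sets.sets_into_space by (auto simp: AA_def)
  have stable: "Int_stable AA"
  proof (rule Int_stableI)
    fix A B assume "A \<in> AA" "B \<in> AA"
    then obtain q r where AB: "A \<in> sets M" "B \<in> sets M" and q: "q \<in> T" "\<forall>x\<in>space M. q x = indicator A x"
      and r: "r \<in> T" "\<forall>x\<in>space M. r x = indicator B x" by (auto simp: AA_def)
    have "\<forall>x\<in>space M. q x * r x = indicator (A \<inter> B) x"
      using q r by (auto simp: indicator_def)
    then have "\<exists>q\<in>T. \<forall>x\<in>space M. q x = indicator (A \<inter> B) x"
      using T_mult[OF q(1) r(1)] by (intro bexI[of _ "\<lambda>x. q x * r x"])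
    with AB show "A \<inter> B \<in> AA"
      by (auto simp: AA_def)
  qed
  \<comment> \<open>Disjointness in the union case makes every partial sum of indicators an
    indicator again, so the constant 1 bounds the error.\<close>
  have sets_closure: "(indicator A :: 'a \<Rightarrow> complex) \<in> l2_closure M T" if "A \<in> sets M" for A
    using stable AA_Pow that[unfolded AA_sets]
  proof (induction rule: sigma_sets_induct_disjoint)
    case (basic A)
    then obtain q where q: "q \<in> T" "\<forall>x\<in>space M. q x = indicator A x" by (auto simp: AA_def)
    then show ?case by (intro closure_cong[OF closure_incl[OF q(1)]]) simp
  next
    case empty
    show ?case by (rule closure_cong[OF closure_incl[OF T_zero]]) simp
  next
    case (compl A)
    have "(\<lambda>x. 1 + (-1) * indicator A x) \<in> l2_closure M T"
      by (intro closure_add closure_cmult closure_incl[OF T_one] compl)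
    then show ?case by (rule closure_cong) (auto simp: indicator_def)
  next
    case (union A)
    have meas: "range A \<subseteq> sets M" using union(2) AA_sets by simp
    show ?case
    proof (rule closure_dominated[where w = "\<lambda>x. 1" and s = "\<lambda>n x. \<Sum>i<n. indicator (A i) x"])
      show "(\<lambda>x. \<Sum>i<n. indicator (A i) x) \<in> l2_closure M T" for n
        by (intro closure_sum union)
      show "indicator (\<Union> (range A)) \<in> L2 M"
        using meas by (intro L2_indicator) blast
      show "integrable M (\<lambda>x. 1\<^sup>2 :: real)" by simp
      fix x
      have part: "(\<Sum>i<n. indicator (A i) x :: complex) = indicator (\<Union>i<n. A i) x" for n
      proof -
        have "disjoint_family_on A {..<n}" using union(1) by (auto simp: disjoint_family_on_def)
        then show ?thesis
          by (rule indicator_UN_disjoint[OF finite_lessThan, symmetric])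
      qed
      show "(\<lambda>n. \<Sum>i<n. indicator (A i) x :: complex) \<longlonglongrightarrow> indicator (\<Union> (range A)) x"
        unfolding part by (rule LIMSEQ_indicator_UN)
      show "norm (indicator (\<Union> (range A)) x - (\<Sum>i<n. indicator (A i) x) :: complex) \<le> 1" for n
        unfolding part by (auto simp: indicator_def)
    qed
  qed
  note [measurable] = L2_measurable[OF f]
  obtain F where F: "\<And>i. simple_function M (F i)" "\<And>x. x \<in> space M \<Longrightarrow> (\<lambda>i. F i x) \<longlonglongrightarrow> f x"
    "\<And>i x. x \<in> space M \<Longrightarrow> dist (F i x) 0 \<le> 2 * dist (f x) 0"
    using borel_measurable_implies_sequence_metric[OF L2_measurable[OF f], of 0] by blast
  show ?thesis
  \<comment> \<open>The approximating simple functions are bounded by twice the norm of f, whence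
    the factor 3.\<close>
  proof (rule closure_dominated[OF _ f, where w = "\<lambda>x. 3 * norm (f x)" and s = F])
    fix n
    have "(\<lambda>x. \<Sum>y\<in>F n ` space M. y * indicator (F n -` {y} \<inter> space M) x) \<in> l2_closure M T"
      by (intro closure_sum closure_cmult sets_closure simple_functionD(2)[OF F(1)])
    then show "F n \<in> l2_closure M T"
    proof (rule closure_cong)
      fix x assume x: "x \<in> space M"
      have "F n x = (\<Sum>y\<in>F n ` space M. indicator (F n -` {y} \<inter> space M) x *\<^sub>R y)"
        by (rule simple_function_indicator_representation_banach[OF F(1) x])
      also have "\<dots> = (\<Sum>y\<in>F n ` space M. y * indicator (F n -` {y} \<inter> space M) x)"
        by (intro sum.cong refl) (auto simp: indicator_def)
      finally show "(\<Sum>y\<in>F n ` space M. y * indicator (F n -` {y} \<inter> space M) x) = F n x" ..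
    qed
  next
    show "integrable M (\<lambda>x. (3 * norm (f x))\<^sup>2)"
      using L2_integrable[OF f] by (simp add: power_mult_distrib)
    fix n x assume x: "x \<in> space M"
    show "norm (f x - F n x) \<le> 3 * norm (f x)"
      using F(3)[OF x, of n] norm_triangle_ineq4[of "f x" "F n x"] by simp
  qed (rule F(2))
qed

end

text \<open>Completing the square. Choosing for a the coefficients of f gives Bessel's inequality; a
  general a measures how far it is from the best choice.\<close>

lemma l2norm_sq_diff_orthonormal:
  assumes f: "f \<in> L2 M" and V: "finite V" and e: "\<And>v. v \<in> V \<Longrightarrow> e v \<in> L2 M"
    and orth: "\<And>u v. u \<in> V \<Longrightarrow> v \<in> V \<Longrightarrow> ip M (e u) (e v) = (if u = v then 1 else 0)"
  shows "(l2norm M (\<lambda>x. f x - (\<Sum>v\<in>V. a v * e v x)))\<^sup>2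
    = (l2norm M f)\<^sup>2 - (\<Sum>v\<in>V. (norm (ip M f (e v)))\<^sup>2) + (\<Sum>v\<in>V. (norm (ip M f (e v) - a v))\<^sup>2)"
proof -
  define s where "s = (\<lambda>x. \<Sum>v\<in>V. a v * e v x)"
  have s: "s \<in> L2 M" unfolding s_def by (intro L2_sum L2_cmult e)
  have left: "ip M s h = (\<Sum>v\<in>V. a v * ip M (e v) h)" if "h \<in> L2 M" for h
    unfolding s_def using that by (subst ip_sum_left) (auto intro!: L2_cmult e simp: ip_cmult_left)
  have se: "ip M s (e u) = a u" if "u \<in> V" for u
    using that V by (simp add: left e orth if_distrib[of "(*) _"] cong: if_cong)
  have sf: "ip M s f = (\<Sum>v\<in>V. a v * cnj (ip M f (e v)))"
    unfolding left[OF f] by (intro sum.cong refl) (simp add: ip_commute[of M "e _" f])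
  have ss: "ip M s s = (\<Sum>v\<in>V. a v * cnj (a v))"
    unfolding left[OF s] by (intro sum.cong refl) (simp add: ip_commute[of M "e _" s] se)
  have "ip M (\<lambda>x. f x - s x) (\<lambda>x. f x - s x) = ip M f f - cnj (ip M s f) - ip M s f + ip M s s"
    using f s by (simp add: ip_diff_left ip_diff_right L2_diff ip_commute[of M f s])
  also have "\<dots> = ip M f f - (\<Sum>v\<in>V. ip M f (e v) * cnj (ip M f (e v)))
     + (\<Sum>v\<in>V. (ip M f (e v) - a v) * cnj (ip M f (e v) - a v))"
    unfolding sf ss by (simp add: sum_subtractf[symmetric] sum.distrib[symmetric] algebra_simps)
  finally have "complex_of_real ((l2norm M (\<lambda>x. f x - s x))\<^sup>2) = of_real ((l2norm M f)\<^sup>2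
     - (\<Sum>v\<in>V. (norm (ip M f (e v)))\<^sup>2) + (\<Sum>v\<in>V. (norm (ip M f (e v) - a v))\<^sup>2))"
    unfolding ip_self by (simp add: complex_norm_square[symmetric] del: complex_cnj_diff)
  then show ?thesis
    unfolding s_def of_real_eq_iff .
qed

text \<open>The defect in Bessel's inequality is at most the squared distance from f to any finite
  combination, which density makes arbitrarily small.\<close>

lemma parseval_of_dense:
  assumes f: "f \<in> L2 M" and e: "\<And>v. v \<in> C \<Longrightarrow> e v \<in> L2 M"
    and orth: "\<And>u v. u \<in> C \<Longrightarrow> v \<in> C \<Longrightarrow> ip M (e u) (e v) = (if u = v then 1 else 0)"
    and dense: "\<And>\<epsilon>. 0 < \<epsilon> \<Longrightarrow> \<exists>V a. finite V \<and> V \<subseteq> C \<and> (l2norm M (\<lambda>x. f x - (\<Sum>v\<in>V. a v * e v x)))\<^sup>2 < \<epsilon>"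
  shows "(\<integral>\<^sup>+v. ennreal ((norm (ip M f (e v)))\<^sup>2) \<partial>count_space C) = ennreal ((l2norm M f)\<^sup>2)"
proof -
  define r where "r v = (norm (ip M f (e v)))\<^sup>2" for v
  have id: "(l2norm M (\<lambda>x. f x - (\<Sum>v\<in>V. a v * e v x)))\<^sup>2
    = (l2norm M f)\<^sup>2 - sum r V + (\<Sum>v\<in>V. (norm (ip M f (e v) - a v))\<^sup>2)" if "finite V" "V \<subseteq> C" for V a
    unfolding r_def using that by (intro l2norm_sq_diff_orthonormal f) (auto intro: e simp: orth subset_iff)
  have up: "sum r V \<le> (l2norm M f)\<^sup>2" if "finite V" "V \<subseteq> C" for V
  proof -
    have "0 \<le> (l2norm M f)\<^sup>2 - sum r V"
      using id[OF that, of "\<lambda>v. ip M f (e v)"] zero_le_power2[of "l2norm M (\<lambda>x. f x - (\<Sum>v\<in>V. ip M f (e v) * e v x))"]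
      by simp
    then show ?thesis by simp
  qed
  have hs: "(r has_sum (l2norm M f)\<^sup>2) C"
    unfolding has_sum_def
  proof (rule tendstoI)
    fix \<epsilon> :: real assume "0 < \<epsilon>"
    then obtain V a where V: "finite V" "V \<subseteq> C" "(l2norm M (\<lambda>x. f x - (\<Sum>v\<in>V. a v * e v x)))\<^sup>2 < \<epsilon>"
      using dense by blast
    have low: "(l2norm M f)\<^sup>2 - sum r V < \<epsilon>"
      using V(3) unfolding id[OF V(1,2)] by (smt (verit) sum_nonneg zero_le_power2)
    show "\<forall>\<^sub>F W in finite_subsets_at_top C. dist (sum r W) ((l2norm M f)\<^sup>2) < \<epsilon>"
      unfolding eventually_finite_subsets_at_top
    proof (intro exI[of _ V] conjI allI impI V)
      fix W assume W: "finite W \<and> V \<subseteq> W \<and> W \<subseteq> C"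
      then have "sum r V \<le> sum r W" by (intro sum_mono2) (auto simp: r_def)
      then show "dist (sum r W) ((l2norm M f)\<^sup>2) < \<epsilon>"
        using up[of W] W low by (simp add: dist_real_def)
    qed
  qed
  have "(\<lambda>v. norm (r v)) summable_on C"
    using has_sum_imp_summable[OF hs] by (simp add: r_def[abs_def])
  then have abs: "Infinite_Set_Sum.abs_summable_on r C"
    by (rule abs_summable_equivalent[THEN iffD1])
  have sum: "infsum r C = (l2norm M f)\<^sup>2"
    by (rule infsumI[OF hs])
  show ?thesis
    using nn_integral_conv_infsetsum[OF abs] infsetsum_infsum[OF abs] sum by (simp add: r_def)
qed

subsection \<open>Operations on orthonormal bases\<close>

text \<open>The point masses are an orthonormal basis of l^2(U), and here they are tensored with e.
  Pairing with a point mass is slicing at that point, so Parseval is \<open>tensor_parseval\<close>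
  over counting measure.\<close>

lemma orthonormal_basis_count_space:
  fixes Q :: "'b measure" and C :: "'c set" and U :: "'a set"
  assumes onb: "orthonormal_basis Q C e" and U: "countable U"
  shows "orthonormal_basis (count_space U \<Otimes>\<^sub>M Q) (U \<times> C)
    (\<lambda>(u, c) t. of_bool (fst t = u) * e c (snd t))"
proof -
  interpret e: orthonormal_basis Q C e by fact
  have sfU: "sigma_finite_measure (count_space U)"
    by (rule sigma_finite_measure_count_space_countable[OF U])
  interpret pair_sigma_finite "count_space U" Q
    using sfU e.sf by (simp add: pair_sigma_finite_def)
  define \<delta> :: "'a \<Rightarrow> 'a \<Rightarrow> complex" where "\<delta> u = (\<lambda>x. of_bool (x = u))" for u
  have ip_delta: "ip (count_space U) g (\<delta> u) = g u" if "u \<in> U" for g u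
  proof -
    have fin: "finite {a \<in> U. g a * cnj (\<delta> u a) \<noteq> 0}"
      by (rule finite_subset[of _ "{u}"]) (auto simp: \<delta>_def)
    have "ip (count_space U) g (\<delta> u) = (\<Sum>a | a \<in> U \<and> g a * cnj (\<delta> u a) \<noteq> 0. g a * cnj (\<delta> u a))"
      unfolding ip_def by (rule lebesgue_integral_count_space_finite_support[OF fin])
    also have "\<dots> = (\<Sum>a\<in>{u}. g a * cnj (\<delta> u a))"
      using that by (intro sum.mono_neutral_left) (auto simp: \<delta>_def)
    finally show ?thesis by (simp add: \<delta>_def)
  qed
  have \<delta>_L2: "\<delta> u \<in> L2 (count_space U)" if "u \<in> U" for u
  proof (rule L2I_nn_integral)
    have "(\<integral>\<^sup>+x. ennreal ((norm (\<delta> u x))\<^sup>2) \<partial>count_space U) = (\<integral>\<^sup>+x. indicator {u} x \<partial>count_space U)"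
      by (intro nn_integral_cong) (auto simp: \<delta>_def)
    also have "\<dots> < \<infinity>" using that by simp
    finally show "(\<integral>\<^sup>+x. ennreal ((norm (\<delta> u x))\<^sup>2) \<partial>count_space U) < \<infinity>" .
  qed simp
  show ?thesis
  proof
    show "countable (U \<times> C)"
      using U e.countable_C by simp
  next
    fix uc assume "uc \<in> U \<times> C"
    then show "(case uc of (u, c) \<Rightarrow> \<lambda>t. of_bool (fst t = u) * e c (snd t)) \<in> L2 (count_space U \<Otimes>\<^sub>M Q)"
      using L2_tensor[OF \<delta>_L2 e.w_L2] by (auto simp: \<delta>_def)
  next
    fix uc uc' assume "uc \<in> U \<times> C" "uc' \<in> U \<times> C"
    then obtain u c u' c' where eq: "uc = (u, c)" "uc' = (u', c')" "u \<in> U" "c \<in> C" "u' \<in> U" "c' \<in> C"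
      by blast
    have "ip (count_space U \<Otimes>\<^sub>M Q) (\<lambda>t. \<delta> u (fst t) * e c (snd t)) (\<lambda>t. \<delta> u' (fst t) * e c' (snd t))
      = (if c = c' then 1 else 0) * \<delta> u u'"
      using eq by (subst ip_tensor_tensor) (auto simp: \<delta>_L2 e.w_L2 e.w_orth ip_delta)
    then show "ip (count_space U \<Otimes>\<^sub>M Q) (case uc of (u, c) \<Rightarrow> \<lambda>t. of_bool (fst t = u) * e c (snd t))
        (case uc' of (u, c) \<Rightarrow> \<lambda>t. of_bool (fst t = u) * e c (snd t)) = (if uc = uc' then 1 else 0)"
      using eq by (auto simp: \<delta>_def)
  next
    fix f assume f: "f \<in> L2 (count_space U \<Otimes>\<^sub>M Q)"
    have ip_f: "ip (count_space U \<Otimes>\<^sub>M Q) f (\<lambda>t. of_bool (fst t = u) * e c (snd t)) = ip Q (\<lambda>t. f (u, t)) (e c)"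
      if "u \<in> U" "c \<in> C" for u c
      using ip_tensor_right[OF f \<delta>_L2[OF that(1)] e.w_L2[OF that(2)]] ip_delta[OF that(1)]
      by (simp add: \<delta>_def)
    interpret UC: pair_sigma_finite "count_space U" "count_space C"
      using sfU sigma_finite_measure_count_space_countable[OF e.countable_C] by (simp add: pair_sigma_finite_def)
    have "(\<integral>\<^sup>+uc. ennreal ((norm (ip (count_space U \<Otimes>\<^sub>M Q) f
        (case uc of (u, c) \<Rightarrow> \<lambda>t. of_bool (fst t = u) * e c (snd t))))\<^sup>2) \<partial>count_space (U \<times> C))
      = (\<integral>\<^sup>+uc. ennreal ((norm (ip Q (\<lambda>t. f (fst uc, t)) (e (snd uc))))\<^sup>2) \<partial>count_space (U \<times> C))"
      by (intro nn_integral_cong) (auto simp: ip_f)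
    also have "\<dots> = (\<integral>\<^sup>+uc. ennreal ((norm (ip Q (\<lambda>t. f (fst uc, t)) (e (snd uc))))\<^sup>2)
        \<partial>(count_space U \<Otimes>\<^sub>M count_space C))"
      by (simp add: pair_measure_countable U e.countable_C)
    also have "\<dots> = (\<integral>\<^sup>+c. \<integral>\<^sup>+u. ennreal ((norm (ip Q (\<lambda>t. f (u, t)) (e c)))\<^sup>2) \<partial>count_space U \<partial>count_space C)"
      by (subst UC.nn_integral_snd[symmetric])
         (simp_all add: pair_measure_countable U e.countable_C case_prod_beta)
    also have "\<dots> = ennreal ((l2norm (count_space U \<Otimes>\<^sub>M Q) f)\<^sup>2)"
      by (rule e.tensor_parseval[OF sfU f])
    finally show "(\<integral>\<^sup>+uc. ennreal ((norm (ip (count_space U \<Otimes>\<^sub>M Q) f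
        (case uc of (u, c) \<Rightarrow> \<lambda>t. of_bool (fst t = u) * e c (snd t))))\<^sup>2) \<partial>count_space (U \<times> C))
      = ennreal ((l2norm (count_space U \<Otimes>\<^sub>M Q) f)\<^sup>2)" .
  qed
qed

text \<open>For an injective map the embedded measure is the push-forward, so norms and inner
  products are unchanged. The functions w are prescribed on the image of the space of Q, which is
  the whole space of the new measure.\<close>

lemma orthonormal_basis_embed:
  assumes onb: "orthonormal_basis Q C e" and inj: "inj_on f (space Q)"
    and w: "\<And>c x. c \<in> C \<Longrightarrow> x \<in> space Q \<Longrightarrow> w c (f x) = e c x"
  shows "orthonormal_basis (embed_measure Q f) C w"
proof -
  interpret e: orthonormal_basis Q C e by fact
  note f_meas [measurable] = measurable_embed_measure2'[OF inj]
  have int: "integral\<^sup>L (embed_measure Q f) g = (\<integral>x. g (f x) \<partial>Q)"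
    if "g \<in> borel_measurable (embed_measure Q f)" for g :: "_ \<Rightarrow> 'd :: {banach, second_countable_topology}"
    by (subst embed_measure_eq_distr'[OF inj], rule integral_distr[OF f_meas that])
  have L2_comp: "(\<lambda>x. g (f x)) \<in> L2 Q" if "g \<in> L2 (embed_measure Q f)" for g
  proof -
    note [measurable] = L2_measurable[OF that]
    have "integrable (distr Q (embed_measure Q f) f) (\<lambda>x. (norm (g x))\<^sup>2)"
      using L2_integrable[OF that] embed_measure_eq_distr'[OF inj] by simp
    from integrable_distr[OF f_meas this] show ?thesis
      by (simp add: L2_def)
  qed
  have w_L2: "w c \<in> L2 (embed_measure Q f)" if c: "c \<in> C" for c
  proof -
    have "(\<lambda>x. w c (f x)) \<in> borel_measurable Q"
      using L2_measurable[OF e.w_L2[OF c]] w[OF c] by (simp cong: measurable_cong)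
    then have [measurable]: "w c \<in> borel_measurable (embed_measure Q f)"
      by (rule measurable_embed_measure1)
    have "(\<integral>\<^sup>+x. ennreal ((norm (w c x))\<^sup>2) \<partial>embed_measure Q f) = (\<integral>\<^sup>+x. ennreal ((norm (e c x))\<^sup>2) \<partial>Q)"
      by (subst nn_integral_embed_measure'[OF inj]) (auto simp: w c cong: nn_integral_cong)
    also have "\<dots> < \<infinity>" using ennreal_l2norm_sq[OF e.w_L2[OF c]] by (metis ennreal_less_top infinity_ennreal_def)
    finally show ?thesis by (intro L2I_nn_integral) simp_all
  qed
  have ip_w: "ip (embed_measure Q f) g (w c) = ip Q (\<lambda>x. g (f x)) (e c)"
    if "g \<in> borel_measurable (embed_measure Q f)" "c \<in> C" for g c
  proof -
    note [measurable] = that(1) L2_measurable[OF w_L2[OF that(2)]]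
    show ?thesis
      unfolding ip_def by (subst int) (auto intro!: Bochner_Integration.integral_cong simp: w that)
  qed
  show ?thesis
  proof
    obtain A where A: "countable A" "A \<subseteq> sets Q" "\<Union> A = space Q" "\<And>a. a \<in> A \<Longrightarrow> emeasure Q a \<noteq> \<infinity>"
      using sigma_finite_measure.sigma_finite_countable[OF e.sf] by blast
    show "\<exists>A. countable A \<and> A \<subseteq> sets (embed_measure Q f) \<and> \<Union> A = space (embed_measure Q f) \<and>
        (\<forall>a\<in>A. emeasure (embed_measure Q f) a \<noteq> \<infinity>)"
    proof (intro exI[of _ "(`) f ` A"] conjI ballI)
      show "(`) f ` A \<subseteq> sets (embed_measure Q f)"
        using A(2) in_sets_embed_measure by blast
      show "\<Union> ((`) f ` A) = space (embed_measure Q f)"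
        unfolding space_embed_measure A(3)[symmetric] by blast
      fix B assume "B \<in> (`) f ` A"
      then show "emeasure (embed_measure Q f) B \<noteq> \<infinity>"
        using A(2,4) emeasure_embed_measure_image'[OF inj] by auto
    qed (use A in simp)
    show "countable C" by (rule e.countable_C)
    show "w c \<in> L2 (embed_measure Q f)" if "c \<in> C" for c by (rule w_L2[OF that])
  next
    fix c c' assume c: "c \<in> C" "c' \<in> C"
    have "ip (embed_measure Q f) (w c) (w c') = ip Q (\<lambda>x. w c (f x)) (e c')"
      by (rule ip_w[OF L2_measurable[OF w_L2[OF c(1)]] c(2)])
    also have "\<dots> = ip Q (e c) (e c')" by (rule ip_cong) (simp_all add: w c)
    finally show "ip (embed_measure Q f) (w c) (w c') = (if c = c' then 1 else 0)"
      by (simp add: e.w_orth c)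
  next
    fix g assume g: "g \<in> L2 (embed_measure Q f)"
    note [measurable] = L2_measurable[OF g]
    have "(\<integral>\<^sup>+c. ennreal ((norm (ip (embed_measure Q f) g (w c)))\<^sup>2) \<partial>count_space C)
      = (\<integral>\<^sup>+c. ennreal ((norm (ip Q (\<lambda>x. g (f x)) (e c)))\<^sup>2) \<partial>count_space C)"
      by (intro nn_integral_cong) (simp add: ip_w L2_measurable[OF g])
    also have "\<dots> = ennreal ((l2norm Q (\<lambda>x. g (f x)))\<^sup>2)"
      by (rule e.w_parseval[OF L2_comp[OF g]])
    also have "(l2norm Q (\<lambda>x. g (f x)))\<^sup>2 = (l2norm (embed_measure Q f) g)\<^sup>2"
      unfolding l2norm_sq by (rule int[symmetric]) simp
    finally show "(\<integral>\<^sup>+c. ennreal ((norm (ip (embed_measure Q f) g (w c)))\<^sup>2) \<partial>count_space C)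
      = ennreal ((l2norm (embed_measure Q f) g)\<^sup>2)" .
  qed
qed

section \<open>The characters of the integral adeles\<close>

text \<open>An element is determined by its finite support among the primes and finitely many
  rational values there.\<close>

lemma countable_FrS:
  assumes S: "\<forall>p\<in>S. prime p"
  shows "countable (FrS S :: (nat \<Rightarrow> 'n::finite \<Rightarrow> real) set)"
proof (rule countable_subset)
  let ?ext = "\<lambda>(P :: nat set) (h :: nat \<times> 'n \<Rightarrow> real) p i. if p \<in> P then h (p, i) else 0"
  show "FrS S \<subseteq> (\<Union>P\<in>Collect finite. ?ext P ` (\<Pi>\<^sub>E pi\<in>P \<times> UNIV. \<rat>))"
  proof
    fix F :: "nat \<Rightarrow> 'n \<Rightarrow> real" assume F: "F \<in> FrS S"
    define P where "P = {p. \<exists>i. F p i \<noteq> 0}"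
    have "finite P"
      using F by (auto simp: FrS_def P_def)
    have "P \<subseteq> S"
      using F by (auto simp: FrS_def P_def)
    have rat: "F p i \<in> \<rat>" if "p \<in> P" for p i
    proof -
      have p: "p \<in> S" "0 < p" using that \<open>P \<subseteq> S\<close> S by (auto dest: prime_gt_0_nat)
      obtain N where "real p ^ N * F p i \<in> \<int>" using FrS_den[OF F p(1)] by blast
      then obtain m where "real p ^ N * F p i = of_int m" by (auto elim: Ints_cases)
      then have "F p i = of_int m / real p ^ N" using p by (simp add: field_simps)
      then show ?thesis by simp
    qed
    have "F = ?ext P (\<lambda>pi\<in>P \<times> UNIV. F (fst pi) (snd pi))"
      by (auto simp: fun_eq_iff P_def)
    moreover have "(\<lambda>pi\<in>P \<times> UNIV. F (fst pi) (snd pi)) \<in> (\<Pi>\<^sub>E pi\<in>P \<times> UNIV. \<rat>)"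
      using rat by auto
    ultimately show "F \<in> (\<Union>P\<in>Collect finite. ?ext P ` (\<Pi>\<^sub>E pi\<in>P \<times> UNIV. \<rat>))"
      using \<open>finite P\<close> by blast
  qed
  show "countable (\<Union>P\<in>Collect finite. ?ext P ` (\<Pi>\<^sub>E pi\<in>P \<times> UNIV. \<rat>))"
    by (intro countable_UN countable_image countable_PiE countable_Collect_finite)
       (auto simp: countable_rat)
qed

section \<open>Orthonormality of the characters under uniform digits\<close>

lemma sum_ez_zero:
  assumes "real n * \<beta> \<in> \<int>" "\<beta> \<notin> \<int>"
  shows "(\<Sum>x<n. ez (\<beta> * real x)) = 0"
proof -
  have "(ez \<beta> - 1) * (\<Sum>x<n. ez (\<beta> * real x)) = ez \<beta> ^ n - 1"
    unfolding ez_mult_nat by (rule power_diff_1_eq[symmetric])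
  also have "\<dots> = 0"
    using assms(1) by (simp flip: ez_mult_nat add: ez_Ints mult.commute)
  finally show ?thesis
    using assms(2) ez_eq_1_iff by simp
qed

text \<open>\<open>product_prob_space\<close> asks for a probability measure at every index, also
  outside \<open>digit_index\<close>, where for example first component 0 would leave no digits at
  all; a point mass at 0 is put there.\<close>

definition digit_prob :: "nat set \<Rightarrow> nat \<times> 'n \<times> nat \<Rightarrow> nat measure" where
  "digit_prob S a = uniform_count_measure (if a \<in> digit_index S then {0..<fst a} else {0})"

lemma digits_measure_eq: "digits_measure S = PiM (digit_index S) (digit_prob S)"
  unfolding digits_measure_def by (rule PiM_cong) (simp_all add: digit_prob_def)

lemma product_prob_space_digits:
  assumes S: "\<forall>p\<in>S. prime p"
  shows "product_prob_space (digit_prob S)"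
proof (rule product_prob_spaceI)
  fix a
  show "prob_space (digit_prob S a)"
    unfolding digit_prob_def using S
    by (intro prob_space_uniform_count_measure) (auto simp: digit_index_def dest: prime_gt_0_nat)
qed

lemma prob_space_digits:
  assumes S: "\<forall>p\<in>S. prime p"
  shows "prob_space (digits_measure S)"
proof -
  interpret product_prob_space "digit_prob S" "digit_index S"
    by (rule product_prob_space_digits[OF S])
  show ?thesis
    unfolding digits_measure_eq by unfold_locales
qed

lemma measurable_digit:
  assumes "a \<in> digit_index S"
  shows "(\<lambda>d. f (d a)) \<in> borel_measurable (digits_measure S)"
proof -
  have "(\<lambda>d. d a) \<in> measurable (digits_measure S) (uniform_count_measure {0..<fst a})"
    unfolding digits_measure_def using measurable_component_singleton[OF assms] .
  moreover have "f \<in> borel_measurable (uniform_count_measure {0..<fst a})"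
    by (simp cong: measurable_cong_sets)
  ultimately show ?thesis by (rule measurable_compose)
qed

text \<open>The integrand factors through the restriction to the digits in J, whose law is a finite
  product of uniform measures, so the average splits into one average per digit.\<close>

lemma integral_digits_prod:
  fixes f :: "nat \<times> 'n \<times> nat \<Rightarrow> nat \<Rightarrow> complex"
  assumes S: "\<forall>p\<in>S. prime p" and J: "finite J" "J \<subseteq> digit_index S"
  shows "(\<integral>d. (\<Prod>a\<in>J. f a (d a)) \<partial>digits_measure S) = (\<Prod>a\<in>J. (\<Sum>x<fst a. f a x) / of_nat (fst a))"
proof -
  interpret product_prob_space "digit_prob S" "digit_index S"
    by (rule product_prob_space_digits[OF S])
  have meas: "f a \<in> borel_measurable (digit_prob S a)" for a
    by (simp add: digit_prob_def cong: measurable_cong_sets)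
  have intg: "integrable (digit_prob S a) (f a)" for a
    unfolding digit_prob_def uniform_count_measure_def by (intro integrable_point_measure_finite) simp
  have fJ: "(\<lambda>x. \<Prod>a\<in>J. f a (x a)) \<in> borel_measurable (PiM J (digit_prob S))"
  proof (rule borel_measurable_prod)
    fix a assume "a \<in> J"
    then show "(\<lambda>x. f a (x a)) \<in> borel_measurable (PiM J (digit_prob S))"
      by (intro measurable_compose[where f = "\<lambda>x. x a" and g = "f a", OF _ meas] measurable_component_singleton)
  qed
  have "(\<integral>d. (\<Prod>a\<in>J. f a (d a)) \<partial>digits_measure S)
    = (\<integral>d. (\<Prod>a\<in>J. f a (restrict d J a)) \<partial>PiM (digit_index S) (digit_prob S))"
    unfolding digits_measure_eq by (intro Bochner_Integration.integral_cong prod.cong) simp_all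
  also have "\<dots> = (\<integral>x. (\<Prod>a\<in>J. f a (x a)) \<partial>distr (PiM (digit_index S) (digit_prob S))
      (PiM J (digit_prob S)) (\<lambda>x. restrict x J))"
    by (rule integral_distr[OF measurable_restrict_subset[OF J(2)] fJ, symmetric])
  also have "\<dots> = (\<integral>x. (\<Prod>a\<in>J. f a (x a)) \<partial>PiM J (digit_prob S))"
    by (simp only: distr_PiM_restrict_finite[OF J])
  also have "\<dots> = (\<Prod>a\<in>J. integral\<^sup>L (digit_prob S a) (f a))"
    by (rule product_integral_prod[OF J(1) intg])
  also have "\<dots> = (\<Prod>a\<in>J. (\<Sum>x<fst a. f a x) / of_nat (fst a))"
    using J(2)
    by (intro prod.cong refl)
       (auto simp: digit_prob_def uniform_count_measure_def lebesgue_integral_point_measure_finite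
          lessThan_atLeast0 scaleR_conv_of_real sum_divide_distrib)
  finally show ?thesis .
qed

lemma norm_dchar: "norm (dchar v d) = 1"
  by (simp add: dchar_def prod_norm[symmetric] case_prod_beta)

lemma measurable_dchar:
  assumes "v \<in> FrS S"
  shows "dchar v \<in> borel_measurable (digits_measure S)"
proof -
  have "(\<lambda>d. \<Prod>a\<in>char_index v. ez (v (fst a) (fst (snd a)) * real (fst a) ^ snd (snd a) * real (d a)))
     \<in> borel_measurable (digits_measure S)"
    using char_index_subset[OF assms] by (intro borel_measurable_prod measurable_digit) auto
  then show ?thesis
    by (simp add: dchar_def[abs_def] case_prod_beta)
qed

lemma dchar_L2:
  assumes S: "\<forall>p\<in>S. prime p" and v: "v \<in> FrS S"
  shows "dchar v \<in> L2 (digits_measure S)"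
proof -
  interpret prob_space "digits_measure S" by (rule prob_space_digits[OF S])
  show ?thesis
    using measurable_dchar[OF v] by (simp add: L2_def norm_dchar)
qed

text \<open>Take the exponent just below the least one that clears the denominator. At that digit a
  character is nontrivial while its p-th power is trivial, so its sum over the digit
  vanishes.\<close>

lemma minimal_nonint_power:
  assumes F: "real p ^ N * r \<in> \<int>" and nz: "r \<notin> \<int>"
  shows "\<exists>j. real p ^ j * r \<notin> \<int> \<and> real p * (real p ^ j * r) \<in> \<int>"
proof -
  define n where "n = (LEAST n. real p ^ n * r \<in> \<int>)"
  have n: "real p ^ n * r \<in> \<int>" unfolding n_def using F by (rule LeastI)
  then have "n \<noteq> 0" using nz by (intro notI) simp
  then obtain j where j: "n = Suc j" by (cases n) auto
  then have "real p ^ j * r \<notin> \<int>" unfolding n_def using not_less_Least[of j "\<lambda>n. real p ^ n * r \<in> \<int>"] by simp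
  then show ?thesis using n j by (auto simp: mult.assoc)
qed

text \<open>The integrand is a product over digits, hence so is the integral. If u and v differ at
  (p, i), the factor at the last position j where p^j (u p i - v p i) is not an integer is a full
  geometric sum of a nontrivial p-th root of unity.\<close>

lemma dchar_orthonormal:
  fixes u v :: "nat \<Rightarrow> 'n::finite \<Rightarrow> real"
  assumes S: "\<forall>p\<in>S. prime p" and u: "u \<in> FrS S" and v: "v \<in> FrS S"
  shows "ip (digits_measure S) (dchar u) (dchar v) = (if u = v then 1 else 0)"
proof -
  define J where "J = char_index u \<union> char_index v"
  have J: "finite J" "J \<subseteq> digit_index S"
    using finite_char_index[OF u] finite_char_index[OF v] char_index_subset[OF u] char_index_subset[OF v]
    by (auto simp: J_def)
  define \<beta> where "\<beta> = (\<lambda>(p, i, j). (u p i - v p i) * real p ^ j)"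
  have "dchar u d * cnj (dchar v d) = (\<Prod>a\<in>J. ez (\<beta> a * real (d a)))" for d
  proof -
    have "dchar u d * cnj (dchar v d) = (\<Prod>(p, i, j)\<in>J. ez (u p i * real p ^ j * real (d (p, i, j))) *
        cnj (ez (v p i * real p ^ j * real (d (p, i, j)))))"
      using dchar_eq_prod[OF J(1), of u d] dchar_eq_prod[OF J(1), of v d]
      by (simp add: J_def prod.distrib case_prod_beta)
    also have "\<dots> = (\<Prod>a\<in>J. ez (\<beta> a * real (d a)))"
      by (intro prod.cong refl) (auto simp: \<beta>_def cnj_ez ez_add[symmetric] algebra_simps)
    finally show ?thesis .
  qed
  then have "ip (digits_measure S) (dchar u) (dchar v) = (\<Prod>a\<in>J. (\<Sum>x<fst a. ez (\<beta> a * real x)) / of_nat (fst a))"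
    unfolding ip_def using integral_digits_prod[OF S J, of "\<lambda>a x. ez (\<beta> a * real x)"] by simp
  also have "\<dots> = (if u = v then 1 else 0)"
  proof (cases "u = v")
    case True
    have "(\<Sum>x<fst a. ez (\<beta> a * real x)) / of_nat (fst a) = 1" if "a \<in> J" for a
    proof -
      have "prime (fst a)" using that J(2) S by (auto simp: digit_index_def)
      then have "0 < fst a" by (rule prime_gt_0_nat)
      moreover have "\<beta> a = 0" by (simp add: \<beta>_def True case_prod_beta)
      ultimately show ?thesis by simp
    qed
    then have "(\<Prod>a\<in>J. (\<Sum>x<fst a. ez (\<beta> a * real x)) / of_nat (fst a)) = 1"
      by (rule prod.neutral[OF ballI])
    then show ?thesis using True by simp
  next
    case False
    then obtain p i where ne: "u p i \<noteq> v p i" by (meson ext)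
    have p: "p \<in> S"
    proof (rule ccontr)
      assume "p \<notin> S"
      then have "u p i = 0" "v p i = 0" using u v by (simp_all add: FrS_def)
      then show False using ne by simp
    qed
    have nint: "u p i - v p i \<notin> \<int>"
    proof
      assume "u p i - v p i \<in> \<int>"
      then obtain m :: int where m: "u p i - v p i = of_int m" by (auto elim: Ints_cases)
      then have "\<bar>real_of_int m\<bar> < 1" using FrS_bounds[OF u, of p i] FrS_bounds[OF v, of p i] by linarith
      then have "m = 0" by linarith
      then show False using m ne by simp
    qed
    obtain N where N: "real p ^ N * u p i \<in> \<int>" using FrS_den[OF u p] by blast
    obtain N' where N': "real p ^ N' * v p i \<in> \<int>" using FrS_den[OF v p] by blast
    have "real p ^ (N + N') * (u p i - v p i) = real p ^ N' * (real p ^ N * u p i) - real p ^ N * (real p ^ N' * v p i)"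
      by (simp add: power_add algebra_simps)
    also have "\<dots> \<in> \<int>" by (intro Ints_diff Ints_mult N N') simp_all
    finally obtain j where j: "real p ^ j * (u p i - v p i) \<notin> \<int>" "real p * (real p ^ j * (u p i - v p i)) \<in> \<int>"
      using minimal_nonint_power[OF _ nint] by blast
    have \<beta>: "\<beta> (p, i, j) = real p ^ j * (u p i - v p i)" by (simp add: \<beta>_def mult.commute)
    have "(p, i, j) \<in> J"
    proof (rule ccontr)
      assume "(p, i, j) \<notin> J"
      then have "real p ^ j * u p i - real p ^ j * v p i \<in> \<int>"
        by (intro Ints_diff) (auto simp: J_def char_index_def)
      then show False using j(1) by (simp add: right_diff_distrib)
    qed
    moreover have "(\<Sum>x<fst (p, i, j). ez (\<beta> (p, i, j) * real x)) / of_nat (fst (p, i, j)) = 0"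
      using sum_ez_zero[of p "\<beta> (p, i, j)"] j \<beta> by simp
    ultimately have "(\<Prod>a\<in>J. (\<Sum>x<fst a. ez (\<beta> a * real x)) / of_nat (fst a)) = 0"
      by (intro prod_zero[OF J(1)] bexI[of _ "(p, i, j)"])
    then show ?thesis using False by simp
  qed
  finally show ?thesis .
qed

section \<open>The algebra of trigonometric polynomials in the digits\<close>

inductive_set trig :: "nat set \<Rightarrow> ((nat \<times> 'n::finite \<times> nat \<Rightarrow> nat) \<Rightarrow> complex) set" for S where
  zero: "(\<lambda>_. 0) \<in> trig S"
| step: "q \<in> trig S \<Longrightarrow> v \<in> FrS S \<Longrightarrow> (\<lambda>d. q d + c * dchar v d) \<in> trig S"

lemma trig_dchar: "v \<in> FrS S \<Longrightarrow> dchar v \<in> trig S"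
  using trig.step[OF trig.zero, of v S 1] by simp

lemma trig_add:
  assumes "q \<in> trig S" "r \<in> trig S"
  shows "(\<lambda>d. q d + r d) \<in> trig S"
  using assms(2)
proof induction
  case (step r v c)
  then show ?case using trig.step[OF step(3) step(2), of c] by (simp add: add.assoc)
qed (use assms in simp)

lemma trig_cmult: "q \<in> trig S \<Longrightarrow> (\<lambda>d. c * q d) \<in> trig S"
proof (induction rule: trig.induct)
  case (step q v c')
  then show ?case using trig.step[OF step(3) step(2), of "c * c'"] by (simp add: algebra_simps)
qed (simp add: trig.zero)

lemma trig_sum: "(\<And>i. i \<in> I \<Longrightarrow> f i \<in> trig S) \<Longrightarrow> (\<lambda>d. \<Sum>i\<in>I. f i d) \<in> trig S"
  by (induction I rule: infinite_finite_induct) (auto intro: trig.zero trig_add)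

text \<open>Addition in Q_S^n/K on representatives, which indexes the product of two
  characters.\<close>

lemma FrS_add:
  assumes u: "u \<in> FrS S" and v: "v \<in> FrS S"
  shows "(\<lambda>p i. frac (u p i + v p i)) \<in> FrS S"
proof -
  have "\<exists>N. real p ^ N * frac (u p i + v p i) \<in> \<int>" if p: "p \<in> S" for p i
  proof -
    obtain N where N: "real p ^ N * u p i \<in> \<int>" using FrS_den[OF u p] by blast
    obtain N' where N': "real p ^ N' * v p i \<in> \<int>" using FrS_den[OF v p] by blast
    have "real p ^ (N + N') * frac (u p i + v p i) = real p ^ N' * (real p ^ N * u p i)
       + real p ^ N * (real p ^ N' * v p i) - real p ^ (N + N') * of_int \<lfloor>u p i + v p i\<rfloor>"
      by (simp add: frac_def power_add algebra_simps)
    also have "\<dots> \<in> \<int>" by (intro Ints_diff Ints_add Ints_mult N N') simp_all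
    finally show ?thesis by blast
  qed
  moreover have "finite {p. \<exists>i. frac (u p i + v p i) \<noteq> 0}"
  proof (rule finite_subset)
    show "{p. \<exists>i. frac (u p i + v p i) \<noteq> 0} \<subseteq> {p. \<exists>i. u p i \<noteq> 0} \<union> {p. \<exists>i. v p i \<noteq> 0}"
      by auto (metis Ints_0 add_0)
  qed (use u v in \<open>simp add: FrS_def\<close>)
  ultimately show ?thesis
    using u v by (auto simp: FrS_def frac_lt_1)
qed

text \<open>The integer discarded by \<open>frac\<close> is multiplied by an integral power of p and
  an integral digit, so it changes no exponential.\<close>

lemma dchar_mult:
  fixes u v :: "nat \<Rightarrow> 'n::finite \<Rightarrow> real"
  assumes u: "u \<in> FrS S" and v: "v \<in> FrS S"
  shows "dchar u d * dchar v d = dchar (\<lambda>p i. frac (u p i + v p i)) d"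
proof -
  define w where "w = (\<lambda>p i. frac (u p i + v p i))"
  have w: "w \<in> FrS S" unfolding w_def by (rule FrS_add[OF u v])
  define J where "J = char_index u \<union> char_index v \<union> char_index w"
  have J: "finite J" "char_index u \<subseteq> J" "char_index v \<subseteq> J" "char_index w \<subseteq> J"
    using finite_char_index[OF u] finite_char_index[OF v] finite_char_index[OF w] by (auto simp: J_def)
  have "ez (u p i * real p ^ j * real x) * ez (v p i * real p ^ j * real x) = ez (w p i * real p ^ j * real x)"
    for p i j x
  proof -
    have "u p i * real p ^ j * real x + v p i * real p ^ j * real x - w p i * real p ^ j * real x
       = of_int \<lfloor>u p i + v p i\<rfloor> * real p ^ j * real x"
      by (simp add: w_def frac_def algebra_simps)
    also have "\<dots> \<in> \<int>" by (intro Ints_mult) simp_all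
    finally show ?thesis unfolding ez_add[symmetric] by (rule ez_cong)
  qed
  then show ?thesis
    unfolding w_def[symmetric] dchar_eq_prod[OF J(1,2)] dchar_eq_prod[OF J(1,3)] dchar_eq_prod[OF J(1,4)]
    by (simp add: prod.distrib[symmetric] case_prod_beta)
qed

lemma trig_mult:
  assumes "q \<in> trig S" "r \<in> trig S"
  shows "(\<lambda>d. q d * r d) \<in> trig S"
proof -
  have dchar: "(\<lambda>d. q d * dchar v d) \<in> trig S" if "q \<in> trig S" and v: "v \<in> FrS S" for q v
    using that(1)
  proof induction
    case (step q u c)
    then have "(\<lambda>d. q d * dchar v d + c * dchar (\<lambda>p i. frac (u p i + v p i)) d) \<in> trig S"
      by (intro trig.step FrS_add v)
    then show ?case
      by (simp add: dchar_mult[OF step(2) v, symmetric] algebra_simps)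
  qed (simp add: trig.zero)
  show ?thesis
    using assms(2)
  proof induction
    case (step r v c)
    have "(\<lambda>d. q d * r d + c * (q d * dchar v d)) \<in> trig S"
      using step by (intro trig_add trig_cmult dchar assms(1))
    then show ?case by (simp add: algebra_simps)
  qed (simp add: trig.zero)
qed

lemma FrS_zero: "(\<lambda>p i. 0) \<in> FrS S"
  by (simp add: FrS_def)

lemma dchar_zero: "dchar (\<lambda>p i. 0) = (\<lambda>_. 1)"
  by (simp add: dchar_def char_index_def fun_eq_iff)

lemma trig_imp_sum:
  assumes "q \<in> trig S"
  shows "\<exists>V a. finite V \<and> V \<subseteq> FrS S \<and> q = (\<lambda>d. \<Sum>v\<in>V. a v * dchar v d)"
  using assms
proof induction
  case zero
  show ?case by (intro exI[of _ "{}"]) simp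
next
  case (step q v c)
  then obtain V a where V: "finite V" "V \<subseteq> FrS S" and q: "q = (\<lambda>d. \<Sum>v\<in>V. a v * dchar v d)"
    by blast
  \<comment> \<open>The class v may already belong to V; then its old coefficient and c are
    added.\<close>
  define b where "b u = (if u \<in> V then a u else 0) + (if u = v then c else 0)" for u
  have "(\<Sum>u\<in>insert v V. b u * dchar u d) = q d + c * dchar v d" for d
  proof -
    have "(\<Sum>u\<in>insert v V. b u * dchar u d) = (\<Sum>u\<in>insert v V. (if u \<in> V then a u else 0) * dchar u d)
       + (\<Sum>u\<in>insert v V. (if u = v then c else 0) * dchar u d)"
      by (simp only: b_def distrib_right sum.distrib)
    also have "(\<Sum>u\<in>insert v V. (if u \<in> V then a u else 0) * dchar u d) = q d"
      unfolding q using V(1) by (intro sum.mono_neutral_cong_right) auto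
    also have "(\<Sum>u\<in>insert v V. (if u = v then c else 0) * dchar u d) = (\<Sum>u\<in>{v}. c * dchar u d)"
      using V(1) by (intro sum.mono_neutral_cong_right) auto
    finally show ?thesis by simp
  qed
  then show ?case
    using V step(2) by (intro exI[of _ "insert v V"] exI[of _ b]) auto
qed

text \<open>Fourier inversion on \<open>\<int>/p\<^sup>N\<close>.\<close>

lemma trig_digit_function:
  fixes i :: "'n::finite" and h :: "nat \<Rightarrow> complex"
  assumes S: "\<forall>p\<in>S. prime p" and p: "p \<in> S"
  shows "\<exists>q\<in>trig S. \<forall>d\<in>digit_space S. q d = h (\<Sum>l<N. d (p, i, l) * p ^ l)"
proof -
  define n where "n = p ^ N"
  have n: "0 < n" using S p by (simp add: n_def prime_gt_0_nat)
  \<comment> \<open>The class k/p^N at the single place (p, i). Its character is the k-th character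
    of Z/p^N, evaluated at the integer formed by the first N digits.\<close>
  define vv :: "nat \<Rightarrow> nat \<Rightarrow> 'n \<Rightarrow> real" where "vv k = (\<lambda>p' i'. if p' = p \<and> i' = i then real k / real n else 0)" for k
  have vv: "vv k \<in> FrS S" if "k < n" for k
  proof -
    have "finite {p'. \<exists>i'. vv k p' i' \<noteq> 0}"
      by (rule finite_subset[of _ "{p}"]) (auto simp: vv_def)
    moreover have "real p ^ N * (real k / real n) \<in> \<int>" using n by (simp add: n_def)
    then have "\<exists>N. real p' ^ N * vv k p' i' \<in> \<int>" for p' i'
      by (cases "p' = p \<and> i' = i") (auto simp: vv_def)
    ultimately show ?thesis
      using that p by (auto simp: FrS_def vv_def)
  qed
  have dchar_vv: "dchar (vv k) d = ez (real k / real n * real (\<Sum>l<N. d (p, i, l) * p ^ l))" for k d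
  proof -
    have "real p ^ l * (real k / real n) \<in> \<int>" if "N \<le> l" for l
    proof -
      have "real p ^ l = real p ^ (l - N) * real n" using that by (simp add: n_def flip: power_add)
      then show ?thesis using n by simp
    qed
    then have "char_index (vv k) \<subseteq> (\<lambda>l. (p, i, l)) ` {..<N}"
      by (force simp: char_index_def vv_def not_le[symmetric] split: if_splits)
    then have "dchar (vv k) d = (\<Prod>(p', i', l)\<in>(\<lambda>l. (p, i, l)) ` {..<N}. ez (vv k p' i' * real p' ^ l * real (d (p', i', l))))"
      by (intro dchar_eq_prod) simp_all
    also have "\<dots> = (\<Prod>l<N. ez (real k / real n * real p ^ l * real (d (p, i, l))))"
      by (subst prod.reindex) (auto simp: inj_on_def vv_def)
    also have "\<dots> = ez (real k / real n * real (\<Sum>l<N. d (p, i, l) * p ^ l))"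
      by (simp add: ez_sum[symmetric] sum_distrib_left mult_ac)
    finally show ?thesis .
  qed
  have inv: "(\<Sum>k<n. ez (- (real k / real n * real y)) * ez (real k / real n * real x)) / of_nat n = of_bool (x = y)"
    if "x < n" "y < n" for x y
  proof -
    define \<beta> where "\<beta> = (real x - real y) / real n"
    have "(\<Sum>k<n. ez (- (real k / real n * real y)) * ez (real k / real n * real x)) = (\<Sum>k<n. ez (\<beta> * real k))"
      by (intro sum.cong refl) (simp add: ez_add[symmetric] \<beta>_def diff_divide_distrib algebra_simps)
    also have "\<dots> / of_nat n = of_bool (x = y)"
    proof (cases "x = y")
      case True
      then show ?thesis using n by (simp add: \<beta>_def)
    next
      case False
      have "\<beta> \<notin> \<int>"
      proof
        assume "\<beta> \<in> \<int>"
        then obtain m :: int where m: "\<beta> = of_int m" by (auto elim: Ints_cases)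
        have "\<bar>\<beta>\<bar> < 1" using that by (auto simp: \<beta>_def abs_less_iff field_simps)
        then have "m = 0" using m by linarith
        then show False using m False n by (simp add: \<beta>_def)
      qed
      moreover have "real n * \<beta> = of_int (int x - int y)" using n by (simp add: \<beta>_def)
      ultimately have "(\<Sum>k<n. ez (\<beta> * real k)) = 0" by (intro sum_ez_zero) simp_all
      then show ?thesis using False by simp
    qed
    finally show ?thesis .
  qed
  \<comment> \<open>The inner sum divided by n is the delta function at y on Z/n, so the outer sum
    picks out the value of h at the residue of d.\<close>
  define q where "q d = (\<Sum>y<n. h y / of_nat n * (\<Sum>k<n. ez (- (real k / real n * real y)) * dchar (vv k) d))" for d
  have "q \<in> trig S"
    unfolding q_def[abs_def] by (intro trig_sum trig_cmult trig_dchar vv) simp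
  moreover have "q d = h (\<Sum>l<N. d (p, i, l) * p ^ l)" if d: "d \<in> digit_space S" for d
  proof -
    define x where "x = (\<Sum>l<N. d (p, i, l) * p ^ l)"
    have x: "x < n"
      unfolding x_def n_def by (rule digit_sum_less) (rule digit_less[OF d p])
    have "q d = (\<Sum>y<n. h y * ((\<Sum>k<n. ez (- (real k / real n * real y)) * ez (real k / real n * real x)) / of_nat n))"
      unfolding q_def dchar_vv x_def[symmetric] by simp
    also have "\<dots> = (\<Sum>y<n. h y * of_bool (x = y))"
      by (intro sum.cong refl) (simp only: inv[OF x] lessThan_iff)
    also have "\<dots> = h x"
      using x by (simp add: of_bool_def if_distrib[of "(*) _"] cong: if_cong)
    finally show ?thesis unfolding x_def .
  qed
  ultimately show ?thesis by blast
qed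

text \<open>Digit j is the integer formed by the first j+1 digits, divided by p^j and rounded down;
  a condition on it is therefore a function on Z/p^(j+1).\<close>

lemma trig_cylinder:
  assumes S: "\<forall>p\<in>S. prime p" and a: "a \<in> digit_index S"
  shows "\<exists>q\<in>trig S. \<forall>d\<in>digit_space S. q d = indicator {d\<in>digit_space S. d a \<in> B} d"
proof -
  obtain p i j where pij: "a = (p, i, j)" "p \<in> S" using a by (auto simp: digit_index_def)
  have digit: "(\<Sum>l<Suc j. d (p, i, l) * p ^ l) div p ^ j = d (p, i, j)" if d: "d \<in> digit_space S" for d
  proof -
    have "(\<Sum>l<j. d (p, i, l) * p ^ l) < p ^ j"
      by (rule digit_sum_less) (rule digit_less[OF d pij(2)])
    moreover have "p ^ j \<noteq> 0" using S pij by (auto dest: prime_gt_0_nat)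
    ultimately show ?thesis by simp
  qed
  obtain q where "q \<in> trig S" and
    q: "\<And>d. d \<in> digit_space S \<Longrightarrow> q d = of_bool ((\<Sum>l<Suc j. d (p, i, l) * p ^ l) div p ^ j \<in> B)"
    using trig_digit_function[OF S pij(2), where h = "\<lambda>x. of_bool (x div p ^ j \<in> B)" and N = "Suc j" and i = i]
    by blast
  moreover have "\<forall>d\<in>digit_space S. q d = indicator {d\<in>digit_space S. d a \<in> B} d"
    using q digit pij by (auto simp: indicator_def)
  ultimately show ?thesis by blast
qed

text \<open>One-digit cylinders generate the sigma-algebra and have trigonometric polynomials as
  indicators, so the characters have dense span and Parseval follows.\<close>

lemma orthonormal_basis_dchar:
  assumes S: "\<forall>p\<in>S. prime p"
  shows "orthonormal_basis (digits_measure S) (FrS S) (dchar :: (nat \<Rightarrow> 'n::finite \<Rightarrow> real) \<Rightarrow> _)"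
proof -
  let ?D = "digits_measure S :: (nat \<times> 'n \<times> nat \<Rightarrow> nat) measure"
  interpret prob_space ?D by (rule prob_space_digits[OF S])
  have trig_L2: "q \<in> L2 ?D" if "q \<in> trig S" for q
    using that
  proof induction
    case (step q v c)
    show ?case by (intro L2_add L2_cmult dchar_L2[OF S] step)
  qed (rule L2_zero)
  interpret l2_algebra ?D "trig S"
  proof
    show "(\<lambda>_. 1) \<in> (trig S :: ((nat \<times> 'n \<times> nat \<Rightarrow> nat) \<Rightarrow> complex) set)"
      using trig_dchar[OF FrS_zero[of S]] by (simp add: dchar_zero)
  qed (auto intro: trig_L2 trig_add trig_cmult trig_mult)
  define G where "G = {{d \<in> digit_space S. d a \<in> A} | (a :: nat \<times> 'n \<times> nat) A. a \<in> digit_index S \<and> A \<in> sets (digit_prob S a)}"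
  have sp: "(\<Pi>\<^sub>E a\<in>digit_index S. space (digit_prob S a)) = (digit_space S :: (nat \<times> 'n \<times> nat \<Rightarrow> nat) set)"
    unfolding digit_space_def by (rule PiE_cong) (simp add: digit_prob_def space_uniform_count_measure)
  have gen: "sets ?D = sigma_sets (space ?D) G"
    unfolding digits_measure_eq sets_PiM_single space_PiM sp G_def ..
  have G_Pow: "G \<subseteq> Pow (space ?D)"
    by (auto simp: G_def space_digits_measure)
  have ind: "\<exists>q\<in>trig S. \<forall>x\<in>space ?D. q x = indicator A x" if "A \<in> G" for A
    using that trig_cylinder[OF S] unfolding G_def space_digits_measure by blast
  show ?thesis
  proof
    show "countable (FrS S :: (nat \<Rightarrow> 'n \<Rightarrow> real) set)" by (rule countable_FrS[OF S])
    show "dchar c \<in> L2 ?D" if "c \<in> FrS S" for c by (rule dchar_L2[OF S that])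
    show "ip ?D (dchar c) (dchar c') = (if c = c' then 1 else 0)" if "c \<in> FrS S" "c' \<in> FrS S" for c c'
      by (rule dchar_orthonormal[OF S that])
  next
    fix f assume f: "f \<in> L2 ?D"
    show "(\<integral>\<^sup>+c. ennreal ((norm (ip ?D f (dchar c)))\<^sup>2) \<partial>count_space (FrS S)) = ennreal ((l2norm ?D f)\<^sup>2)"
    proof (rule parseval_of_dense[OF f])
      fix \<epsilon> :: real assume "0 < \<epsilon>"
      moreover have "f \<in> l2_closure ?D (trig S)"
        by (rule L2_eq_closure[OF gen G_Pow ind f])
      ultimately obtain q where "q \<in> trig S" "(l2norm ?D (\<lambda>x. f x - q x))\<^sup>2 < \<epsilon>"
        unfolding l2_closure_def by blast
      with trig_imp_sum[OF this(1)]
      show "\<exists>V a. finite V \<and> V \<subseteq> FrS S \<and> (l2norm ?D (\<lambda>x. f x - (\<Sum>v\<in>V. a v * dchar v x)))\<^sup>2 < \<epsilon>"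
        by auto
    qed (auto intro: dchar_L2[OF S] simp: dchar_orthonormal[OF S])
  qed
qed

section \<open>The diagonal embedding of the lattice\<close>

text \<open>The localisation Z_(p) inside the reals: it expresses that a rational number is a p-adic
  integer. For prime p, coprimality also excludes b = 0.\<close>

definition Zloc :: "nat \<Rightarrow> real set" where
  "Zloc p = {of_int a / of_int b | a b. coprime b (int p)}"

lemma Zloc_I: "coprime b (int p) \<Longrightarrow> x = of_int a / of_int b \<Longrightarrow> x \<in> Zloc p"
  by (auto simp: Zloc_def)

lemma Zloc_Ints: "x \<in> \<int> \<Longrightarrow> x \<in> Zloc p"
  by (auto elim!: Ints_cases intro!: Zloc_I[of 1])

lemma Zloc_add:
  assumes p: "prime p" and x: "x \<in> Zloc p" and y: "y \<in> Zloc p"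
  shows "x + y \<in> Zloc p"
proof -
  obtain a b where ab: "coprime b (int p)" "x = of_int a / of_int b" using x by (auto simp: Zloc_def)
  obtain c d where cd: "coprime d (int p)" "y = of_int c / of_int d" using y by (auto simp: Zloc_def)
  have "b \<noteq> 0" "d \<noteq> 0" using ab cd p by (auto dest: prime_gt_1_nat)
  then have eq: "x + y = of_int (a * d + c * b) / of_int (b * d)"
    using ab cd by (simp add: field_simps)
  show ?thesis
    by (rule Zloc_I[OF _ eq]) (use ab cd in simp)
qed

lemma Zloc_minus: "x \<in> Zloc p \<Longrightarrow> - x \<in> Zloc p"
  by (auto simp: Zloc_def) (metis minus_divide_left of_int_minus)

lemma Zloc_diff: "prime p \<Longrightarrow> x \<in> Zloc p \<Longrightarrow> y \<in> Zloc p \<Longrightarrow> x - y \<in> Zloc p"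
  using Zloc_add[of p x "- y"] Zloc_minus[of y p] by simp

lemma Zloc_sum: "prime p \<Longrightarrow> (\<And>i. i \<in> I \<Longrightarrow> f i \<in> Zloc p) \<Longrightarrow> sum f I \<in> Zloc p"
  by (induction I rule: infinite_finite_induct) (auto intro: Zloc_add Zloc_Ints)

lemma Zloc_mult_power:
  assumes "x \<in> Zloc p"
  shows "real p ^ k * x \<in> Zloc p"
proof -
  obtain a b where ab: "coprime b (int p)" "x = of_int a / of_int b" using assms by (auto simp: Zloc_def)
  then show ?thesis by (intro Zloc_I[of b p _ "int p ^ k * a"]) simp_all
qed

text \<open>A power of p cannot cancel a denominator prime to p, so Z_(p) and Z[1/p] meet in
  Z.\<close>

lemma Zloc_den_Ints:
  assumes p: "prime p" and x: "x \<in> Zloc p" and N: "real p ^ N * x \<in> \<int>"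
  shows "x \<in> \<int>"
proof -
  obtain a b where ab: "coprime b (int p)" "x = of_int a / of_int b" using x by (auto simp: Zloc_def)
  obtain m where m: "real p ^ N * x = of_int m" using N by (auto elim: Ints_cases)
  have b: "b \<noteq> 0" using ab p by (auto dest: prime_gt_1_nat)
  have "real_of_int (int p ^ N * a) = real_of_int (m * b)"
    using m ab(2) b by (simp add: field_simps)
  then have "int p ^ N * a = m * b" by (simp only: of_int_eq_iff)
  then have "int p ^ N dvd m * b" by (metis dvd_triv_left)
  then have "int p ^ N dvd m"
    using ab(1) by (simp add: coprime_commute coprime_dvd_mult_left_iff)
  then obtain c where c: "m = int p ^ N * c" by blast
  have "real p ^ N * x = real p ^ N * of_int c" using m c by simp
  then have "x = of_int c" using p by (simp add: prime_gt_0_nat)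
  then show ?thesis by simp
qed

text \<open>The condition inside \<open>qp_of\<close>, with the congruence modulo p^k expressed as
  membership in Z_(p) after division by p^k.\<close>

definition is_residue :: "nat \<Rightarrow> real \<Rightarrow> nat \<Rightarrow> real \<Rightarrow> bool" where
  "is_residue p q k c \<longleftrightarrow> 0 \<le> c \<and> c < real p ^ k \<and> (\<exists>N. real p ^ N * c \<in> \<int>) \<and> (q - c) / real p ^ k \<in> Zloc p"

lemma qp_of_eq_The:
  assumes "prime p"
  shows "qp_of p q k = (THE c. is_residue p q k c)"
proof -
  have p: "0 < real p ^ k" using assms by (simp add: prime_gt_0_nat)
  have "(\<exists>a b::int. coprime b (int p) \<and> q - c = real p ^ k * (of_int a / of_int b)) \<longleftrightarrow> (q - c) / real p ^ k \<in> Zloc p" for c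
    using p by (auto simp: Zloc_def divide_eq_eq mult.commute)
  then show ?thesis
    by (simp add: qp_of_def is_residue_def)
qed

text \<open>The difference of two residues, divided by p^k, lies both in Z_(p) and in Z[1/p], hence
  in Z, and its absolute value is below 1.\<close>

lemma is_residue_unique:
  assumes p: "prime p" and c: "is_residue p q k c" and d: "is_residue p q k d"
  shows "c = d"
proof -
  have pos: "0 < real p ^ k" using p by (simp add: prime_gt_0_nat)
  obtain N where N: "real p ^ N * c \<in> \<int>" using c by (auto simp: is_residue_def)
  obtain N' where N': "real p ^ N' * d \<in> \<int>" using d by (auto simp: is_residue_def)
  define x where "x = (c - d) / real p ^ k"
  have "x = (q - d) / real p ^ k - (q - c) / real p ^ k"
    by (simp add: x_def diff_divide_distrib)
  then have "x \<in> Zloc p"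
    using c d p by (simp add: is_residue_def Zloc_diff)
  moreover have cd: "real p ^ k * x = c - d"
    using pos by (simp add: x_def)
  have "real p ^ (N + N' + k) * x = real p ^ N' * (real p ^ N * c) - real p ^ N * (real p ^ N' * d)"
    unfolding power_add mult.assoc cd by (simp add: algebra_simps)
  then have "real p ^ (N + N' + k) * x \<in> \<int>"
    by (simp only:) (intro Ints_diff Ints_mult N N'; simp)
  ultimately have "x \<in> \<int>" using Zloc_den_Ints p by blast
  then obtain m where m: "x = of_int m" by (auto elim: Ints_cases)
  have "\<bar>c - d\<bar> < real p ^ k" using c d by (auto simp: is_residue_def)
  then have "\<bar>x\<bar> < 1" using pos by (simp add: x_def abs_divide)
  then have "m = 0" using m by linarith
  then show ?thesis using m cd by simp
qed

lemma qp_of_eqI: "prime p \<Longrightarrow> is_residue p q k c \<Longrightarrow> qp_of p q k = c"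
  by (simp add: qp_of_eq_The) (blast intro: is_residue_unique)

text \<open>Write m = m' p^e with m' prime to p. The residue is b/p^e, where b is a times an inverse
  of m' modulo p^(k+e); the exponent is k+e because division by p^e uses up e powers of p.\<close>

lemma is_residue_exists:
  assumes p: "prime p" and m: "0 < (m :: nat)"
  shows "\<exists>c. is_residue p (of_int a / of_nat m) k c"
proof -
  obtain e m' where m': "\<not> p dvd m'" "m = m' * p ^ e"
    using prime_power_canonical[OF p m] by blast
  have pos: "0 < p" using p by (rule prime_gt_0_nat)
  have m'0: "0 < m'" using m m' by (cases m') auto
  define P where "P = int p ^ (k + e)"
  have P: "0 < P" using pos by (simp add: P_def)
  have cop: "coprime (int m') (int p)"
    using prime_imp_coprime[OF p m'(1)] by (simp add: coprime_commute)
  then have "coprime (int m') P" by (simp add: P_def)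
  then obtain u v where uv: "u * int m' + v * P = 1"
    using bezout_int[of "int m'" P] by auto
  define b where "b = (a * u) mod P"
  have b: "0 \<le> b" "b < P" using P by (simp_all add: b_def)
  have "a - b * int m' = a * (u * int m' + v * P) - b * int m'" using uv by simp
  also have "\<dots> = (a * u - b) * int m' + a * v * P" by (simp add: algebra_simps)
  also have "a * u - b = P * (a * u div P)" by (simp add: b_def minus_mod_eq_mult_div)
  finally obtain w where w: "a - b * int m' = P * w" by (metis distrib_left mult.assoc mult.commute)
  have "is_residue p (of_int a / of_nat m) k (of_int b / real p ^ e)"
    unfolding is_residue_def
  proof (intro conjI exI[of _ e])
    show "0 \<le> real_of_int b / real p ^ e" using b by simp
    have "real_of_int b < real_of_int P" using b by (simp only: of_int_less_iff)
    then show "real_of_int b / real p ^ e < real p ^ k"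
      using pos by (simp add: P_def power_add field_simps)
    show "real p ^ e * (real_of_int b / real p ^ e) \<in> \<int>" using pos by simp
    define D where "D = of_int a / of_nat m - of_int b / real p ^ e"
    have "D * real m' * real p ^ e = of_int (a - b * int m')"
      using m'0 pos m' by (simp add: D_def field_simps)
    also have "\<dots> = real p ^ k * of_int w * real p ^ e"
      unfolding w by (simp add: P_def power_add)
    finally have "D * real m' = real p ^ k * of_int w"
      using pos by simp
    then have "D / real p ^ k = of_int w / of_int (int m')"
      using m'0 pos by (simp add: field_simps)
    then show "(of_int a / of_nat m - of_int b / real p ^ e) / real p ^ k \<in> Zloc p"
      unfolding D_def by (rule Zloc_I[OF cop])
  qed
  then show ?thesis by blast
qed

lemma is_residue_qp_of:
  assumes "prime p" "q \<in> ZS S"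
  shows "is_residue p q k (qp_of p q k)"
proof -
  obtain a m where "q = of_int a / of_nat m" "0 < m" using assms(2) by (auto simp: ZS_def)
  then obtain c where "is_residue p q k c" using is_residue_exists[OF assms(1)] by blast
  then show ?thesis using qp_of_eqI[OF assms(1)] by metis
qed

text \<open>Two levels differ, after division by the smaller power of p, by an element of Z_(p) and
  of Z[1/p], that is, by an integer. A denominator for level 0 therefore serves all levels.\<close>

lemma is_Qp_qp_of:
  assumes p: "prime p" and q: "q \<in> ZS S"
  shows "is_Qp p (qp_of p q)"
  unfolding is_Qp_def
proof (intro conjI allI)
  note res = is_residue_qp_of[OF assms]
  have pos: "0 < real p" using p by (simp add: prime_gt_0_nat)
  show b: "0 \<le> qp_of p q k" "qp_of p q k < real p ^ k" for k
    using res[of k] by (auto simp: is_residue_def)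
  have step: "\<exists>w. qp_of p q K = qp_of p q k + real p ^ k * of_int w" if "k \<le> K" for k K
  proof -
    define x where "x = (qp_of p q K - qp_of p q k) / real p ^ k"
    have eq: "(q - qp_of p q K) / real p ^ k = real p ^ (K - k) * ((q - qp_of p q K) / real p ^ K)"
      using that pos by (simp add: field_simps flip: power_add)
    have "(q - qp_of p q K) / real p ^ k \<in> Zloc p"
      unfolding eq by (rule Zloc_mult_power) (use res[of K] in \<open>simp add: is_residue_def\<close>)
    moreover have "x = (q - qp_of p q k) / real p ^ k - (q - qp_of p q K) / real p ^ k"
      by (simp add: x_def diff_divide_distrib)
    ultimately have "x \<in> Zloc p"
      using res[of k] p by (simp add: is_residue_def Zloc_diff)
    moreover obtain N where N: "real p ^ N * qp_of p q K \<in> \<int>" using res[of K] by (auto simp: is_residue_def)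
    obtain N' where N': "real p ^ N' * qp_of p q k \<in> \<int>" using res[of k] by (auto simp: is_residue_def)
    have cd: "real p ^ k * x = qp_of p q K - qp_of p q k"
      using pos by (simp add: x_def)
    have "real p ^ (N + N' + k) * x = real p ^ N' * (real p ^ N * qp_of p q K) - real p ^ N * (real p ^ N' * qp_of p q k)"
      unfolding power_add mult.assoc cd by (simp add: algebra_simps)
    then have "real p ^ (N + N' + k) * x \<in> \<int>"
      by (simp only:) (intro Ints_diff Ints_mult N N'; simp)
    ultimately have "x \<in> \<int>" using Zloc_den_Ints[OF p] by blast
    then obtain w where "x = of_int w" by (auto elim: Ints_cases)
    then have "qp_of p q K = qp_of p q k + real p ^ k * of_int w"
      using pos by (simp add: x_def field_simps)
    then show ?thesis by blast
  qed
  obtain N where N: "real p ^ N * qp_of p q 0 \<in> \<int>" using res[of 0] by (auto simp: is_residue_def)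
  have "real p ^ N * qp_of p q k \<in> \<int>" for k
  proof -
    obtain w where "qp_of p q k = qp_of p q 0 + real p ^ 0 * of_int w" using step[of 0 k] by blast
    then have "real p ^ N * qp_of p q k = real p ^ N * qp_of p q 0 + real p ^ N * of_int w"
      by (simp add: algebra_simps)
    also have "\<dots> \<in> \<int>" by (intro Ints_add N Ints_mult) simp_all
    finally show ?thesis .
  qed
  then show "\<exists>N. \<forall>k. real p ^ N * qp_of p q k \<in> \<int>" by blast
  show "pmod p k (qp_of p q (Suc k)) = qp_of p q k" for k
  proof -
    obtain w where "qp_of p q (Suc k) = qp_of p q k + real p ^ k * of_int w" using step[of k "Suc k"] by auto
    then show ?thesis by (intro pmod_eqI b)
  qed
qed

lemma qp_of_0_diff: "prime p \<Longrightarrow> q \<in> ZS S \<Longrightarrow> q - qp_of p q 0 \<in> Zloc p"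
  using is_residue_qp_of[of p q S 0] by (simp add: is_residue_def)

section \<open>The ring Z[1/p : p in S] and its classes modulo K\<close>

lemma ZS_add:
  assumes "x \<in> ZS S" "y \<in> ZS S"
  shows "x + y \<in> ZS S"
proof -
  obtain a m where am: "x = of_int a / of_nat m" "0 < m" "\<forall>p. prime p \<and> p dvd m \<longrightarrow> p \<in> S"
    using assms(1) by (auto simp: ZS_def)
  obtain b l where bl: "y = of_int b / of_nat l" "0 < l" "\<forall>p. prime p \<and> p dvd l \<longrightarrow> p \<in> S"
    using assms(2) by (auto simp: ZS_def)
  have "x + y = of_int (a * int l + b * int m) / of_nat (m * l)"
    using am bl by (simp add: field_simps)
  moreover have "\<forall>p. prime p \<and> p dvd m * l \<longrightarrow> p \<in> S"
    using am bl by (auto simp: prime_dvd_mult_iff)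
  ultimately show ?thesis
    using am bl unfolding ZS_def mem_Collect_eq by (intro exI[of _ "a * int l + b * int m"] exI[of _ "m * l"]) simp
qed

lemma ZS_Ints: "x \<in> \<int> \<Longrightarrow> x \<in> ZS S"
  unfolding ZS_def by (elim Ints_cases) (auto intro!: exI[of _ "1::nat"])

lemma ZS_minus: "x \<in> ZS S \<Longrightarrow> - x \<in> ZS S"
  unfolding ZS_def
proof (elim CollectE exE conjE, intro CollectI)
  fix a m assume "x = of_int a / real m" "0 < m" "\<forall>p. prime p \<and> p dvd m \<longrightarrow> p \<in> S"
  then show "\<exists>a m. - x = of_int a / real m \<and> 0 < m \<and> (\<forall>p. prime p \<and> p dvd m \<longrightarrow> p \<in> S)"
    by (intro exI[of _ "- a"] exI[of _ m]) simp
qed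

lemma ZS_diff: "x \<in> ZS S \<Longrightarrow> y \<in> ZS S \<Longrightarrow> x - y \<in> ZS S"
  using ZS_add[of x S "- y"] ZS_minus[of y S] by simp

lemma ZS_sum: "(\<And>i. i \<in> I \<Longrightarrow> f i \<in> ZS S) \<Longrightarrow> sum f I \<in> ZS S"
  by (induction I rule: infinite_finite_induct) (auto intro: ZS_add ZS_Ints)

text \<open>A prime dividing the reduced denominator would lie in S, and integrality at that prime
  forbids it. Coordinatewise this says that Gamma^n meets K in Z^n.\<close>

lemma ZS_Zloc_Ints:
  assumes q: "q \<in> ZS S" and loc: "\<And>p. p \<in> S \<Longrightarrow> prime p \<Longrightarrow> q \<in> Zloc p"
  shows "q \<in> \<int>"
proof -
  obtain a m where am: "q = of_int a / of_nat m" "0 < m" "\<And>p. prime p \<Longrightarrow> p dvd m \<Longrightarrow> p \<in> S"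
    using q by (auto simp: ZS_def)
  have "gcd a (int m) \<noteq> 0" using am by simp
  then obtain a' b' where ab: "a = a' * gcd a (int m)" "int m = b' * gcd a (int m)" "coprime a' b'"
    using gcd_coprime_exists by blast
  have g: "0 < gcd a (int m)" using am by simp
  have b'0: "0 < b'" using ab(2) am(2) g by (metis of_nat_0_less_iff zero_less_mult_pos2)
  have q': "q = of_int a' / of_int b'"
  proof -
    have "q = of_int a / of_int (int m)" using am by simp
    also have "\<dots> = of_int (a' * gcd a (int m)) / of_int (b' * gcd a (int m))"
      using ab by metis
    also have "\<dots> = of_int a' / of_int b'" using g by simp
    finally show ?thesis .
  qed
  have "nat b' = 1"
  proof (rule ccontr)
    assume "nat b' \<noteq> 1"
    then obtain p where p: "prime p" "p dvd nat b'" using prime_factor_nat by blast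
    have pb: "int p dvd b'" using p(2) b'0 by (simp add: int_dvd_int_iff[symmetric])
    then have "int p dvd int m" using ab(2) by (metis dvd_mult2)
    then have "q \<in> Zloc p" using loc am(3)[OF p(1)] p(1) by (simp add: int_dvd_int_iff)
    then obtain \<alpha> \<beta> where \<alpha>: "coprime \<beta> (int p)" "q = of_int \<alpha> / of_int \<beta>" by (auto simp: Zloc_def)
    have "\<beta> \<noteq> 0" using \<alpha> p by (auto dest: prime_gt_1_nat)
    then have "real_of_int (a' * \<beta>) = real_of_int (\<alpha> * b')"
      using q' \<alpha>(2) b'0 by (simp add: field_simps)
    then have "a' * \<beta> = \<alpha> * b'" by (simp only: of_int_eq_iff)
    then have "int p dvd a' * \<beta>" using pb by simp
    then have "int p dvd a'" using \<alpha>(1) by (simp add: coprime_commute coprime_dvd_mult_left_iff)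
    then have "is_unit (int p)" using pb ab(3) coprime_common_divisor by blast
    then show False using p(1) by (auto dest: prime_gt_1_nat)
  qed
  then have "b' = 1" using b'0 by simp
  then show ?thesis using q' by simp
qed

text \<open>The restricted product condition holds because a prime not dividing the denominator of a
  coordinate gives it fractional part 0.\<close>

lemma embS_in_QSn:
  fixes k :: "real^'n"
  assumes S: "\<forall>p\<in>S. prime p" and k: "\<And>i. k $ i \<in> ZS S"
  shows "embS S k \<in> QSn S"
proof -
  have "finite {p\<in>S. qp_of p q 0 \<noteq> 0}" if "q \<in> ZS S" for q
  proof -
    obtain a m where am: "q = of_int a / of_nat m" "0 < m" using \<open>q \<in> ZS S\<close> by (auto simp: ZS_def)
    have "p dvd m" if "p \<in> S" "qp_of p q 0 \<noteq> 0" for p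
    proof (rule ccontr)
      assume "\<not> p dvd m"
      then have "coprime (int m) (int p)"
        using prime_imp_coprime[of p m] S that(1) by (simp add: coprime_commute)
      then have "q \<in> Zloc p" using am by (intro Zloc_I[of "int m"]) simp_all
      then have "is_residue p q 0 0" by (simp add: is_residue_def)
      then show False using qp_of_eqI S that by blast
    qed
    then have "{p\<in>S. qp_of p q 0 \<noteq> 0} \<subseteq> {d. d dvd m}"
      by blast
    then show ?thesis
      using finite_divisors_nat[OF am(2)] by (rule finite_subset)
  qed
  then have "finite (\<Union>i. {p\<in>S. qp_of p (k $ i) 0 \<noteq> 0})"
    using k by simp
  then have "finite {p\<in>S. \<exists>i. embS S k p i 0 \<noteq> 0}"
    by (rule rev_finite_subset) (auto simp: embS_def)
  then show ?thesis
    using S is_Qp_qp_of[OF _ k] by (auto simp: QSn_def embS_def)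
qed

text \<open>Equal fractional parts make each coordinate difference integral at every p in S, so
  \<open>ZS_Zloc_Ints\<close> applies. Thus Gamma^n/Z^n injects into Q_S^n/K.\<close>

lemma frp_embS_eq_iff:
  fixes k l :: "real^'n"
  assumes S: "\<forall>p\<in>S. prime p" and k: "\<And>i. k $ i \<in> ZS S" and l: "\<And>i. l $ i \<in> ZS S"
  shows "frp (embS S k) = frp (embS S l) \<longleftrightarrow> (\<forall>i. (k - l) $ i \<in> \<int>)"
proof
  assume eq: "frp (embS S k) = frp (embS S l)"
  show "\<forall>i. (k - l) $ i \<in> \<int>"
  proof
    fix i
    have "k $ i - l $ i \<in> \<int>"
    proof (rule ZS_Zloc_Ints)
      show "k $ i - l $ i \<in> ZS S" by (intro ZS_diff k l)
      fix p assume p: "p \<in> S" "prime p"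
      have "qp_of p (k $ i) 0 = qp_of p (l $ i) 0"
        using fun_cong[OF fun_cong[OF eq], of p i] p by (simp add: frp_def embS_def)
      then have "k $ i - l $ i = (k $ i - qp_of p (k $ i) 0) - (l $ i - qp_of p (l $ i) 0)"
        by simp
      then show "k $ i - l $ i \<in> Zloc p"
        using qp_of_0_diff[OF p(2) k, of i] qp_of_0_diff[OF p(2) l, of i] Zloc_diff[OF p(2)] by metis
    qed
    then show "(k - l) $ i \<in> \<int>" by simp
  qed
next
  assume int: "\<forall>i. (k - l) $ i \<in> \<int>"
  have "qp_of p (k $ i) 0 = qp_of p (l $ i) 0" if "p \<in> S" for p i
  proof (rule qp_of_eqI)
    show p: "prime p" using S that by blast
    have "k $ i - qp_of p (l $ i) 0 = (l $ i - qp_of p (l $ i) 0) + (k - l) $ i" by simp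
    also have "\<dots> \<in> Zloc p"
      by (rule Zloc_add[OF p qp_of_0_diff[OF p l] Zloc_Ints[OF int[rule_format]]])
    finally show "is_residue p (k $ i) 0 (qp_of p (l $ i) 0)"
      using is_residue_qp_of[OF p l[of i], of 0] by (simp add: is_residue_def)
  qed
  then show "frp (embS S k) = frp (embS S l)"
    by (auto simp: frp_def embS_def fun_eq_iff)
qed

text \<open>Partial fractions: the lift is the sum over p of the prescribed p-parts. At a given p
  every other summand has denominator prime to p and disappears modulo Z_p.\<close>

lemma frp_embS_surj:
  fixes F :: "nat \<Rightarrow> 'n::finite \<Rightarrow> real"
  assumes S: "\<forall>p\<in>S. prime p" and F: "F \<in> FrS S"
  shows "\<exists>k :: real^'n. (\<forall>i. k $ i \<in> ZS S) \<and> frp (embS S k) = F"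
proof -
  define P where "P = {p. \<exists>i. F p i \<noteq> 0}"
  have P: "finite P" "P \<subseteq> S" using F by (auto simp: FrS_def P_def)
  define k :: "real^'n" where "k = (\<chi> i. \<Sum>p\<in>P. F p i)"
  have form: "\<exists>m N. F p i = of_int m / real p ^ N" if p: "p \<in> S" for p i
  proof -
    obtain N where "real p ^ N * F p i \<in> \<int>" using FrS_den[OF F p] by blast
    then obtain m where "real p ^ N * F p i = of_int m" by (auto elim: Ints_cases)
    then have "F p i = of_int m / real p ^ N" using p S by (auto simp: field_simps dest: prime_gt_0_nat)
    then show ?thesis by blast
  qed
  have "F p i \<in> ZS S" if p: "p \<in> S" for p i
  proof -
    obtain m N where mN: "F p i = of_int m / real p ^ N" using form[OF p] by blast
    have "0 < p ^ N" using S p by (simp add: prime_gt_0_nat)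
    moreover have "\<forall>p'. prime p' \<and> p' dvd p ^ N \<longrightarrow> p' \<in> S"
      using S p by (metis prime_dvd_power primes_dvd_imp_eq)
    ultimately show ?thesis
      using mN unfolding ZS_def mem_Collect_eq by (intro exI[of _ m] exI[of _ "p ^ N"]) simp
  qed
  then have kZS: "k $ i \<in> ZS S" for i
    using P by (auto simp: k_def intro!: ZS_sum)
  have "qp_of p (k $ i) 0 = F p i" if p: "p \<in> S" for p i
  proof (rule qp_of_eqI)
    show pr: "prime p" using S p by blast
    \<comment> \<open>The prime p need not belong to P; if it does not, the inserted summand is
      0.\<close>
    have "k $ i = (\<Sum>p'\<in>insert p P. F p' i)"
      unfolding k_def using P(1) by (cases "p \<in> P") (auto simp: P_def insert_absorb)
    also have "\<dots> = F p i + (\<Sum>p'\<in>P - {p}. F p' i)"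
      using P(1) by (simp add: sum.insert_remove)
    finally have "k $ i - F p i = (\<Sum>p'\<in>P - {p}. F p' i)" by simp
    also have "\<dots> \<in> Zloc p"
    proof (rule Zloc_sum[OF pr])
      fix p' assume p': "p' \<in> P - {p}"
      then have "p' \<in> S" using P by auto
      then obtain m N where mN: "F p' i = of_int m / real p' ^ N" using form by blast
      have "coprime p' p" using p' \<open>p' \<in> S\<close> S pr by (intro primes_coprime) auto
      then have "coprime (int p' ^ N) (int p)" by simp
      then show "F p' i \<in> Zloc p" using mN by (intro Zloc_I[of "int p' ^ N" p _ m]) simp_all
    qed
    finally show "is_residue p (k $ i) 0 (F p i)"
      using FrS_bounds[OF F] FrS_den[OF F p] by (simp add: is_residue_def)
  qed
  moreover have "F p i = 0" if "p \<notin> S" for p i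
    using that F by (simp add: FrS_def)
  ultimately have "frp (embS S k) = F"
    by (auto simp: frp_def embS_def fun_eq_iff)
  then show ?thesis using kZS by blast
qed

section \<open>Time-frequency shifts\<close>

lemma borel_measurable_cis [measurable]: "cis \<in> borel_measurable borel"
  by (intro borel_measurable_continuous_onI continuous_on_cis continuous_on_id)

lemma lborel_integral_shift:
  fixes f :: "'a::euclidean_space \<Rightarrow> 'b::{banach, second_countable_topology}"
  assumes [measurable]: "f \<in> borel_measurable borel"
  shows "(\<integral>x. f (x - a) \<partial>lborel) = (\<integral>x. f x \<partial>lborel)"
proof -
  have "(\<integral>x. f x \<partial>lborel) = (\<integral>x. f x \<partial>distr lborel borel ((+) (- a)))"
    by (simp only: lborel_distr_plus)
  also have "\<dots> = (\<integral>x. f (x - a) \<partial>lborel)"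
    by (subst integral_distr) simp_all
  finally show ?thesis ..
qed

lemma lborel_integrable_shift:
  fixes f :: "'a::euclidean_space \<Rightarrow> 'b::{banach, second_countable_topology}"
  assumes "integrable lborel f"
  shows "integrable lborel (\<lambda>x. f (x - a))"
proof -
  have "integrable (distr lborel borel ((+) (- a))) f"
    using assms by (simp only: lborel_distr_plus)
  from integrable_distr[OF _ this] show ?thesis by simp
qed

text \<open>The inverse of the unitary operator \<open>tfsR z\<close>, hence its adjoint; it brings
  slice coefficients back from the twisted copies.\<close>

definition tfsR_inv :: "(real^'n) \<times> (real^'n) \<Rightarrow> (real^'n \<Rightarrow> complex) \<Rightarrow> real^'n \<Rightarrow> complex" where
  "tfsR_inv z f = (\<lambda>t. cis (- (2 * pi * (snd z \<bullet> (t + fst z)))) * f (t + fst z))"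

lemma tfsR_L2:
  assumes "f \<in> L2 lborel"
  shows "tfsR z f \<in> L2 lborel"
proof -
  have [measurable]: "f \<in> borel_measurable borel" using L2_measurable[OF assms] by simp
  show ?thesis
    using lborel_integrable_shift[OF L2_integrable[OF assms], of "fst z"]
    by (simp add: L2_def tfsR_def norm_mult)
qed

lemma tfsR_inv_L2:
  assumes "f \<in> L2 lborel"
  shows "tfsR_inv z f \<in> L2 lborel"
proof -
  have [measurable]: "f \<in> borel_measurable borel" using L2_measurable[OF assms] by simp
  show ?thesis
    using lborel_integrable_shift[OF L2_integrable[OF assms], of "- fst z"]
    by (simp add: L2_def tfsR_inv_def norm_mult)
qed

lemma l2norm_tfsR_inv:
  assumes "f \<in> L2 lborel"
  shows "l2norm lborel (tfsR_inv z f) = l2norm lborel f"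
proof -
  have [measurable]: "f \<in> borel_measurable borel" using L2_measurable[OF assms] by simp
  show ?thesis
    using lborel_integral_shift[of "\<lambda>t. (norm (f t))\<^sup>2" "- fst z"]
    by (simp add: l2norm_def tfsR_inv_def norm_mult)
qed

lemma ip_tfsR_tfsR:
  assumes "f \<in> L2 lborel" "f' \<in> L2 lborel"
  shows "ip lborel (tfsR z f) (tfsR z f') = ip lborel f f'"
proof -
  have [measurable]: "f \<in> borel_measurable borel" "f' \<in> borel_measurable borel"
    using assms[THEN L2_measurable] by simp_all
  have "cis r * x * cnj (cis r * y) = x * cnj y" for r x y
  proof -
    have "cis r * x * cnj (cis r * y) = (cis r * cnj (cis r)) * (x * cnj y)" by (simp add: mult_ac)
    then show ?thesis by (simp add: cis_cnj cis_mult)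
  qed
  then show ?thesis
    using lborel_integral_shift[of "\<lambda>t. f t * cnj (f' t)" "fst z"]
    by (simp only: ip_def tfsR_def) measurable
qed

lemma ip_tfsR_right:
  assumes "f \<in> L2 lborel" "f' \<in> L2 lborel"
  shows "ip lborel f (tfsR z f') = ip lborel (tfsR_inv z f) f'"
proof -
  have "tfsR z (tfsR_inv z f) = f"
    by (simp add: tfsR_def tfsR_inv_def fun_eq_iff cis_mult mult.assoc[symmetric])
  then show ?thesis
    using ip_tfsR_tfsR[OF tfsR_inv_L2[OF assms(1)] assms(2), of z z] by simp
qed

text \<open>The scalar arises from moving the modulation by \<open>snd z'\<close> past the
  translation by \<open>fst z\<close>. It depends neither on g nor on t, so it can be absorbed in a
  phase common to both windows.\<close>

lemma tfsR_add:
  "tfsR (z + z') g t = cis (2 * pi * (snd z' \<bullet> fst z)) * tfsR z (tfsR z' g) t"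
proof -
  have "2 * pi * ((snd z + snd z') \<bullet> t) = 2 * pi * (snd z' \<bullet> fst z) + (2 * pi * (snd z \<bullet> t) + 2 * pi * (snd z' \<bullet> (t - fst z)))"
    by (simp add: algebra_simps inner_diff_right)
  then show ?thesis
    by (simp add: tfsR_def cis_mult[symmetric] mult.assoc diff_diff_eq)
qed

lemma measurable_ip_tfsR:
  fixes g :: "real^'n \<Rightarrow> complex"
  assumes "g \<in> L2 lborel"
  shows "(\<lambda>z. ip lborel g (tfsR z g)) \<in> borel_measurable (lborel \<Otimes>\<^sub>M lborel)"
proof -
  have [measurable]: "g \<in> borel_measurable borel" using L2_measurable[OF assms] by simp
  show ?thesis
    unfolding ip_def tfsR_def
    by (rule lborel.borel_measurable_lebesgue_integral) measurable
qed

section \<open>The finite adeles\<close>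

text \<open>The vector indexed by (u, v) is the indicator of the coset u + K times the character v
  of K at the K-component; for (0, 0) it is the indicator of K. Coordinates are read off by
  inverting \<open>from_digits\<close>, so values matter only on the space of the Haar
  measure.\<close>

definition wQ :: "nat set \<Rightarrow> (nat \<Rightarrow> 'n::finite \<Rightarrow> real) \<times> (nat \<Rightarrow> 'n \<Rightarrow> real) \<Rightarrow> (nat \<Rightarrow> 'n \<Rightarrow> nat \<Rightarrow> real) \<Rightarrow> complex" where
  "wQ S uv t = (case the_inv_into (FrS S \<times> digit_space S) (from_digits S) t of
     (F, d) \<Rightarrow> of_bool (F = fst uv) * dchar (snd uv) d)"

lemma wQ_from_digits:
  assumes "\<forall>p\<in>S. prime p" "F \<in> FrS S" "d \<in> digit_space S"
  shows "wQ S uv (from_digits S (F, d)) = of_bool (F = fst uv) * dchar (snd uv) d"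
  using the_inv_into_f_f[OF inj_on_from_digits[OF assms(1)], of "(F, d)"] assms by (simp add: wQ_def)

lemma space_QS_measure: "space (QS_measure S) = from_digits S ` (FrS S \<times> digit_space S)"
  by (simp add: QS_measure_def space_embed_measure space_pair_measure space_digits_measure)

lemma space_AQ: "space (AQ S) = UNIV \<times> space (QS_measure S)"
  by (simp add: AQ_def space_pair_measure)

lemma space_QS_measure_subset: "\<forall>p\<in>S. prime p \<Longrightarrow> x \<in> space (QS_measure S) \<Longrightarrow> x \<in> QSn S"
  by (auto simp: space_QS_measure from_digits_in_QSn)

lemma orthonormal_basis_wQ:
  assumes S: "\<forall>p\<in>S. prime p"
  shows "orthonormal_basis (QS_measure S :: (nat \<Rightarrow> 'n::finite \<Rightarrow> nat \<Rightarrow> real) measure) (FrS S \<times> FrS S) (wQ S)"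
  unfolding QS_measure_def
proof (rule orthonormal_basis_embed)
  show "orthonormal_basis (count_space (FrS S) \<Otimes>\<^sub>M digits_measure S) (FrS S \<times> FrS S)
     (\<lambda>(u :: nat \<Rightarrow> 'n \<Rightarrow> real, v) t. of_bool (fst t = u) * dchar (v :: nat \<Rightarrow> 'n \<Rightarrow> real) (snd t))"
    by (rule orthonormal_basis_count_space[OF orthonormal_basis_dchar[OF S] countable_FrS[OF S]])
  show "inj_on (from_digits S) (space (count_space (FrS S) \<Otimes>\<^sub>M (digits_measure S :: (nat \<times> 'n \<times> nat \<Rightarrow> nat) measure)))"
    using inj_on_from_digits[OF S] by (simp add: space_pair_measure space_digits_measure)
  fix c :: "(nat \<Rightarrow> 'n \<Rightarrow> real) \<times> (nat \<Rightarrow> 'n \<Rightarrow> real)"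
    and x :: "(nat \<Rightarrow> 'n \<Rightarrow> real) \<times> (nat \<times> 'n \<times> nat \<Rightarrow> nat)"
  assume "x \<in> space (count_space (FrS S) \<Otimes>\<^sub>M digits_measure S)"
  then show "wQ S c (from_digits S x) = (case c of (u, v) \<Rightarrow> \<lambda>t. of_bool (fst t = u) * dchar v (snd t)) x"
    using wQ_from_digits[OF S, of "fst x" "snd x" c]
    by (auto simp: space_pair_measure space_digits_measure case_prod_beta)
qed

text \<open>Translating the indicator of K by x selects the coset with fractional part
  \<open>frp x\<close>, and on that coset the character y is a phase times a character of K. The
  phase involves the finite parts x and y, but neither g nor t.\<close>

lemma tfsA_tensor1K:
  fixes g :: "real^'n \<Rightarrow> complex"
  assumes S: "\<forall>p\<in>S. prime p" and x: "x \<in> QSn S" and y: "y \<in> QSn S" and t: "t \<in> space (AQ S)"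
  shows "tfsA S ((a, x), (b, y)) (tensor1K S g) t =
    chif_phase S y (frp x) * (tfsR (a, b) g (fst t) * wQ S (frp x, frp y) (snd t))"
proof -
  obtain F d where Fd: "F \<in> FrS S" "d \<in> digit_space S" "snd t = from_digits S (F, d)"
    using t by (auto simp: space_AQ space_QS_measure)
  have "indicator (KS S) (QS_sub (snd t) x) = (of_bool (F = frp x) :: complex)"
    using QS_sub_in_KS_iff[OF S from_digits_in_QSn[OF S Fd(1,2)] x] frp_from_digits[OF Fd(1,2)] Fd(3)
    by (simp add: indicator_def)
  then show ?thesis
    using chif_from_digits[OF S y Fd(1,2)] wQ_from_digits[OF S Fd(1,2), of "(frp x, frp y)"] Fd(3)
    by (auto simp: tfsA_def tensor1K_def chi_inner_eq tfsR_def)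
qed

lemma tensor1K_eq:
  assumes S: "\<forall>p\<in>S. prime p" and t: "t \<in> space (AQ S)"
  shows "tensor1K S g t = g (fst t) * wQ S (\<lambda>p i. 0, \<lambda>p i. 0) (snd t)"
proof -
  obtain F d where Fd: "F \<in> FrS S" "d \<in> digit_space S" "snd t = from_digits S (F, d)"
    using t by (auto simp: space_AQ space_QS_measure)
  have "from_digits S (F, d) p i 0 = F p i" for p i
    using frp_from_digits[OF Fd(1,2)] by (metis frp_def)
  then have "from_digits S (F, d) \<in> KS S \<longleftrightarrow> F = (\<lambda>p i. 0)"
    using from_digits_in_QSn[OF S Fd(1,2)] by (simp add: KS_def fun_eq_iff)
  then have "(indicator (KS S) (from_digits S (F, d)) :: complex) = of_bool (F = (\<lambda>p i. 0))"
    by (simp add: indicator_def)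
  then show ?thesis
    unfolding tensor1K_def Fd(3) wQ_from_digits[OF S Fd(1,2)] by (simp add: dchar_zero)
qed

section \<open>Integrability over the adelic time-frequency plane\<close>

lemma nn_integral_pair_indicator:
  assumes Q: "sigma_finite_measure Q" and f: "f \<in> borel_measurable M"
    and K: "K \<in> sets Q" "emeasure Q K = 1"
  shows "(\<integral>\<^sup>+v. f (fst v) * indicator K (snd v) \<partial>(M \<Otimes>\<^sub>M Q)) = (\<integral>\<^sup>+x. f x \<partial>M)"
proof -
  interpret sigma_finite_measure Q by fact
  note [measurable] = f K(1)
  have "(\<integral>\<^sup>+v. f (fst v) * indicator K (snd v) \<partial>(M \<Otimes>\<^sub>M Q)) = (\<integral>\<^sup>+x. \<integral>\<^sup>+y. f x * indicator K y \<partial>Q \<partial>M)"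
    using nn_integral_fst[of "\<lambda>v. f (fst v) * indicator K (snd v)" M] by simp
  then show ?thesis
    using K by (simp add: nn_integral_cmult)
qed

text \<open>Since K has measure 1, both finite variables integrate out with weight 1, and the adelic
  integral equals the real one.\<close>

lemma tensor1K_S0:
  fixes g :: "real^'n \<Rightarrow> complex"
  assumes S: "\<forall>p\<in>S. prime p" and g: "g \<in> S0 lborel (lborel \<Otimes>\<^sub>M lborel) tfsR"
  shows "tensor1K S g \<in> S0 (AQ S) (AQ S \<Otimes>\<^sub>M AQ S) (tfsA S)"
proof -
  let ?Q = "QS_measure S :: (nat \<Rightarrow> 'n \<Rightarrow> nat \<Rightarrow> real) measure"
  let ?zero = "(\<lambda>p i. 0) :: nat \<Rightarrow> 'n \<Rightarrow> real"
  interpret w: orthonormal_basis ?Q "FrS S \<times> FrS S" "wQ S"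
    by (rule orthonormal_basis_wQ[OF S])
  interpret pair_sigma_finite lborel ?Q
    using w.sf sigma_finite_lborel by (simp add: pair_sigma_finite_def)
  have gL2: "g \<in> L2 lborel" and g_fin: "(\<integral>\<^sup>+z. ennreal (norm (ip lborel g (tfsR z g))) \<partial>(lborel \<Otimes>\<^sub>M lborel)) < \<infinity>"
    using g by (simp_all add: S0_def)
  have zero: "(?zero, ?zero) \<in> FrS S \<times> FrS S" by (simp add: FrS_zero)
  have "tensor1K S g \<in> L2 (AQ S) \<longleftrightarrow> (\<lambda>t. g (fst t) * wQ S (?zero, ?zero) (snd t)) \<in> L2 (AQ S)"
    by (rule L2_cong) (rule tensor1K_eq[OF S])
  then have tL2: "tensor1K S g \<in> L2 (AQ S)"
    using L2_tensor[OF gL2 w.w_L2[OF zero]] by (simp add: AQ_def)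
  \<comment> \<open>The subgroup K in the form of an image under \<open>from_digits\<close>, from
    which measurability and mass 1 can be read off.\<close>
  define K where "K = from_digits S ` ({?zero} \<times> digit_space S)"
  have inj: "inj_on (from_digits S) (space (count_space (FrS S) \<Otimes>\<^sub>M (digits_measure S :: (nat \<times> 'n \<times> nat \<Rightarrow> nat) measure)))"
    using inj_on_from_digits[OF S] by (simp add: space_pair_measure space_digits_measure)
  interpret D: prob_space "digits_measure S :: (nat \<times> 'n \<times> nat \<Rightarrow> nat) measure"
    by (rule prob_space_digits[OF S])
  have box: "{?zero} \<times> digit_space S \<in> sets (count_space (FrS S) \<Otimes>\<^sub>M (digits_measure S :: (nat \<times> 'n \<times> nat \<Rightarrow> nat) measure))"
    unfolding space_digits_measure[symmetric] by (intro pair_measureI) (simp_all add: FrS_zero)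
  have K_sets: "K \<in> sets ?Q"
    unfolding K_def QS_measure_def by (rule in_sets_embed_measure[OF box])
  have K_1: "emeasure ?Q K = 1"
    unfolding K_def QS_measure_def emeasure_embed_measure_image'[OF inj box]
    unfolding space_digits_measure[symmetric]
    by (subst D.emeasure_pair_measure_Times) (simp_all add: FrS_zero D.emeasure_space_1)
  have in_K: "x \<in> K \<longleftrightarrow> frp x = ?zero" if "x \<in> space ?Q" for x
    using that frp_from_digits FrS_zero by (fastforce simp: K_def space_QS_measure)
  define H where "H z = ennreal (norm (ip lborel g (tfsR z g)))" for z
  have H_meas [measurable]: "H \<in> borel_measurable (lborel \<Otimes>\<^sub>M lborel)"
    using measurable_ip_tfsR[OF gL2] unfolding H_def by measurable
  have amb: "ennreal (norm (ip (AQ S) (tensor1K S g) (tfsA S z (tensor1K S g)))) =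
     H (fst (fst z), fst (snd z)) * indicator K (snd (fst z)) * indicator K (snd (snd z))"
    if z: "z \<in> space (AQ S \<Otimes>\<^sub>M AQ S)" for z
  proof -
    obtain a x b y where z_eq: "z = ((a, x), (b, y))" by (metis prod.collapse)
    then have xy: "x \<in> space ?Q" "y \<in> space ?Q" using z by (auto simp: space_pair_measure space_AQ)
    note xy' = xy[THEN space_QS_measure_subset[OF S]]
    have "ip (AQ S) (tensor1K S g) (tfsA S z (tensor1K S g)) = ip (AQ S) (\<lambda>t. g (fst t) * wQ S (?zero, ?zero) (snd t))
       (\<lambda>t. chif_phase S y (frp x) * (tfsR (a, b) g (fst t) * wQ S (frp x, frp y) (snd t)))"
      unfolding z_eq by (rule ip_cong) (simp_all add: tensor1K_eq[OF S] tfsA_tensor1K[OF S xy'])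
    also have "\<dots> = cnj (chif_phase S y (frp x)) *
       (ip ?Q (wQ S (?zero, ?zero)) (wQ S (frp x, frp y)) * ip lborel g (tfsR (a, b) g))"
      unfolding ip_cmult_right AQ_def using frp_in_FrS[OF xy'(1)] frp_in_FrS[OF xy'(2)] zero
      by (subst ip_tensor_tensor) (simp_all add: gL2 tfsR_L2 w.w_L2)
    finally have ip_eq: "norm (ip (AQ S) (tensor1K S g) (tfsA S z (tensor1K S g))) =
       norm (ip ?Q (wQ S (?zero, ?zero)) (wQ S (frp x, frp y))) * norm (ip lborel g (tfsR (a, b) g))"
      by (simp add: norm_mult norm_chif_phase)
    have "(frp x, frp y) \<in> FrS S \<times> FrS S"
      using frp_in_FrS[OF xy'(1)] frp_in_FrS[OF xy'(2)] by simp
    then have orth: "ip ?Q (wQ S (?zero, ?zero)) (wQ S (frp x, frp y)) = (if (?zero, ?zero) = (frp x, frp y) then 1 else 0)"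
      by (rule w.w_orth[OF zero])
    show ?thesis
    proof (cases "frp x = ?zero \<and> frp y = ?zero")
      case True
      then have "x \<in> K" "y \<in> K" using in_K xy by blast+
      then show ?thesis unfolding ip_eq orth using True by (simp add: z_eq H_def)
    next
      case False
      then have "x \<notin> K \<or> y \<notin> K" using in_K xy by blast
      moreover have "norm (ip ?Q (wQ S (?zero, ?zero)) (wQ S (frp x, frp y))) = 0"
        using False unfolding orth by auto
      ultimately show ?thesis unfolding ip_eq by (auto simp: z_eq)
    qed
  qed
  have AQ_sf: "sigma_finite_measure (AQ S :: 'n adele measure)"
    unfolding AQ_def by (rule sigma_finite_measure_axioms)
  interpret A: sigma_finite_measure "AQ S :: 'n adele measure" by (rule AQ_sf)
  have proj [measurable]: "fst \<in> measurable (AQ S :: 'n adele measure) lborel"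
    "snd \<in> measurable (AQ S :: 'n adele measure) ?Q"
    unfolding AQ_def by measurable
  note [measurable] = K_sets
  have "(\<integral>\<^sup>+z. ennreal (norm (ip (AQ S) (tensor1K S g) (tfsA S z (tensor1K S g)))) \<partial>(AQ S \<Otimes>\<^sub>M AQ S))
     = (\<integral>\<^sup>+z. H (fst (fst z), fst (snd z)) * indicator K (snd (fst z)) * indicator K (snd (snd z)) \<partial>(AQ S \<Otimes>\<^sub>M AQ S))"
    by (intro nn_integral_cong amb)
  also have "\<dots> = (\<integral>\<^sup>+u. \<integral>\<^sup>+v. H (fst u, fst v) * indicator K (snd u) * indicator K (snd v) \<partial>AQ S \<partial>AQ S)"
    by (subst A.nn_integral_fst[symmetric]) simp_all
  \<comment> \<open>Integrates out the finite part of the frequency variable; that of the position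
    variable follows once the remaining indicator is pulled out of the inner integral.\<close>
  also have "\<dots> = (\<integral>\<^sup>+u. \<integral>\<^sup>+b. H (fst u, b) * indicator K (snd u) \<partial>lborel \<partial>AQ S)"
    unfolding AQ_def
    by (intro nn_integral_cong nn_integral_pair_indicator[OF w.sf _ K_sets K_1]) measurable
  also have "\<dots> = (\<integral>\<^sup>+u. (\<integral>\<^sup>+b. H (fst u, b) \<partial>lborel) * indicator K (snd u) \<partial>AQ S)"
    by (intro nn_integral_cong nn_integral_multc) measurable
  also have "\<dots> = (\<integral>\<^sup>+a. \<integral>\<^sup>+b. H (a, b) \<partial>lborel \<partial>lborel)"
    unfolding AQ_def by (rule nn_integral_pair_indicator[OF w.sf _ K_sets K_1]) measurable
  also have "\<dots> = (\<integral>\<^sup>+z. H z \<partial>(lborel \<Otimes>\<^sub>M lborel))"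
    by (rule lborel.nn_integral_fst) measurable
  also have "\<dots> < \<infinity>"
    using g_fin by (simp add: H_def)
  finally show ?thesis
    using tL2 by (simp add: S0_def)
qed

section \<open>Transfer of Gabor frames\<close>

text \<open>A section of the map from Gamma^n to Q_S^n/K. Any choice works, as two lifts of a class
  differ by an integer vector.\<close>

definition lift_rep :: "nat set \<Rightarrow> (nat \<Rightarrow> 'n::finite \<Rightarrow> real) \<Rightarrow> real^'n" where
  "lift_rep S F = (SOME k. (\<forall>i. k $ i \<in> ZS S) \<and> frp (embS S k) = F)"

lemma lift_rep:
  assumes "\<forall>p\<in>S. prime p" "F \<in> FrS S"
  shows "lift_rep S F $ i \<in> ZS S" "frp (embS S (lift_rep S F)) = F"
  using someI_ex[OF frp_embS_surj[OF assms]] unfolding lift_rep_def by blast+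

lemma dual_frames_adelic:
  fixes g h :: "real^'n \<Rightarrow> complex"
    and Ainf :: "(real^'n) \<times> (real^'n) \<Rightarrow> (real^'n) \<times> (real^'n)"
  assumes S: "\<forall>p\<in>S. prime p" and g: "g \<in> L2 lborel" and h: "h \<in> L2 lborel"
    and lin: "linear Ainf" and bij: "bij Ainf"
  shows "dual_frames lborel (latR Ainf) (\<lambda>z. tfsR z g) (\<lambda>z. tfsR z h)
      \<longleftrightarrow> dual_frames (AQ S) (latA S Ainf) (\<lambda>z. tfsA S z (tensor1K S g)) (\<lambda>z. tfsA S z (tensor1K S h))"
proof -
  let ?Q = "QS_measure S :: (nat \<Rightarrow> 'n \<Rightarrow> nat \<Rightarrow> real) measure"
  let ?C = "FrS S \<times> FrS S :: ((nat \<Rightarrow> 'n \<Rightarrow> real) \<times> (nat \<Rightarrow> 'n \<Rightarrow> real)) set"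
  \<comment> \<open>The real time-frequency shift belonging to the chosen lift of the class c; it
    becomes the twist of the copy indexed by c.\<close>
  define \<alpha> where "\<alpha> c = Ainf (lift_rep S (fst c), lift_rep S (snd c))"
    for c :: "(nat \<Rightarrow> 'n \<Rightarrow> real) \<times> (nat \<Rightarrow> 'n \<Rightarrow> real)"
  define J where "J = (\<lambda>c f (t :: 'n adele). tfsR (\<alpha> c) f (fst t) * wQ S c (snd t))"
  interpret w: orthonormal_basis ?Q ?C "wQ S"
    by (rule orthonormal_basis_wQ[OF S])
  have decomp: "orthogonal_decomposition TYPE((real^'n) \<times> (real^'n)) lborel (AQ S) ?C J
    (\<lambda>c F. tfsR_inv (\<alpha> c) (\<lambda>x. ip ?Q (\<lambda>t. F (x, t)) (wQ S c)))"
    unfolding AQ_def J_def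
  proof (rule w.orthogonal_decomposition_tensor[OF sigma_finite_lborel])
    show "tfsR (\<alpha> c) (\<lambda>x. f x - f' x) x = tfsR (\<alpha> c) f x - tfsR (\<alpha> c) f' x" for c f f' x
      by (simp add: tfsR_def right_diff_distrib)
    show "tfsR (\<alpha> c) (\<lambda>x. \<Sum>i\<in>I. a i * f i x) x = (\<Sum>i\<in>I. a i * tfsR (\<alpha> c) (f i) x)"
      for c x and I :: "((real^'n) \<times> (real^'n)) set" and a f
      by (simp add: tfsR_def sum_distrib_left mult.left_commute)
  qed (rule tfsR_L2 tfsR_inv_L2 ip_tfsR_tfsR ip_tfsR_right l2norm_tfsR_inv; assumption)+
  define frc where "frc z = (frp (snd (fst z)), frp (snd (snd z)))" for z :: "'n adele \<times> 'n adele"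
  define zinf where "zinf z = (fst (fst z), fst (snd z))" for z :: "'n adele \<times> 'n adele"
  \<comment> \<open>Splits a lattice point into its class and the real displacement from the chosen
    lift of that class.\<close>
  define \<theta> where "\<theta> z = (frc z, zinf z - \<alpha> (frc z))" for z
  \<comment> \<open>The coset phase of the finite character times the commutation scalar that arises
    from writing the real component as lift plus displacement. Neither factor involves the window,
    so g and h share it.\<close>
  define u where "u z = chif_phase S (snd (snd z)) (fst (frc z)) *
      cis (2 * pi * (snd (snd (\<theta> z)) \<bullet> fst (\<alpha> (fst (\<theta> z)))))" for z
  have emb: "embS S k \<in> QSn S" if "\<And>i. k $ i \<in> ZS S" for k :: "real^'n"
    by (rule embS_in_QSn[OF S that])
  have latA_E: "\<exists>k l. z = ((fst (Ainf (k, l)), embS S k), (snd (Ainf (k, l)), embS S l)) \<and>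
      (\<forall>i. k $ i \<in> ZS S) \<and> (\<forall>i. l $ i \<in> ZS S)" if "z \<in> latA S Ainf" for z
    using that unfolding latA_def by blast
  have frc_C: "frc z \<in> ?C" if z: "z \<in> latA S Ainf" for z
    using latA_E[OF z] emb frp_in_FrS by (fastforce simp: frc_def)
  have shift: "tfsA S z (tensor1K S f) t = u z * (case \<theta> z of (c, l) \<Rightarrow> J c (tfsR l f)) t"
    if z: "z \<in> latA S Ainf" and t: "t \<in> space (AQ S)" for z t f
  proof -
    obtain k l where z_eq: "z = ((fst (Ainf (k, l)), embS S k), (snd (Ainf (k, l)), embS S l))"
      and kl: "\<And>i. k $ i \<in> ZS S" "\<And>i. l $ i \<in> ZS S"
      using latA_E[OF z] by blast
    have "tfsA S z (tensor1K S f) t = chif_phase S (embS S l) (frp (embS S k)) *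
       (tfsR (zinf z) f (fst t) * wQ S (frc z) (snd t))"
      unfolding z_eq by (subst tfsA_tensor1K[OF S emb[OF kl(1)] emb[OF kl(2)] t]) (simp add: zinf_def frc_def)
    also have "tfsR (zinf z) f (fst t) = cis (2 * pi * (snd (zinf z - \<alpha> (frc z)) \<bullet> fst (\<alpha> (frc z)))) *
        tfsR (\<alpha> (frc z)) (tfsR (zinf z - \<alpha> (frc z)) f) (fst t)"
      using tfsR_add[of "\<alpha> (frc z)" "zinf z - \<alpha> (frc z)" f "fst t"] by simp
    finally show ?thesis
      by (simp add: u_def \<theta>_def J_def frc_def z_eq mult_ac)
  qed
  \<comment> \<open>The real component alone determines a lattice point: \<open>Ainf\<close> is
    injective, and (k, l) determines the finite components.\<close>
  have inj: "inj_on \<theta> (latA S Ainf)"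
  proof (rule inj_onI)
    fix z z' assume z: "z \<in> latA S Ainf" "z' \<in> latA S Ainf" and eq: "\<theta> z = \<theta> z'"
    obtain k l where z_eq: "z = ((fst (Ainf (k, l)), embS S k), (snd (Ainf (k, l)), embS S l))"
      using latA_E[OF z(1)] by blast
    obtain k' l' where z'_eq: "z' = ((fst (Ainf (k', l')), embS S k'), (snd (Ainf (k', l')), embS S l'))"
      using latA_E[OF z(2)] by blast
    have "frc z = frc z'" "zinf z - \<alpha> (frc z) = zinf z' - \<alpha> (frc z')"
      using eq unfolding \<theta>_def prod.inject by blast+
    then have "zinf z = zinf z'" by (metis diff_add_cancel)
    then have "Ainf (k, l) = Ainf (k', l')" by (simp add: z_eq z'_eq zinf_def)
    then have "(k, l) = (k', l')" by (rule injD[OF bij_is_inj[OF bij]])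
    then show "z = z'" by (simp add: z_eq z'_eq)
  qed
  have image: "\<theta> ` latA S Ainf = ?C \<times> latR Ainf"
  proof
    show "\<theta> ` latA S Ainf \<subseteq> ?C \<times> latR Ainf"
    proof
      fix y assume "y \<in> \<theta> ` latA S Ainf"
      then obtain z where z: "z \<in> latA S Ainf" "y = \<theta> z" by blast
      obtain k l where z_eq: "z = ((fst (Ainf (k, l)), embS S k), (snd (Ainf (k, l)), embS S l))"
        and kl: "\<And>i. k $ i \<in> ZS S" "\<And>i. l $ i \<in> ZS S"
        using latA_E[OF z(1)] by blast
      have C: "frp (embS S k) \<in> FrS S" "frp (embS S l) \<in> FrS S"
        using emb[OF kl(1)] emb[OF kl(2)] by (simp_all add: frp_in_FrS)
      have "zinf z - \<alpha> (frc z) = Ainf (k - lift_rep S (frp (embS S k)), l - lift_rep S (frp (embS S l)))"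
        using linear_diff[OF lin, of "(k, l)" "(lift_rep S (frp (embS S k)), lift_rep S (frp (embS S l)))"]
        by (simp add: z_eq zinf_def \<alpha>_def frc_def)
      moreover have "\<forall>i. (k - lift_rep S (frp (embS S k))) $ i \<in> \<int>"
        using frp_embS_eq_iff[OF S kl(1) lift_rep(1)[OF S C(1)]] lift_rep(2)[OF S C(1)] by simp
      moreover have "\<forall>i. (l - lift_rep S (frp (embS S l))) $ i \<in> \<int>"
        using frp_embS_eq_iff[OF S kl(2) lift_rep(1)[OF S C(2)]] lift_rep(2)[OF S C(2)] by simp
      ultimately have "zinf z - \<alpha> (frc z) \<in> latR Ainf"
        unfolding latR_def by blast
      then show "y \<in> ?C \<times> latR Ainf"
        using frc_C[OF z(1)] z(2) by (simp add: \<theta>_def)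
    qed
    show "?C \<times> latR Ainf \<subseteq> \<theta> ` latA S Ainf"
    proof
      fix y assume "y \<in> ?C \<times> latR Ainf"
      then obtain F G m n where y: "y = ((F, G), Ainf (m, n))" and FG: "F \<in> FrS S" "G \<in> FrS S"
        and mn: "\<And>i. m $ i \<in> \<int>" "\<And>i. n $ i \<in> \<int>"
        unfolding latR_def by auto
      \<comment> \<open>An integer translate of the lift keeps its class and has the prescribed
        displacement after applying \<open>Ainf\<close>.\<close>
      define k where "k = lift_rep S F + m"
      define l where "l = lift_rep S G + n"
      have kl: "k $ i \<in> ZS S" "l $ i \<in> ZS S" for i
        unfolding k_def l_def vector_add_component
        by (intro ZS_add lift_rep(1)[OF S] FG ZS_Ints mn)+
      have "frp (embS S k) = F"
        using frp_embS_eq_iff[OF S kl(1) lift_rep(1)[OF S FG(1)]] mn lift_rep(2)[OF S FG(1)] by (simp add: k_def)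
      moreover have "frp (embS S l) = G"
        using frp_embS_eq_iff[OF S kl(2) lift_rep(1)[OF S FG(2)]] mn lift_rep(2)[OF S FG(2)] by (simp add: l_def)
      moreover define z where "z = ((fst (Ainf (k, l)), embS S k), (snd (Ainf (k, l)), embS S l))"
      ultimately have "frc z = (F, G)" by (simp add: frc_def)
      moreover have "Ainf (k, l) - Ainf (lift_rep S F, lift_rep S G) = Ainf (m, n)"
        unfolding linear_diff[OF lin, symmetric] by (simp add: k_def l_def)
      ultimately have "\<theta> z = y"
        by (simp add: \<theta>_def zinf_def z_def \<alpha>_def y)
      moreover have "z \<in> latA S Ainf"
        unfolding latA_def z_def using kl by blast
      ultimately show "y \<in> \<theta> ` latA S Ainf" by blast
    qed
  qed
  have "dual_frames (AQ S) (latA S Ainf) (\<lambda>z. tfsA S z (tensor1K S g)) (\<lambda>z. tfsA S z (tensor1K S h))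
    \<longleftrightarrow> dual_frames (AQ S) (?C \<times> latR Ainf) (\<lambda>(c, l). J c (tfsR l g)) (\<lambda>(c, l). J c (tfsR l h))"
  proof (rule dual_frames_reindex)
    show "bij_betw \<theta> (latA S Ainf) (?C \<times> latR Ainf)"
      using inj image by (simp add: bij_betw_def)
    show "norm (u z) = 1" for z
      by (simp add: u_def norm_mult norm_chif_phase)
  qed (rule shift; assumption)+
  also have "\<dots> \<longleftrightarrow> dual_frames lborel (latR Ainf) (\<lambda>z. tfsR z g) (\<lambda>z. tfsR z h)"
    \<comment> \<open>Restricting to one summand requires some class; the trivial one
      serves.\<close>
    using orthogonal_decomposition.dual_frames_lift[OF decomp, of "latR Ainf" "\<lambda>z. tfsR z g" "\<lambda>z. tfsR z h"]
      orthogonal_decomposition.dual_frames_restrict[OF decomp, of "(\<lambda>p i. 0, \<lambda>p i. 0)" "latR Ainf" "\<lambda>z. tfsR z g" "\<lambda>z. tfsR z h"]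
    by (auto simp: FrS_zero tfsR_L2 g h)
  finally show ?thesis ..
qed

theorem theorem6p11:
  fixes S :: "nat set"
    and g h :: "real^'n \<Rightarrow> complex"
    and Ainf :: "(real^'n) \<times> (real^'n) \<Rightarrow> (real^'n) \<times> (real^'n)"
  assumes S_primes: "\<forall>p\<in>S. prime p"
    and g_S0: "g \<in> S0 lborel (lborel \<Otimes>\<^sub>M lborel) tfsR"
    and h_S0: "h \<in> S0 lborel (lborel \<Otimes>\<^sub>M lborel) tfsR"
    and A_lin: "linear Ainf"
    and A_bij: "bij Ainf"
  shows "tensor1K S g \<in> S0 (AQ S) (AQ S \<Otimes>\<^sub>M AQ S) (tfsA S)
       \<and> tensor1K S h \<in> S0 (AQ S) (AQ S \<Otimes>\<^sub>M AQ S) (tfsA S)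
       \<and> (dual_frames lborel (latR Ainf) (\<lambda>z. tfsR z g) (\<lambda>z. tfsR z h)
          \<longleftrightarrow> dual_frames (AQ S) (latA S Ainf) (\<lambda>z. tfsA S z (tensor1K S g)) (\<lambda>z. tfsA S z (tensor1K S h)))"
  using tensor1K_S0[OF S_primes g_S0] tensor1K_S0[OF S_primes h_S0]
    dual_frames_adelic[OF S_primes _ _ A_lin A_bij, of g h] g_S0 h_S0
  by (simp add: S0_def)

end
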